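(* Let $\Theta\subset\mathbb{R}^p$ be compact and convex with smooth boundary, $\theta_0$ an interior point of $\Theta$, and let $\Theta\to M(T)$, $\theta\mapsto\mu_\theta$, be continuous and belong to $C^2(\Theta;M(T))$ and to $C^3(\Theta;M(T))$. Suppose that for $\theta\in\Theta$, $\mathcal{K}\mu_\theta(t)=\mathcal{K}\mu_{\theta_0}(t)$ for all $t\in T$ implies $\theta=\theta_0$, and that the $p\times p$ matrix $\Sigma$ with entries $\Sigma_{ij}=\langle\partial_i\mu_{\theta_0},\mathcal{K}\partial_j\mu_{\theta_0}\rangle$ is regular (invertible). Consider a joint limit $\varepsilon\to0$, $n\to\infty$ (i.e. any sequence of pairs $(\varepsilon,n)$ with $\varepsilon\to0$ and $n\to\infty$) along which $\varepsilon^{-1}\|K^n-K\|_{L^\infty}\to0$ and moreover $\varepsilon^{-2}\|K^n-K\|_{L^\infty}\to0$. Let $\hat\theta_{n,\varepsilon}\in\Theta$ be a maximizer over $\Theta$ of $\Phi_{n,\varepsilon}$. Then, in this limit, $$\mathbb{E}\big[\Phi_{n,\varepsilon}(\hat\theta_{n,\varepsilon})-\Phi(\hat\theta_{n,\varepsilon})\big]=p\,\varepsilon^2+o(\varepsilon^2).$$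
   Context: $T=[0,\tau]$ is a closed bounded interval; $C(T)$ is the Banach space of continuous real functions on $T$ with the sup norm; $M(T)=C(T)^*$ is the space of finite signed Borel measures on $T$ with the total variation norm; $\langle\mu,x\rangle=\int_T x_t\,\mu(dt)$. $Z$ is a centered Gaussian vector on $C(T)$, i.e. a $C(T)$-valued random vector on a probability space $(\Omega,\mathbb{P})$ such that $\langle\mu,Z\rangle$ is a centered normal variable for every $\mu\in M(T)$. Its covariance function $K(s,t)=\mathrm{Cov}[Z_s,Z_t]$ is continuous on $T^2$ and its covariance operator $\mathcal{K}:M(T)\to C(T)$ is $(\mathcal{K}\mu)(s)=\int_T K(s,t)\,\mu(dt)$. For each $n\in\mathbb{N}$ let $0=t_0<t_1<\dots<t_n=\tau$ (points depending on $n$) with $\lim_{n\to\infty}\sup_{i}|t_i-t_{i-1}|=0$, and $T_1=[0,t_1]$, $T_i=(t_{i-1},t_i]$ for $i\ge2$. $K^n=\sum_{i,j=1}^nK(t_i,t_j)\mathbf{1}_{T_i\times T_j}$, and $\|\cdot\|_{L^\infty}$ is the norm of $L^\infty(T^2)$. With $h_0=\mathcal{K}\mu_{\theta_0}$ and $X^\varepsilon=h_0+\varepsilon Z$ ($\varepsilon>0$), $$\Phi_{n,\varepsilon}(\theta)=\sum_{i=1}^n\mu_\theta(T_i)X^\varepsilon_{t_i}-\frac12\sum_{i,j=1}^n\mu_\theta(T_i)\mu_\theta(T_j)K(t_i,t_j),\qquad \Phi(\theta)=\langle\mu_\theta,h_0\rangle-\tfrac12\langle\mu_\theta,\mathcal{K}\mu_\theta\rangle.$$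 The maximizer $\hat\theta_{n,\varepsilon}$ is understood to be chosen as a random variable. $C^k(\Theta;M(T))$ is the set of maps $\theta\mapsto\mu_\theta$ from $\Theta$ to $M(T)$ that are $k$ times Fréchet differentiable (total variation norm on $M(T)$) with uniformly continuous partial derivatives of order $k$; that is, differentiable in the interior of $\Theta$, with partial derivatives of order at most $k$ extending continuously to $\Theta$. $\partial_i=\partial/\partial\theta_i$. *)

theory Defs
  imports "HOL-Probability.Probability"
begin

section \<open>Finite signed Borel measures\<close>

text \<open>A real-valued countably additive set function is automatically finite and bounded.  Its value
  on non-Borel sets is normalised to 0, so that distinct set functions are distinct measures.\<close>

definition signed_borel :: "('a::topological_space set \<Rightarrow> real) \<Rightarrow> bool" where
  "signed_borel m \<longleftrightarrow> (\<forall>A. A \<notin> sets borel \<longrightarrow> m A = 0) \<and>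
     (\<forall>F::nat \<Rightarrow> 'a set. range F \<subseteq> sets borel \<longrightarrow> disjoint_family F \<longrightarrow>
        (\<lambda>i. m (F i)) sums m (\<Union>i. F i))"

lemma signed_borel_sums:
  assumes "signed_borel m" "range F \<subseteq> sets borel" "disjoint_family F"
  shows "(\<lambda>i::nat. m (F i)) sums m (\<Union>i. F i)"
  using assms unfolding signed_borel_def by blast

lemma signed_borel_empty: "signed_borel m \<Longrightarrow> m {} = 0"
proof -
  assume "signed_borel m"
  from signed_borel_sums[OF this, of "\<lambda>_. {}"]
  have "summable (\<lambda>i::nat. m {})" by (auto simp: disjoint_family_on_def sums_iff)
  then show ?thesis by (simp add: summable_const_iff)
qed

lemma signed_borel_Un:
  assumes "signed_borel m" "A \<in> sets borel" "B \<in> sets borel" "A \<inter> B = {}"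
  shows "m (A \<union> B) = m A + m B"
proof -
  have "disjoint_family (binaryset A B)"
    using assms(4) by (auto simp: disjoint_family_on_def binaryset_def)
  moreover have "range (binaryset A B) \<subseteq> sets borel"
    using assms by (auto simp: binaryset_def)
  ultimately have "(\<lambda>i. m (binaryset A B i)) sums m (A \<union> B)"
    using signed_borel_sums[OF assms(1), of "binaryset A B"] by (simp add: UN_binaryset_eq)
  moreover have "(\<lambda>i. m (binaryset A B i)) sums (m A + m B)"
    by (rule binaryset_sums) (rule signed_borel_empty[OF assms(1)])
  ultimately show ?thesis by (rule sums_unique2)
qed

lemma signed_borel_Diff:
  assumes "signed_borel m" "A \<in> sets borel" "B \<in> sets borel" "B \<subseteq> A"
  shows "m (A - B) = m A - m B"
  proof -
  have "(A - B) \<inter> B = {}" by blast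
  from signed_borel_Un[OF assms(1) _ assms(3) this] assms show ?thesis
    by (simp add: Un_absorb2)
qed

lemma signed_borel_Int:
  assumes "signed_borel m" "A \<in> sets borel" "B \<in> sets borel"
  shows "m A = m (A \<inter> B) + m (A - B)"
  using signed_borel_Un[OF assms(1), of "A \<inter> B" "A - B"] assms
  by (simp add: Int_Diff_disjoint Int_Diff_Un)

lemma signed_borel_bounded:
  fixes m :: "'a::topological_space set \<Rightarrow> real"
  assumes m: "signed_borel m"
  obtains C where "\<And>A. \<bar>m A\<bar> \<le> C"
proof -
  define bad where "bad A \<longleftrightarrow> A \<in> sets borel \<and>
    (\<forall>C. \<exists>B\<in>sets borel. B \<subseteq> A \<and> \<bar>m B\<bar> > C)" for A
  have step: "\<exists>A'. bad A' \<and> A' \<subseteq> A \<and> \<bar>m (A - A')\<bar> > 1" if A: "bad A" for A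
  proof -
    from A obtain B where B: "B \<in> sets borel" "B \<subseteq> A" "\<bar>m B\<bar> > \<bar>m A\<bar> + 1"
      unfolding bad_def by blast
    have AB: "A \<in> sets borel" "A - B \<in> sets borel" using A B by (auto simp: bad_def)
    have d: "m (A - B) = m A - m B" using m AB(1) B(1,2) by (rule signed_borel_Diff)
    show ?thesis
    proof (cases "bad B")
      case True
      then show ?thesis using B d by (intro exI[of _ B]) auto
    next
      case False
      then obtain C where C: "\<And>E. E \<in> sets borel \<Longrightarrow> E \<subseteq> B \<Longrightarrow> \<bar>m E\<bar> \<le> C"
        using B unfolding bad_def by (meson not_le)
      have "bad (A - B)"
        unfolding bad_def
      proof (intro conjI allI)
        show "A - B \<in> sets borel" by fact
        fix D
        from A obtain E where E: "E \<in> sets borel" "E \<subseteq> A" "\<bar>m E\<bar> > C + D"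
          unfolding bad_def by blast
        have "m E = m (E \<inter> B) + m (E - B)" using m E(1) B(1) by (rule signed_borel_Int)
        moreover have "\<bar>m (E \<inter> B)\<bar> \<le> C" using E B by (intro C) auto
        ultimately have "\<bar>m (E - B)\<bar> > D" using E by linarith
        then show "\<exists>E'\<in>sets borel. E' \<subseteq> A - B \<and> \<bar>m E'\<bar> > D"
          using E B by (intro bexI[of _ "E - B"]) auto
      qed
      moreover have "A - (A - B) = B" using B by auto
      ultimately show ?thesis using B by (intro exI[of _ "A - B"]) auto
    qed
  qed
  have "\<not> bad UNIV"
  proof
    assume "bad UNIV"
    from dependent_nat_choice[of "\<lambda>_. bad" "\<lambda>_ A A'. A' \<subseteq> A \<and> \<bar>m (A - A')\<bar> > 1"] step this
    obtain f where f: "\<And>n. bad (f n)" "\<And>n. f (Suc n) \<subseteq> f n" "\<And>n. \<bar>m (f n - f (Suc n))\<bar> > 1"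
      by metis
    define F where "F n = f n - f (Suc n)" for n
    have dec: "f j \<subseteq> f i" if "i \<le> j" for i j
      using that f(2) by (rule lift_Suc_antimono_le[rotated])
    have "disjoint_family F"
      unfolding disjoint_family_on_def
    proof (intro ballI impI)
      fix i j :: nat assume "i \<noteq> j"
      then have "Suc i \<le> j \<or> Suc j \<le> i" by linarith
      then show "F i \<inter> F j = {}"
        using dec[of "Suc i" j] dec[of "Suc j" i] by (auto simp: F_def)
    qed
    moreover have "range F \<subseteq> sets borel" using f(1) by (auto simp: F_def bad_def)
    ultimately have "summable (\<lambda>i. m (F i))"
      using signed_borel_sums[OF m] sums_summable by blast
    then have "(\<lambda>i. m (F i)) \<longlonglongrightarrow> 0" by (rule summable_LIMSEQ_zero)
    then have "eventually (\<lambda>i. \<bar>m (F i)\<bar> < 1) sequentially"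
      using order_tendstoD(2)[OF tendsto_rabs_zero, of _ _ 1] by auto
    then obtain i where "\<bar>m (F i)\<bar> < 1" by (auto simp: eventually_sequentially)
    then show False using f(3)[of i] by (simp add: F_def)
  qed
  then obtain C where "\<And>B. B \<in> sets borel \<Longrightarrow> \<bar>m B\<bar> \<le> C"
    unfolding bad_def by (auto simp: not_less)
  then have "\<bar>m B\<bar> \<le> max C 0" for B
    using m by (cases "B \<in> sets borel") (auto simp: signed_borel_def intro: le_max_iff_disj[THEN iffD2])
  then show thesis by (rule that)
qed

lemma signed_borel_finite_Union:
  assumes m: "signed_borel m" and "finite P" "P \<subseteq> sets borel" "disjoint P"
  shows "m (\<Union>P) = (\<Sum>A\<in>P. m A)"
  using assms(2-)
proof (induction P rule: finite_induct)
  case empty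
  then show ?case using signed_borel_empty[OF m] by simp
next
  case (insert A P)
  have "A \<inter> \<Union>P = {}" using insert by (auto simp: disjoint_def)
  moreover have "\<Union>P \<in> sets borel" using insert by (intro sets.finite_Union) auto
  moreover have "disjoint P" using insert by (auto simp: disjoint_def)
  ultimately show ?case
    using insert signed_borel_Un[OF m, of A "\<Union>P"] by simp
qed

definition total_variation :: "('a::topological_space set \<Rightarrow> real) \<Rightarrow> real" where
  "total_variation m =
     (SUP P\<in>{P. finite P \<and> P \<subseteq> sets borel \<and> partition_on UNIV P}. \<Sum>A\<in>P. \<bar>m A\<bar>)"

lemma total_variation_bdd:
  fixes m :: "'a::topological_space set \<Rightarrow> real"
  assumes m: "signed_borel m"
  shows "bdd_above ((\<lambda>P. \<Sum>A\<in>P. \<bar>m A\<bar>) `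
    {P. finite P \<and> P \<subseteq> sets borel \<and> partition_on UNIV P})"
proof -
  obtain C where C: "\<And>A. \<bar>m A\<bar> \<le> C" using signed_borel_bounded[OF m] by blast
  show ?thesis
  proof (rule bdd_aboveI2[where M = "2 * C"])
    fix P :: "'a set set"
    assume "P \<in> {P. finite P \<and> P \<subseteq> sets borel \<and> partition_on UNIV P}"
    then have P: "finite P" "P \<subseteq> sets borel" "disjoint P"
      by (auto simp: partition_on_def)
    let ?p = "{A\<in>P. m A \<ge> 0}" and ?n = "{A\<in>P. \<not> m A \<ge> 0}"
    have "(\<Sum>A\<in>P. \<bar>m A\<bar>) = (\<Sum>A\<in>?p. \<bar>m A\<bar>) + (\<Sum>A\<in>?n. \<bar>m A\<bar>)"
      using P(1) by (subst sum.union_disjoint[symmetric]) (auto intro!: sum.cong)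
    also have "\<dots> = (\<Sum>A\<in>?p. m A) - (\<Sum>A\<in>?n. m A)"
      by (simp add: sum_negf[symmetric])
    also have "\<dots> = m (\<Union>?p) - m (\<Union>?n)"
      using P by (subst (1 2) signed_borel_finite_Union[OF m]) (auto simp: disjoint_def)
    also have "\<dots> \<le> 2 * C" using C[of "\<Union>?p"] C[of "\<Union>?n"] by linarith
    finally show "(\<Sum>A\<in>P. \<bar>m A\<bar>) \<le> 2 * C" .
  qed
qed

lemma total_variation_upper:
  assumes "signed_borel m" "finite P" "P \<subseteq> sets borel" "partition_on UNIV P"
  shows "(\<Sum>A\<in>P. \<bar>m A\<bar>) \<le> total_variation m"
  unfolding total_variation_def using assms by (intro cSUP_upper total_variation_bdd) auto

lemma total_variation_least:
  assumes "\<And>P. finite P \<Longrightarrow> P \<subseteq> sets borel \<Longrightarrow> partition_on UNIV P \<Longrightarrow>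
    (\<Sum>A\<in>P. \<bar>m A\<bar>) \<le> c"
  shows "total_variation (m :: 'a::topological_space set \<Rightarrow> real) \<le> c"
proof -
  have "{UNIV :: 'a set} \<in> {P. finite P \<and> P \<subseteq> sets borel \<and> partition_on UNIV P}"
    by (auto simp: partition_on_def)
  then show ?thesis unfolding total_variation_def using assms by (intro cSUP_least) blast+
qed

lemma abs_le_total_variation:
  assumes m: "signed_borel m"
  shows "\<bar>m A\<bar> \<le> total_variation m"
proof -
  have U: "\<bar>m UNIV\<bar> \<le> total_variation m"
    using total_variation_upper[OF m, of "{UNIV}"] by (auto simp: partition_on_def)
  show ?thesis
  proof (cases "A \<in> sets borel \<and> A \<noteq> {} \<and> A \<noteq> UNIV")
    case True
    then have "(\<Sum>B\<in>{A, - A}. \<bar>m B\<bar>) \<le> total_variation m"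
      by (intro total_variation_upper[OF m]) (auto simp: partition_on_def disjoint_def)
    moreover have "A \<noteq> - A" by auto
    ultimately show ?thesis by simp
  next
    case False
    then show ?thesis using U m signed_borel_empty[OF m] by (auto simp: signed_borel_def)
  qed
qed

lemma signed_borel_lincomb:
  assumes "signed_borel m" "signed_borel m'"
  shows "signed_borel (\<lambda>A. a * m A + b * m' A)"
  using assms unfolding signed_borel_def by (auto intro!: sums_add sums_mult)

typedef (overloaded) 'a::topological_space signed_measure =
  "{m :: 'a set \<Rightarrow> real. signed_borel m}"
  morphisms smeasure Abs_signed_measure
  by (rule exI[of _ "\<lambda>_. 0"]) (simp add: signed_borel_def)

setup_lifting type_definition_signed_measure

lemma signed_borel_smeasure: "signed_borel (smeasure \<mu>)"
  using smeasure by blast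

instantiation signed_measure :: (topological_space) real_normed_vector
begin

lift_definition zero_signed_measure :: "'a signed_measure" is "\<lambda>_. 0"
  by (simp add: signed_borel_def)

lift_definition plus_signed_measure ::
  "'a signed_measure \<Rightarrow> 'a signed_measure \<Rightarrow> 'a signed_measure" is "\<lambda>m m' A. m A + m' A"
  using signed_borel_lincomb[of _ _ 1 1] by simp

lift_definition minus_signed_measure ::
  "'a signed_measure \<Rightarrow> 'a signed_measure \<Rightarrow> 'a signed_measure" is "\<lambda>m m' A. m A - m' A"
  using signed_borel_lincomb[of _ _ 1 "-1"] by simp

lift_definition uminus_signed_measure :: "'a signed_measure \<Rightarrow> 'a signed_measure"
  is "\<lambda>m A. - m A"
  using signed_borel_lincomb[of _ _ 0 "-1"] by simp

lift_definition scaleR_signed_measure :: "real \<Rightarrow> 'a signed_measure \<Rightarrow> 'a signed_measure"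
  is "\<lambda>c m A. c * m A"
  using signed_borel_lincomb[of _ _ _ 0] by simp

lift_definition norm_signed_measure :: "'a signed_measure \<Rightarrow> real" is total_variation .

definition sgn_signed_measure :: "'a signed_measure \<Rightarrow> 'a signed_measure" where
  "sgn_signed_measure \<mu> = inverse (norm \<mu>) *\<^sub>R \<mu>"

definition dist_signed_measure :: "'a signed_measure \<Rightarrow> 'a signed_measure \<Rightarrow> real" where
  "dist_signed_measure \<mu> \<nu> = norm (\<mu> - \<nu>)"

definition uniformity_signed_measure :: "('a signed_measure \<times> 'a signed_measure) filter" where
  "uniformity_signed_measure = (INF e\<in>{0 <..}. principal {(x, y). dist x y < e})"

definition open_signed_measure :: "'a signed_measure set \<Rightarrow> bool" where
  "open_signed_measure S = (\<forall>x\<in>S. \<forall>\<^sub>F (x', y) in uniformity. x' = x \<longrightarrow> y \<in> S)"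

instance
proof
  fix \<mu> \<nu> \<rho> :: "'a signed_measure" and a b :: real
  show "\<mu> + \<nu> + \<rho> = \<mu> + (\<nu> + \<rho>)" "\<mu> + \<nu> = \<nu> + \<mu>" "0 + \<mu> = \<mu>" "- \<mu> + \<mu> = 0"
    "\<mu> - \<nu> = \<mu> + - \<nu>" "a *\<^sub>R (\<mu> + \<nu>) = a *\<^sub>R \<mu> + a *\<^sub>R \<nu>"
    "(a + b) *\<^sub>R \<mu> = a *\<^sub>R \<mu> + b *\<^sub>R \<mu>" "a *\<^sub>R b *\<^sub>R \<mu> = (a * b) *\<^sub>R \<mu>" "1 *\<^sub>R \<mu> = \<mu>"
    by (transfer, simp add: fun_eq_iff algebra_simps)+
  show "dist \<mu> \<nu> = norm (\<mu> - \<nu>)" by (rule dist_signed_measure_def)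
  show "sgn \<mu> = inverse (norm \<mu>) *\<^sub>R \<mu>" by (rule sgn_signed_measure_def)
  show "(uniformity :: ('a signed_measure \<times> _) filter) =
    (INF e\<in>{0 <..}. principal {(x, y). dist x y < e})"
    by (rule uniformity_signed_measure_def)
  show "open S = (\<forall>x\<in>S. \<forall>\<^sub>F (x', y) in uniformity. x' = x \<longrightarrow> y \<in> S)"
    for S :: "'a signed_measure set"
    by (rule open_signed_measure_def)
  show "norm \<mu> = 0 \<longleftrightarrow> \<mu> = 0"
  proof (transfer, intro iffI ext)
    fix m :: "'a set \<Rightarrow> real" and A assume "signed_borel m" "total_variation m = 0"
    then show "m A = 0" using abs_le_total_variation[of m A] by simp
  next
    fix m :: "'a set \<Rightarrow> real" assume m: "signed_borel m" "m = (\<lambda>_. 0)"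
    have "total_variation m \<le> 0" by (rule total_variation_least) (simp add: m)
    then show "total_variation m = 0" using abs_le_total_variation[OF m(1), of UNIV] by simp
  qed
  show "norm (\<mu> + \<nu>) \<le> norm \<mu> + norm \<nu>"
  proof (transfer, rule total_variation_least)
    fix m m' :: "'a set \<Rightarrow> real" and P :: "'a set set"
    assume *: "signed_borel m" "signed_borel m'" "finite P" "P \<subseteq> sets borel" "partition_on UNIV P"
    have "(\<Sum>A\<in>P. \<bar>m A + m' A\<bar>) \<le> (\<Sum>A\<in>P. \<bar>m A\<bar> + \<bar>m' A\<bar>)"
      by (intro sum_mono abs_triangle_ineq)
    also have "\<dots> \<le> total_variation m + total_variation m'"
      unfolding sum.distrib using * by (intro add_mono total_variation_upper) auto
    finally show "(\<Sum>A\<in>P. \<bar>m A + m' A\<bar>) \<le> total_variation m + total_variation m'" .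
  qed
  have le: "norm (c *\<^sub>R \<kappa>) \<le> \<bar>c\<bar> * norm \<kappa>" for c :: real and \<kappa> :: "'a signed_measure"
  proof (transfer, rule total_variation_least)
    fix c :: real and m :: "'a set \<Rightarrow> real" and P :: "'a set set"
    assume *: "signed_borel m" "finite P" "P \<subseteq> sets borel" "partition_on UNIV P"
    have "(\<Sum>A\<in>P. \<bar>c * m A\<bar>) = \<bar>c\<bar> * (\<Sum>A\<in>P. \<bar>m A\<bar>)"
      by (simp add: abs_mult sum_distrib_left)
    also have "\<dots> \<le> \<bar>c\<bar> * total_variation m"
      using * by (intro mult_left_mono total_variation_upper) auto
    finally show "(\<Sum>A\<in>P. \<bar>c * m A\<bar>) \<le> \<bar>c\<bar> * total_variation m" .
  qed
  show "norm (a *\<^sub>R \<mu>) = \<bar>a\<bar> * norm \<mu>"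
  proof (cases "a = 0")
    case True
    have "norm (0::'a signed_measure) \<ge> 0"
      using le[of "-1" 0] le[of 0 "0 :: 'a signed_measure"]
      by transfer (use abs_le_total_variation[of "\<lambda>_. 0"] in \<open>auto simp: signed_borel_def\<close>)
    moreover have "a *\<^sub>R \<mu> = 0" using True by transfer simp
    moreover have "norm (a *\<^sub>R \<mu>) \<le> 0" using le[of a \<mu>] True by simp
    ultimately show ?thesis using True by simp
  next
    case False
    have "inverse a *\<^sub>R a *\<^sub>R \<mu> = \<mu>" using False by transfer (simp add: fun_eq_iff)
    then have "norm \<mu> \<le> \<bar>inverse a\<bar> * norm (a *\<^sub>R \<mu>)" using le[of "inverse a" "a *\<^sub>R \<mu>"] by simp
    then have "\<bar>a\<bar> * norm \<mu> \<le> norm (a *\<^sub>R \<mu>)" using False by (simp add: field_simps)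
    then show ?thesis using le[of a \<mu>] by simp
  qed
qed

end

text \<open>Jordan decomposition.\<close>

definition pos_part :: "'a::topological_space signed_measure \<Rightarrow> 'a measure" where
  "pos_part \<mu> = measure_of UNIV (sets borel)
     (\<lambda>A. ennreal (SUP B\<in>{B \<in> sets borel. B \<subseteq> A}. smeasure \<mu> B))"

definition neg_part :: "'a::topological_space signed_measure \<Rightarrow> 'a measure" where
  "neg_part \<mu> = pos_part (- \<mu>)"

lemma sets_pos_part [simp, measurable_cong]: "sets (pos_part \<mu>) = sets borel"
proof -
  have "sigma_sets UNIV (sets (borel :: 'a measure)) = sets borel"
    using sets.sigma_sets_eq[of "borel :: 'a measure"] by simp
  then show ?thesis by (simp add: pos_part_def)
qed

lemma sets_neg_part [simp, measurable_cong]: "sets (neg_part \<mu>) = sets borel"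
  by (simp add: neg_part_def)

lemma bdd_above_smeasure: "bdd_above (smeasure \<mu> ` S)"
proof -
  obtain C where "\<And>A. \<bar>smeasure \<mu> A\<bar> \<le> C"
    using signed_borel_bounded[OF signed_borel_smeasure] by blast
  then show ?thesis by (intro bdd_aboveI2[where M = C]) (rule order_trans[OF abs_ge_self])
qed

lemma emeasure_pos_part:
  assumes A: "A \<in> sets borel"
  shows "emeasure (pos_part \<mu>) A =
    ennreal (SUP B\<in>{B \<in> sets borel. B \<subseteq> A}. smeasure \<mu> B)"
proof -
  note sb = signed_borel_smeasure[of \<mu>]
  define S where "S A = (SUP B\<in>{B \<in> sets borel. B \<subseteq> A}. smeasure \<mu> B)" for A
  have up: "smeasure \<mu> B \<le> S E" if "B \<in> sets borel" "B \<subseteq> E" for B E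
    unfolding S_def using that by (intro cSUP_upper bdd_above_smeasure) auto
  have least: "S E \<le> c" if "\<And>B. B \<in> sets borel \<Longrightarrow> B \<subseteq> E \<Longrightarrow> smeasure \<mu> B \<le> c" for E c
    unfolding S_def using that by (intro cSUP_least) auto
  have nonneg: "S E \<ge> 0" for E using up[of "{}" E] signed_borel_empty[OF sb] by simp
  have mono: "S E \<le> S E'" if "E \<subseteq> E'" for E E' using that by (intro least up) auto
  have super: "S E + S E' \<le> S (E \<union> E')" if "E \<inter> E' = {}" for E E'
  proof -
    have "S E \<le> S (E \<union> E') - S E'"
    proof (rule least)
      fix B assume B: "B \<in> sets borel" "B \<subseteq> E"
      have "S E' \<le> S (E \<union> E') - smeasure \<mu> B"
      proof (rule least)
        fix B' assume B': "B' \<in> sets borel" "B' \<subseteq> E'"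
        have "smeasure \<mu> (B \<union> B') = smeasure \<mu> B + smeasure \<mu> B'"
          using B B' that by (intro signed_borel_Un[OF sb]) auto
        moreover have "smeasure \<mu> (B \<union> B') \<le> S (E \<union> E')" using B B' by (intro up) auto
        ultimately show "smeasure \<mu> B' \<le> S (E \<union> E') - smeasure \<mu> B" by simp
      qed
      then show "smeasure \<mu> B \<le> S (E \<union> E') - S E'" by simp
    qed
    then show ?thesis by simp
  qed
  have "countably_additive (sets borel) (\<lambda>A. ennreal (S A))"
    unfolding countably_additive_def
  proof (intro allI impI)
    fix F :: "nat \<Rightarrow> 'a set"
    assume F: "range F \<subseteq> sets borel" "disjoint_family F"
    have part: "(\<Sum>i<n. S (F i)) \<le> S (\<Union>i<n. F i)" for n
    proof (induction n)
      case 0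
      then show ?case by (simp add: nonneg)
    next
      case (Suc n)
      have "F i \<inter> F n = {}" if "i < n" for i using F(2) that by (auto simp: disjoint_family_on_def)
      then have "(\<Union>i<n. F i) \<inter> F n = {}" by blast
      from super[OF this] Suc show ?case by (simp add: lessThan_Suc Un_commute)
    qed
    have le: "(\<Sum>i<n. S (F i)) \<le> S (\<Union>i. F i)" for n
      using part[of n] mono[of "\<Union>i<n. F i" "\<Union>i. F i"] by (auto intro: order_trans)
    have sm: "summable (\<lambda>i. S (F i))"
      by (rule summableI_nonneg_bounded[OF nonneg le])
    have "S (\<Union>i. F i) \<le> (\<Sum>i. S (F i))"
    proof (rule least)
      fix B assume B: "B \<in> sets borel" "B \<subseteq> (\<Union>i. F i)"
      have "disjoint_family (\<lambda>i. B \<inter> F i)"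
        using F(2) unfolding disjoint_family_on_def by blast
      then have "(\<lambda>i. smeasure \<mu> (B \<inter> F i)) sums smeasure \<mu> (\<Union>i. B \<inter> F i)"
        using B F by (intro signed_borel_sums[OF sb]) auto
      moreover have "(\<Union>i. B \<inter> F i) = B" using B by auto
      ultimately have sums: "(\<lambda>i. smeasure \<mu> (B \<inter> F i)) sums smeasure \<mu> B" by simp
      have "smeasure \<mu> (B \<inter> F i) \<le> S (F i)" for i
        using B F by (intro up) auto
      from sums_le[OF this sums summable_sums[OF sm]]
      show "smeasure \<mu> B \<le> (\<Sum>i. S (F i))" .
    qed
    moreover have "(\<Sum>i. S (F i)) \<le> S (\<Union>i. F i)"
      by (rule suminf_le_const[OF sm le])
    ultimately have "(\<lambda>i. S (F i)) sums S (\<Union>i. F i)"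
      using summable_sums[OF sm] by (metis order_antisym)
    then show "(\<Sum>i. ennreal (S (F i))) = ennreal (S (\<Union>i. F i))"
      by (intro suminf_ennreal_eq nonneg)
  qed
  moreover have "positive (sets borel) (\<lambda>A. ennreal (S A))"
  proof -
    have "S {} \<le> 0" using signed_borel_empty[OF sb] by (intro least) auto
    then show ?thesis by (simp add: positive_def ennreal_neg)
  qed
  ultimately show ?thesis
    using A sets.sigma_algebra_axioms[of "borel :: 'a measure"]
    unfolding S_def pos_part_def
    by (intro emeasure_measure_of_sigma) (auto simp: space_borel)
qed

lemma smeasure_Jordan:
  assumes A: "A \<in> sets borel"
  shows "smeasure \<mu> A = measure (pos_part \<mu>) A - measure (neg_part \<mu>) A"
proof -
  note sb = signed_borel_smeasure
  define S where "S \<nu> = (SUP B\<in>{B \<in> sets borel. B \<subseteq> A}. smeasure \<nu> B)" for \<nu> :: "'a signed_measure"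
  have up: "smeasure \<nu> B \<le> S \<nu>" if "B \<in> sets borel" "B \<subseteq> A" for B and \<nu> :: "'a signed_measure"
    unfolding S_def using that by (intro cSUP_upper bdd_above_smeasure) auto
  have least: "S \<nu> \<le> c" if "\<And>B. B \<in> sets borel \<Longrightarrow> B \<subseteq> A \<Longrightarrow> smeasure \<nu> B \<le> c"
    for c and \<nu> :: "'a signed_measure"
    unfolding S_def using that by (intro cSUP_least) auto
  have nonneg: "S \<nu> \<ge> 0" for \<nu>
    using up[of "{}" \<nu>] signed_borel_empty[OF sb, of \<nu>] by simp
  have m: "measure (pos_part \<nu>) A = S \<nu>" for \<nu>
    using emeasure_pos_part[OF A, of \<nu>] nonneg[of \<nu>] by (simp add: measure_def S_def)
  have neg: "smeasure (- \<mu>) B = - smeasure \<mu> B" for B by transfer simp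
  have diff: "smeasure \<mu> (A - B) = smeasure \<mu> A - smeasure \<mu> B" if "B \<in> sets borel" "B \<subseteq> A" for B
    using that A by (intro signed_borel_Diff[OF sb])
  have "S (- \<mu>) \<le> S \<mu> - smeasure \<mu> A"
    using A by (intro least) (use up[of "A - B" \<mu> for B] diff in \<open>fastforce simp: neg\<close>)
  moreover have "S \<mu> \<le> smeasure \<mu> A + S (- \<mu>)"
    using A by (intro least) (use up[of "A - B" "- \<mu>" for B] diff in \<open>fastforce simp: neg\<close>)
  ultimately show ?thesis by (simp add: m neg_part_def)
qed

definition measures_on :: "'a::topological_space set \<Rightarrow> 'a signed_measure set" where
  "measures_on T = {\<mu>. \<forall>A\<in>sets borel. A \<inter> T = {} \<longrightarrow> smeasure \<mu> A = 0}"

definition pairing :: "'a::topological_space set \<Rightarrow> 'a signed_measure \<Rightarrow> ('a \<Rightarrow> real) \<Rightarrow> real" where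
  "pairing T \<mu> x = (LINT t:T|pos_part \<mu>. x t) - (LINT t:T|neg_part \<mu>. x t)"


section \<open>Gaussian vectors on \<open>C(T)\<close>\<close>

text \<open>The elements of \<open>C_metric T\<close> are extensional: they take the value \<open>undefined\<close> outside \<open>T\<close>.\<close>

definition C_metric :: "real set \<Rightarrow> (real \<Rightarrow> real) metric" where
  "C_metric T = cfunspace (top_of_set T) euclidean_metric"

definition C_borel :: "real set \<Rightarrow> (real \<Rightarrow> real) measure" where
  "C_borel T = sigma (mspace (C_metric T)) {U. openin (mtopology_of (C_metric T)) U}"

text \<open>The point mass at 0 counts as a normal distribution.\<close>

definition centered_normal :: "'w measure \<Rightarrow> ('w \<Rightarrow> real) \<Rightarrow> bool" where
  "centered_normal M X \<longleftrightarrow> X \<in> borel_measurable M \<and>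
     ((AE \<omega> in M. X \<omega> = 0) \<or>
      (\<exists>\<sigma>>0. distributed M lborel X (\<lambda>x. ennreal (normal_density 0 \<sigma> x))))"

definition centered_gaussian_vector ::
  "'w measure \<Rightarrow> real set \<Rightarrow> ('w \<Rightarrow> real \<Rightarrow> real) \<Rightarrow> bool" where
  "centered_gaussian_vector M T Z \<longleftrightarrow> Z \<in> M \<rightarrow>\<^sub>M C_borel T \<and>
     (\<forall>\<mu>\<in>measures_on T. centered_normal M (\<lambda>\<omega>. pairing T \<mu> (Z \<omega>)))"

definition cov_fun :: "'w measure \<Rightarrow> ('w \<Rightarrow> real \<Rightarrow> real) \<Rightarrow> real \<Rightarrow> real \<Rightarrow> real" where
  "cov_fun M Z s t =
     (\<integral>\<omega>. (Z \<omega> s - (\<integral>\<omega>'. Z \<omega>' s \<partial>M)) * (Z \<omega> t - (\<integral>\<omega>'. Z \<omega>' t \<partial>M)) \<partial>M)"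

definition cov_op ::
  "real set \<Rightarrow> (real \<Rightarrow> real \<Rightarrow> real) \<Rightarrow> real signed_measure \<Rightarrow> real \<Rightarrow> real" where
  "cov_op T K \<mu> s = pairing T \<mu> (\<lambda>t. K s t)"


section \<open>Differentiability classes\<close>

definition partial_deriv ::
  "'p::finite \<Rightarrow> (real^'p \<Rightarrow> 'b::real_normed_vector) \<Rightarrow> real^'p \<Rightarrow> 'b" where
  "partial_deriv i f x = frechet_derivative f (at x) (axis i 1)"

definition partial_derivs ::
  "'p::finite list \<Rightarrow> (real^'p \<Rightarrow> 'b::real_normed_vector) \<Rightarrow> real^'p \<Rightarrow> 'b" where
  "partial_derivs is f = fold partial_deriv is f"

text \<open>On an open subset of \<open>\<real>\<^sup>p\<close>, \<open>k\<close>-fold Frechet differentiability amounts to Frechet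
  differentiability of all partial derivatives of order less than \<open>k\<close>.\<close>

definition Ck_on ::
  "nat \<Rightarrow> (real^'p::finite) set \<Rightarrow> (real^'p \<Rightarrow> 'b::real_normed_vector) \<Rightarrow> bool" where
  "Ck_on k \<Theta> f \<longleftrightarrow>
     (\<forall>is. length is < k \<longrightarrow> partial_derivs is f differentiable_on interior \<Theta>) \<and>
     (\<forall>is. length is \<le> k \<longrightarrow>
        (\<exists>g. continuous_on \<Theta> g \<and> (\<forall>\<theta>\<in>interior \<Theta>. g \<theta> = partial_derivs is f \<theta>)))"

definition smooth_on_open :: "(real^'p::finite) set \<Rightarrow> (real^'p \<Rightarrow> 'b::real_normed_vector) \<Rightarrow> bool" where
  "smooth_on_open U f \<longleftrightarrow> open U \<and> (\<forall>is. partial_derivs is f differentiable_on U)"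

text \<open>\<open>\<Theta>\<close> is locally a sublevel set of a smooth function without critical point on the boundary.\<close>

definition smooth_boundary :: "(real^'p::finite) set \<Rightarrow> bool" where
  "smooth_boundary \<Theta> \<longleftrightarrow>
     (\<forall>x\<in>frontier \<Theta>. \<exists>U (\<rho> :: real^'p \<Rightarrow> real). x \<in> U \<and> smooth_on_open U \<rho> \<and>
        (\<exists>i. partial_deriv i \<rho> x \<noteq> 0) \<and> \<rho> x = 0 \<and> \<Theta> \<inter> U = {y \<in> U. \<rho> y \<le> 0})"


section \<open>Discretization\<close>

text \<open>A grid is a sequence \<open>t\<close> with relevant entries \<open>t 0, \<dots>, t n\<close>.\<close>

definition is_grid :: "real \<Rightarrow> nat \<Rightarrow> (nat \<Rightarrow> real) \<Rightarrow> bool" where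
  "is_grid \<tau> n t \<longleftrightarrow> t 0 = 0 \<and> t n = \<tau> \<and> (\<forall>i<n. t i < t (Suc i))"

definition mesh :: "nat \<Rightarrow> (nat \<Rightarrow> real) \<Rightarrow> real" where
  "mesh n t = (SUP i\<in>{1..n}. \<bar>t i - t (i - 1)\<bar>)"

definition cell :: "(nat \<Rightarrow> real) \<Rightarrow> nat \<Rightarrow> real set" where
  "cell t i = (if i = 1 then {0..t 1} else {t (i - 1)<..t i})"

definition K_disc ::
  "nat \<Rightarrow> (nat \<Rightarrow> real) \<Rightarrow> (real \<Rightarrow> real \<Rightarrow> real) \<Rightarrow> real \<Rightarrow> real \<Rightarrow> real" where
  "K_disc n t K s u =
     (\<Sum>i=1..n. \<Sum>j=1..n. K (t i) (t j) * indicator (cell t i \<times> cell t j) (s, u))"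

definition Linf_norm :: "(real \<times> real) set \<Rightarrow> (real \<times> real \<Rightarrow> real) \<Rightarrow> ereal" where
  "Linf_norm S f = esssup (restrict_space lborel S) (\<lambda>x. ereal \<bar>f x\<bar>)"

definition Phi_disc ::
  "nat \<Rightarrow> (nat \<Rightarrow> real) \<Rightarrow> (real \<Rightarrow> real \<Rightarrow> real) \<Rightarrow> (real \<Rightarrow> real) \<Rightarrow> real signed_measure \<Rightarrow> real" where
  "Phi_disc n t K x \<mu> =
     (\<Sum>i=1..n. smeasure \<mu> (cell t i) * x (t i)) -
     1/2 * (\<Sum>i=1..n. \<Sum>j=1..n. smeasure \<mu> (cell t i) * smeasure \<mu> (cell t j) * K (t i) (t j))"

definition Phi_lim ::
  "real set \<Rightarrow> (real \<Rightarrow> real \<Rightarrow> real) \<Rightarrow> (real \<Rightarrow> real) \<Rightarrow> real signed_measure \<Rightarrow> real" where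
  "Phi_lim T K h \<mu> = pairing T \<mu> h - 1/2 * pairing T \<mu> (cov_op T K \<mu>)"

end

theory Submission
  imports Defs
begin

text \<open>
The proof expands the expected overshoot into a discretisation bias and a noise term and computes the
limit of the latter path by path.

Write \<open>I\<^sub>n(\<nu>, x)\<close> for the sum over the cells of \<open>\<nu>(T\<^sub>i) x(t\<^sub>i)\<close>, \<open>B(\<nu>, \<rho>)\<close> for the bilinear form of the covariance
operator and \<open>\<Delta>\<^sub>\<theta> = \<mu>\<^sub>\<theta> - \<mu>\<^sub>\<theta>\<^sub>0\<close>.  The limit contrast equals a constant minus \<open>B(\<Delta>\<^sub>\<theta>, \<Delta>\<^sub>\<theta>) / 2\<close>, and the discretised
contrast exceeds it by a bias of order \<open>\<delta> = \<parallel>K\<^sup>n - K\<parallel>\<close> plus the noise \<open>\<epsilon> I\<^sub>n(\<mu>\<^sub>\<theta>, Z)\<close>.  The bias is \<open>o(\<epsilon>\<^sup>2)\<close>, and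
\<open>I\<^sub>n(\<mu>\<^sub>\<theta>\<^sub>0, Z)\<close> has mean zero.  What remains is \<open>\<epsilon>\<^sup>2\<close> times the mean of \<open>Q = I\<^sub>n(\<Delta>\<^sub>\<theta>, Z) / \<epsilon>\<close> at the maximizer, which
has to converge to \<open>p\<close>.

For a fixed path, identifiability, compactness and the regularity of \<open>\<Sigma>\<close> give \<open>B(\<Delta>\<^sub>\<theta>, \<Delta>\<^sub>\<theta>) \<ge> c \<bar>\<theta> - \<theta>\<^sub>0\<bar>\<^sup>2\<close>
(\<open>\<Delta>_coercive\<close>), so that comparison with \<open>\<theta>\<^sub>0\<close> bounds the rescaled error \<open>w\<close> of the maximizer
(\<open>rate\<close>).  In the variable \<open>w\<close> the contrast converges to the concave quadratic
\<open>- w\<^sup>T \<Sigma> w / 2 + w\<^sup>T G\<close> with \<open>G\<^sub>i = \<langle>\<partial>\<^sub>i \<mu>\<^sub>\<theta>\<^sub>0, Z\<rangle>\<close>; hence \<open>w\<close> converges to \<open>\<Sigma>\<^sup>-\<^sup>1 G\<close> and \<open>Q\<close> to \<open>G\<^sup>T \<Sigma>\<^sup>-\<^sup>1 G\<close>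
(\<open>maximizer_noise_tendsto\<close>).  Neither a first-order condition nor an event on which the maximizer is an
interior point is needed.  Since \<open>G\<close> has covariance matrix \<open>\<Sigma>\<close> (\<open>G_covariance\<close>), the limit has mean
\<open>tr(\<Sigma>\<^sup>-\<^sup>1 \<Sigma>) = p\<close>.

Convergence of the means follows from a uniform bound on the second moments of \<open>Q\<close> (\<open>noise_second_moment\<close>,
\<open>convergence_of_means\<close>).  It rests on moments of the supremum over \<open>\<theta>\<close> of \<open>I\<^sub>n(\<partial>\<^sub>i \<mu>\<^sub>\<theta>, Z)\<close>, uniform in the grid.
The map \<open>\<theta> \<mapsto> \<partial>\<^sub>i \<mu>\<^sub>\<theta>\<close> is Lipschitz in total variation, so this normal process is Lipschitz in
every \<open>L\<^sup>q\<close>, and chaining over dyadic nets bounds the \<open>q\<close>-th moment of its supremum once \<open>q\<close> is large compared to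
the dimension (\<open>chaining_bound\<close>).

Two facts connect the statement with this argument.  The covariance function is continuous because normal
variables that converge pointwise converge in mean square (\<open>increment_variance_tendsto\<close>), and the essential
supremum of \<open>\<bar>K\<^sup>n - K\<bar>\<close> controls the oscillation of \<open>K\<close> on every cell (\<open>cell_osc_Linf\<close>).
\<close>

section \<open>Signed measures, grids and the dual pairing\<close>

lemma smeasure_add: "smeasure (\<mu> + \<nu>) A = smeasure \<mu> A + smeasure \<nu> A"
  by transfer simp

lemma smeasure_diff: "smeasure (\<mu> - \<nu>) A = smeasure \<mu> A - smeasure \<nu> A"
  by transfer simp

lemma smeasure_scaleR: "smeasure (c *\<^sub>R \<mu>) A = c * smeasure \<mu> A"
  by transfer simp

lemma smeasure_zero: "smeasure 0 A = 0"
  by transfer simp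

lemma abs_smeasure_le_norm: "\<bar>smeasure \<nu> A\<bar> \<le> norm \<nu>"
  by transfer (rule abs_le_total_variation)

lemma bounded_linear_smeasure: "bounded_linear (\<lambda>\<nu>. smeasure \<nu> A)"
  by (rule bounded_linear_intro[where K = 1])
    (auto simp: smeasure_add smeasure_scaleR abs_smeasure_le_norm)

lemma sum_abs_smeasure_le_norm:
  assumes "finite I" "disjoint_family_on A I" "\<And>i. i \<in> I \<Longrightarrow> A i \<in> sets borel"
  shows "(\<Sum>i\<in>I. \<bar>smeasure \<nu> (A i)\<bar>) \<le> norm (\<nu> :: 'a::topological_space signed_measure)"
proof -
  define J where "J = {i\<in>I. A i \<noteq> {}}"
  define P where "P = A ` J"
  have J: "finite J" "J \<subseteq> I" using assms(1) by (auto simp: J_def)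
  have inj: "inj_on A J"
  proof (rule inj_onI)
    fix i j assume ij: "i \<in> J" "j \<in> J" "A i = A j"
    show "i = j"
    proof (rule ccontr)
      assume "i \<noteq> j"
      with ij J assms(2) have "A i \<inter> A j = {}" by (metis disjoint_family_onD subsetD)
      with ij show False by (auto simp: J_def)
    qed
  qed
  have disP: "disjoint P"
    unfolding disjoint_def P_def using disjoint_family_onD[OF assms(2)] J(2) by blast
  have Pb: "P \<subseteq> sets borel" "finite P" using J assms(3) by (auto simp: P_def)
  have empty_val: "smeasure \<nu> {} = 0" by (rule signed_borel_empty[OF signed_borel_smeasure])
  have "(\<Sum>i\<in>I. \<bar>smeasure \<nu> (A i)\<bar>) = (\<Sum>i\<in>J. \<bar>smeasure \<nu> (A i)\<bar>)"
    using assms(1) empty_val by (intro sum.mono_neutral_right) (auto simp: J_def)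
  also have "\<dots> = (\<Sum>B\<in>P. \<bar>smeasure \<nu> B\<bar>)"
    by (simp add: P_def sum.reindex[OF inj])
  also have "\<dots> \<le> norm \<nu>"
  proof (cases "\<Union>P = UNIV")
    case True
    then have "partition_on UNIV P" using disP by (auto simp: partition_on_def P_def J_def)
    then show ?thesis using Pb
      unfolding norm_signed_measure.rep_eq
      by (intro total_variation_upper signed_borel_smeasure)
  next
    case False
    let ?R = "- \<Union>P"
    have R: "?R \<notin> P" using False by auto
    have "partition_on UNIV (insert ?R P)"
      unfolding partition_on_def
    proof (intro conjI)
      show "\<Union> (insert ?R P) = UNIV" by auto
      show "disjoint (insert ?R P)" using disP unfolding disjoint_def by blast
      show "{} \<notin> insert ?R P" using False P_def J_def by blast
    qed
    moreover have "?R \<in> sets borel"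
      by (rule borel_comp, rule sets.finite_Union) (use Pb in simp_all)
    ultimately have "(\<Sum>B\<in>insert ?R P. \<bar>smeasure \<nu> B\<bar>) \<le> norm \<nu>" using Pb
      unfolding norm_signed_measure.rep_eq
      by (intro total_variation_upper signed_borel_smeasure) auto
    then show ?thesis using R Pb by simp
  qed
  finally show ?thesis .
qed

lemma measures_on_scaleR: "\<mu> \<in> measures_on T \<Longrightarrow> c *\<^sub>R \<mu> \<in> measures_on T"
  by (simp add: measures_on_def smeasure_scaleR)

lemma measures_on_sum: "(\<And>i. i \<in> I \<Longrightarrow> \<mu> i \<in> measures_on T) \<Longrightarrow> (\<Sum>i\<in>I. \<mu> i) \<in> measures_on T"
  by (induction I rule: infinite_finite_induct)
    (auto simp: measures_on_def smeasure_add smeasure_zero)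

lemma measure_pos_part_le: "measure (pos_part \<nu>) A \<le> norm \<nu>"
proof (cases "A \<in> sets borel")
  case True
  have "(SUP B\<in>{B \<in> sets borel. B \<subseteq> A}. smeasure \<nu> B) \<le> norm \<nu>"
  proof (rule cSUP_least)
    fix B assume "B \<in> {B \<in> sets borel. B \<subseteq> A}"
    show "smeasure \<nu> B \<le> norm \<nu>" using abs_smeasure_le_norm[of \<nu> B] by linarith
  qed auto
  then show ?thesis
    unfolding measure_def emeasure_pos_part[OF True]
    by (metis enn2real_leI ennreal_leI norm_ge_zero)
qed (simp add: measure_notin_sets)

lemma measure_neg_part_le: "measure (neg_part \<nu>) A \<le> norm \<nu>"
  using measure_pos_part_le[of "-\<nu>" A] by (simp add: neg_part_def)

lemma finite_measure_pos_part: "finite_measure (pos_part \<nu>)"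
proof (rule finite_measureI)
  have "space (pos_part \<nu>) \<in> sets borel" by (metis sets.top sets_pos_part)
  then show "emeasure (pos_part \<nu>) (space (pos_part \<nu>)) \<noteq> \<infinity>"
    by (simp add: emeasure_pos_part)
qed

lemma finite_measure_neg_part: "finite_measure (neg_part \<nu>)"
  unfolding neg_part_def by (rule finite_measure_pos_part)

text \<open>Integration of \<open>x\<close> against the discretisation of \<open>\<nu>\<close> that moves the mass of each cell to
  its right end point.\<close>

definition grid_sum :: "nat \<Rightarrow> (nat \<Rightarrow> real) \<Rightarrow> real signed_measure \<Rightarrow> (real \<Rightarrow> real) \<Rightarrow> real" where
  "grid_sum n t \<nu> x = (\<Sum>i=1..n. smeasure \<nu> (cell t i) * x (t i))"

lemma grid_sum_add: "grid_sum n t (\<mu> + \<nu>) x = grid_sum n t \<mu> x + grid_sum n t \<nu> x"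
  by (simp add: grid_sum_def smeasure_add algebra_simps sum.distrib)

lemma grid_sum_diff: "grid_sum n t (\<mu> - \<nu>) x = grid_sum n t \<mu> x - grid_sum n t \<nu> x"
  by (simp add: grid_sum_def smeasure_diff algebra_simps sum_subtractf)

lemma grid_sum_scaleR: "grid_sum n t (c *\<^sub>R \<mu>) x = c * grid_sum n t \<mu> x"
  by (simp add: grid_sum_def smeasure_scaleR algebra_simps sum_distrib_left)

lemma cell_borel [simp]: "cell t i \<in> sets borel"
  by (simp add: cell_def)

lemma grid_mono:
  assumes "is_grid \<tau> n t" "i \<le> j" "j \<le> n"
  shows "t i \<le> t j"
  using assms(2,3)
proof (induction j rule: dec_induct)
  case (step k)
  then have "t i \<le> t k" "t k < t (Suc k)" using assms(1) by (auto simp: is_grid_def)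
  then show ?case by linarith
qed simp

lemma grid_range:
  assumes "is_grid \<tau> n t" "i \<le> n"
  shows "t i \<in> {0..\<tau>}"
  using grid_mono[OF assms(1), of 0 i] grid_mono[OF assms(1), of i n] assms
  by (auto simp: is_grid_def)

lemma cell_upper: "s \<in> cell t i \<Longrightarrow> s \<le> t i"
  by (auto simp: cell_def split: if_splits)

lemma cell_subset:
  assumes "is_grid \<tau> n t" "i \<in> {1..n}"
  shows "cell t i \<subseteq> {t (i - 1)..t i}" "{t (i - 1)<..<t i} \<subseteq> cell t i" "t (i - 1) < t i"
    "t i \<in> cell t i"
proof -
  obtain j where j: "i = Suc j" using assms(2) by (cases i) auto
  show "t (i - 1) < t i" using assms j by (auto simp: is_grid_def)
  then show "cell t i \<subseteq> {t (i - 1)..t i}" "{t (i - 1)<..<t i} \<subseteq> cell t i" "t i \<in> cell t i"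
    using assms(1) by (auto simp: cell_def is_grid_def)
qed

lemma cell_subset_interval:
  assumes "is_grid \<tau> n t" "i \<in> {1..n}"
  shows "cell t i \<subseteq> {0..\<tau>}"
  using cell_subset(1)[OF assms] grid_range[OF assms(1), of i] grid_range[OF assms(1), of "i - 1"] assms(2)
  by fastforce

lemma cells_cover:
  assumes g: "is_grid \<tau> n t" and n: "n \<ge> 1"
  shows "(\<Union>i\<in>{1..n}. cell t i) = {0..\<tau>}"
proof
  show "(\<Union>i\<in>{1..n}. cell t i) \<subseteq> {0..\<tau>}" using cell_subset_interval[OF g] by blast
  have "{0..t m} \<subseteq> (\<Union>i\<in>{1..m}. cell t i)" if "m \<ge> 1" for m
    using that
  proof (induction m rule: dec_induct)
    case base
    then show ?case by (auto simp: cell_def)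
  next
    case (step m)
    have "{0..t (Suc m)} \<subseteq> {0..t m} \<union> cell t (Suc m)" using step(1) by (auto simp: cell_def)
    also have "\<dots> \<subseteq> (\<Union>i\<in>{1..m}. cell t i) \<union> cell t (Suc m)" using step by blast
    finally show ?case by (simp add: atLeastAtMostSuc_conv)  blast
  qed
  from this[OF n] show "{0..\<tau>} \<subseteq> (\<Union>i\<in>{1..n}. cell t i)" using g by (simp add: is_grid_def)
qed

lemma disjoint_cells:
  assumes g: "is_grid \<tau> n t"
  shows "disjoint_family_on (cell t) {1..n}"
proof -
  have "cell t i \<inter> cell t j = {}" if "i \<in> {1..n}" "j \<in> {1..n}" "i < j" for i j
  proof -
    have "t i \<le> t (j - 1)" using that by (intro grid_mono[OF g]) auto
    then show ?thesis using that cell_upper[of _ t i] by (force simp: cell_def[of t j])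
  qed
  then show ?thesis unfolding disjoint_family_on_def by (metis Int_commute linorder_neqE_nat)
qed

lemma cell_mesh:
  assumes g: "is_grid \<tau> n t" and i: "i \<in> {1..n}" and s: "s \<in> cell t i"
  shows "\<bar>t i - s\<bar> \<le> mesh n t"
proof -
  have "\<bar>t i - t (i - 1)\<bar> \<le> mesh n t"
    unfolding mesh_def using i by (intro cSUP_upper) auto
  then show ?thesis using cell_subset(1)[OF g i] s by auto
qed

lemma grid_sum_bound:
  assumes g: "is_grid \<tau> n t" and e: "\<And>i. i \<in> {1..n} \<Longrightarrow> \<bar>x (t i)\<bar> \<le> e" "e \<ge> 0"
  shows "\<bar>grid_sum n t \<nu> x\<bar> \<le> norm \<nu> * e"
proof -
  have "\<bar>grid_sum n t \<nu> x\<bar> \<le> (\<Sum>i=1..n. \<bar>smeasure \<nu> (cell t i)\<bar> * e)"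
    unfolding grid_sum_def
    by (rule order_trans[OF sum_abs]) (auto simp: abs_mult intro!: sum_mono mult_left_mono e(1))
  also have "\<dots> \<le> norm \<nu> * e"
    unfolding sum_distrib_right[symmetric]
    by (intro mult_right_mono e(2) sum_abs_smeasure_le_norm[OF _ disjoint_cells[OF g]]) auto
  finally show ?thesis .
qed

lemma continuous_on_Icc_bounded:
  fixes x :: "real \<Rightarrow> real"
  assumes "continuous_on {a..b} x"
  obtains R where "R \<ge> 0" "\<And>s. s \<in> {a..b} \<Longrightarrow> \<bar>x s\<bar> \<le> R"
proof -
  have "bounded (x ` {a..b})"
    by (rule compact_imp_bounded[OF compact_continuous_image[OF assms compact_Icc]])
  then obtain R where "R > 0" "\<forall>y\<in>x ` {a..b}. norm y \<le> R" unfolding bounded_pos by metis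
  then show thesis by (intro that[of R]) auto
qed

lemma set_integral_grid_step:
  fixes N :: "real measure" and t :: "nat \<Rightarrow> real"
  assumes g: "is_grid \<tau> n t" and n: "n \<ge> 1" and N: "finite_measure N" "sets N = sets borel"
    and x: "continuous_on {0..\<tau>} x"
    and e: "\<And>i s. i \<in> {1..n} \<Longrightarrow> s \<in> cell t i \<Longrightarrow> \<bar>x (t i) - x s\<bar> \<le> e"
  shows "\<bar>(\<Sum>i=1..n. measure N (cell t i) * x (t i)) - (LINT s:{0..\<tau>}|N. x s)\<bar> \<le> e * measure N {0..\<tau>}"
proof -
  interpret finite_measure N by fact
  define y where "y s = (\<Sum>i=1..n. x (t i) * indicator (cell t i) s)" for s
  have cN: "cell t i \<in> sets N" for i by (simp add: N)
  have y_int: "integrable N y" unfolding y_def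
    by (intro Bochner_Integration.integrable_sum integrable_mult_right integrable_real_indicator cN)
      (simp add: emeasure_finite less_top[symmetric])
  have y_val: "(\<integral>s. y s \<partial>N) = (\<Sum>i=1..n. measure N (cell t i) * x (t i))"
    unfolding y_def
    by (subst Bochner_Integration.integral_sum)
      (auto simp: cN N emeasure_finite less_top[symmetric] mult.commute intro!: integrable_mult_right integrable_real_indicator)
  obtain R where R: "\<And>s. s \<in> {0..\<tau>} \<Longrightarrow> \<bar>x s\<bar> \<le> R"
    using continuous_on_Icc_bounded[OF x] by metis
  have xm: "(\<lambda>s. indicator {0..\<tau>} s * x s) \<in> borel_measurable N"
    using borel_measurable_continuous_on_indicator[OF _ x] N(2)
    by (simp cong: measurable_cong_sets)
  have x_int: "integrable N (\<lambda>s. indicator {0..\<tau>} s * x s)"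
    by (rule integrable_const_bound[where B = "\<bar>R\<bar>", OF _ xm])
      (use R in \<open>force simp: indicator_def\<close>)
  have eq: "y s = x (t i)" if "i \<in> {1..n}" "s \<in> cell t i" for i s
  proof -
    have "indicator (cell t j) s = (if j = i then 1 else (0::real))" if "j \<in> {1..n}" for j
      using disjoint_family_onD[OF disjoint_cells[OF g], of i j] that \<open>i \<in> {1..n}\<close> \<open>s \<in> cell t i\<close>
      by (auto simp: indicator_def)
    then have "y s = (\<Sum>j=1..n. x (t j) * (if j = i then 1 else 0))"
      unfolding y_def by (intro sum.cong) auto
    also have "\<dots> = x (t i)" using that(1) by (simp add: if_distrib sum.delta cong: if_cong)
    finally show ?thesis .
  qed
  have zero: "y s = 0" if "s \<notin> {0..\<tau>}" for s
  proof -
    have "s \<notin> cell t i" if "i \<in> {1..n}" for i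
      using cell_subset_interval[OF g that] \<open>s \<notin> {0..\<tau>}\<close> by blast
    then show ?thesis unfolding y_def by (intro sum.neutral) simp
  qed
  have bd: "\<bar>y s - indicator {0..\<tau>} s * x s\<bar> \<le> e * indicator {0..\<tau>} s" for s
  proof (cases "s \<in> {0..\<tau>}")
    case True
    then obtain i where "i \<in> {1..n}" "s \<in> cell t i" using cells_cover[OF g n] by blast
    then show ?thesis using True eq[of i s] e[of i s] by simp
  qed (simp add: zero)
  have "\<bar>(\<integral>s. y s \<partial>N) - (\<integral>s. indicator {0..\<tau>} s * x s \<partial>N)\<bar>
      = \<bar>\<integral>s. y s - indicator {0..\<tau>} s * x s \<partial>N\<bar>"
    using y_int x_int by simp
  also have "\<dots> \<le> (\<integral>s. \<bar>y s - indicator {0..\<tau>} s * x s\<bar> \<partial>N)"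
    by (rule integral_abs_bound)
  also have "\<dots> \<le> (\<integral>s. e * indicator {0..\<tau>} s \<partial>N)"
    using y_int x_int N bd
    by (intro integral_mono) (auto simp: emeasure_finite less_top[symmetric] intro!: integrable_mult_right integrable_real_indicator)
  also have "\<dots> = e * measure N {0..\<tau>}" using N by simp
  finally show ?thesis by (simp add: y_val set_lebesgue_integral_def)
qed

lemma grid_sum_pairing:
  assumes g: "is_grid \<tau> n t" and n: "n \<ge> 1" and x: "continuous_on {0..\<tau>} x"
    and e: "\<And>i s. i \<in> {1..n} \<Longrightarrow> s \<in> cell t i \<Longrightarrow> \<bar>x (t i) - x s\<bar> \<le> e"
  shows "\<bar>grid_sum n t \<nu> x - pairing {0..\<tau>} \<nu> x\<bar> \<le> 2 * norm \<nu> * e"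
proof -
  have "n \<in> {1..n}" using n by simp
  from e[OF this cell_subset(4)[OF g this]] have e0: "e \<ge> 0" by simp
  let ?p = "\<Sum>i=1..n. measure (pos_part \<nu>) (cell t i) * x (t i)"
  let ?q = "\<Sum>i=1..n. measure (neg_part \<nu>) (cell t i) * x (t i)"
  have "grid_sum n t \<nu> x = ?p - ?q"
    by (simp add: grid_sum_def smeasure_Jordan sum_subtractf left_diff_distrib)
  moreover have "\<bar>?p - (LINT s:{0..\<tau>}|pos_part \<nu>. x s)\<bar> \<le> e * norm \<nu>"
    by (rule order_trans[OF set_integral_grid_step[OF g n _ _ x e]])
      (auto intro: finite_measure_pos_part mult_left_mono measure_pos_part_le e0)
  moreover have "\<bar>?q - (LINT s:{0..\<tau>}|neg_part \<nu>. x s)\<bar> \<le> e * norm \<nu>"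
    by (rule order_trans[OF set_integral_grid_step[OF g n _ _ x e]])
      (auto intro: finite_measure_neg_part mult_left_mono measure_neg_part_le e0)
  ultimately show ?thesis unfolding pairing_def by (simp add: algebra_simps)
qed

lemma uniform_grid:
  assumes "\<tau> > 0" "m \<ge> 1"
  shows "is_grid \<tau> m (\<lambda>i. \<tau> * real i / real m)"
  using assms by (auto simp: is_grid_def field_simps)

lemma uniform_grid_mesh:
  "(\<lambda>m. mesh m (\<lambda>i. \<tau> * real i / real m)) \<longlonglongrightarrow> 0"
proof -
  have "mesh m (\<lambda>i. \<tau> * real i / real m) = \<bar>\<tau>\<bar> / real m" if "m \<ge> 1" for m
  proof -
    have "\<bar>\<tau> * real i / real m - \<tau> * real (i - 1) / real m\<bar> = \<bar>\<tau>\<bar> / real m" if "i \<in> {1..m}" for i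
    proof -
      have "real (i - 1) = real i - 1" using that by auto
      then have "\<tau> * real i / real m - \<tau> * real (i - 1) / real m = \<tau> / real m"
        by (simp add: diff_divide_distrib[symmetric] right_diff_distrib)
      then show ?thesis by simp
    qed
    then have "mesh m (\<lambda>i. \<tau> * real i / real m) = (SUP i\<in>{1..m}. \<bar>\<tau>\<bar> / real m)"
      unfolding mesh_def by (intro SUP_cong) auto
    then show ?thesis using that by simp
  qed
  then have "\<forall>\<^sub>F m in sequentially. \<bar>\<tau>\<bar> / real m = mesh m (\<lambda>i. \<tau> * real i / real m)"
    by (auto intro: eventually_sequentiallyI[of 1])
  with lim_const_over_n[of "\<bar>\<tau>\<bar>"] show ?thesis by (rule Lim_transform_eventually)
qed

text \<open>Discretised pairings converge along any sequence of grids with vanishing mesh.\<close>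

lemma grid_sum_tendsto:
  assumes g: "\<And>m. m \<ge> 1 \<Longrightarrow> is_grid \<tau> m (t m)" and mesh: "(\<lambda>m. mesh m (t m)) \<longlonglongrightarrow> 0"
    and x: "continuous_on {0..\<tau>} x"
  shows "(\<lambda>m. grid_sum m (t m) \<nu> x) \<longlonglongrightarrow> pairing {0..\<tau>} \<nu> x"
proof (rule LIMSEQ_I)
  fix r :: real assume r: "r > 0"
  define e where "e = r / (2 * norm \<nu> + 1)"
  have e: "e > 0" "2 * norm \<nu> * e < r" using r by (auto simp: e_def field_simps add_pos_nonneg)
  have "uniformly_continuous_on {0..\<tau>} x"
    by (intro compact_uniformly_continuous x compact_Icc)
  then obtain d where d: "d > 0" "\<And>s s'. s \<in> {0..\<tau>} \<Longrightarrow> s' \<in> {0..\<tau>} \<Longrightarrow> \<bar>s' - s\<bar> < d \<Longrightarrow> \<bar>x s' - x s\<bar> < e"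
    using e(1) unfolding uniformly_continuous_on_def dist_real_def by metis
  have "eventually (\<lambda>m. mesh m (t m) < d \<and> m \<ge> 1) sequentially"
    using order_tendstoD(2)[OF mesh d(1)] eventually_ge_at_top[of 1] by (rule eventually_conj)
  then obtain m0 where m0: "\<And>m. m \<ge> m0 \<Longrightarrow> mesh m (t m) < d \<and> m \<ge> 1"
    by (auto simp: eventually_sequentially)
  have "norm (grid_sum m (t m) \<nu> x - pairing {0..\<tau>} \<nu> x) < r" if m: "m \<ge> m0" for m
  proof -
    note g' = g[of m] and mm = m0[OF m]
    have "\<bar>x (t m i) - x s\<bar> \<le> e" if i: "i \<in> {1..m}" "s \<in> cell (t m) i" for i s
    proof -
      have "\<bar>t m i - s\<bar> < d" using cell_mesh[OF g' i] mm by linarith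
      moreover have "t m i \<in> {0..\<tau>}" "s \<in> {0..\<tau>}"
        using grid_range[OF g', of i] cell_subset_interval[OF g' i(1)] i mm by auto
      ultimately show ?thesis using d(2)[of s "t m i"] by simp
    qed
    then have "\<bar>grid_sum m (t m) \<nu> x - pairing {0..\<tau>} \<nu> x\<bar> \<le> 2 * norm \<nu> * e"
      using mm by (intro grid_sum_pairing g x) auto
    with e(2) show ?thesis by simp
  qed
  then show "\<exists>m0. \<forall>m\<ge>m0. norm (grid_sum m (t m) \<nu> x - pairing {0..\<tau>} \<nu> x) < r" by blast
qed

text \<open>The pairing is defined through the Jordan decomposition, which is not additive.  Its linearity and
  its norm bound are inherited from the discretised pairings on uniform grids.\<close>

context
  fixes \<tau> :: real
  assumes \<tau>: "\<tau> > 0"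
begin

lemma unif_tendsto:
  "continuous_on {0..\<tau>} x \<Longrightarrow>
    (\<lambda>m. grid_sum m (\<lambda>i. \<tau> * real i / real m) \<nu> x) \<longlonglongrightarrow> pairing {0..\<tau>} \<nu> x"
  by (rule grid_sum_tendsto[OF uniform_grid[OF \<tau>] uniform_grid_mesh])

lemma pairing_add:
  assumes "continuous_on {0..\<tau>} x"
  shows "pairing {0..\<tau>} (\<mu> + \<nu>) x = pairing {0..\<tau>} \<mu> x + pairing {0..\<tau>} \<nu> x"
  using LIMSEQ_unique[OF unif_tendsto[OF assms, of "\<mu> + \<nu>"]]
    tendsto_add[OF unif_tendsto[OF assms, of \<mu>] unif_tendsto[OF assms, of \<nu>]]
  by (simp add: grid_sum_add)

lemma pairing_scaleR:
  assumes "continuous_on {0..\<tau>} x"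
  shows "pairing {0..\<tau>} (c *\<^sub>R \<nu>) x = c * pairing {0..\<tau>} \<nu> x"
  using LIMSEQ_unique[OF unif_tendsto[OF assms, of "c *\<^sub>R \<nu>"]]
    tendsto_mult_left[OF unif_tendsto[OF assms, of \<nu>], of c]
  by (simp add: grid_sum_scaleR)

lemma pairing_bound:
  assumes x: "continuous_on {0..\<tau>} x" and e: "\<And>s. s \<in> {0..\<tau>} \<Longrightarrow> \<bar>x s\<bar> \<le> e"
  shows "\<bar>pairing {0..\<tau>} \<nu> x\<bar> \<le> norm \<nu> * e"
proof (rule LIMSEQ_le_const2[OF tendsto_rabs[OF unif_tendsto[OF x, of \<nu>]]])
  have e0: "e \<ge> 0" using e[of 0] \<tau> by simp
  have "\<bar>grid_sum m (\<lambda>i. \<tau> * real i / real m) \<nu> x\<bar> \<le> norm \<nu> * e" if "m \<ge> 1" for m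
    using grid_range[OF uniform_grid[OF \<tau> that]]
    by (intro grid_sum_bound[OF uniform_grid[OF \<tau> that]] e e0) auto
  then show "\<exists>N. \<forall>m\<ge>N. \<bar>grid_sum m (\<lambda>i. \<tau> * real i / real m) \<nu> x\<bar> \<le> norm \<nu> * e"
    by blast
qed

lemma pairing_add_right:
  assumes x: "continuous_on {0..\<tau>} x" and y: "continuous_on {0..\<tau>} y"
  shows "pairing {0..\<tau>} \<nu> (\<lambda>s. x s + y s) = pairing {0..\<tau>} \<nu> x + pairing {0..\<tau>} \<nu> y"
proof (rule LIMSEQ_unique[OF unif_tendsto])
  show "continuous_on {0..\<tau>} (\<lambda>s. x s + y s)" by (intro continuous_intros x y)
  show "(\<lambda>m. grid_sum m (\<lambda>i. \<tau> * real i / real m) \<nu> (\<lambda>s. x s + y s))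
      \<longlonglongrightarrow> pairing {0..\<tau>} \<nu> x + pairing {0..\<tau>} \<nu> y"
    using tendsto_add[OF unif_tendsto[OF x, of \<nu>] unif_tendsto[OF y, of \<nu>]]
    by (simp add: grid_sum_def distrib_left sum.distrib)
qed

lemma pairing_scale_right:
  assumes x: "continuous_on {0..\<tau>} x"
  shows "pairing {0..\<tau>} \<nu> (\<lambda>s. c * x s) = c * pairing {0..\<tau>} \<nu> x"
proof (rule LIMSEQ_unique[OF unif_tendsto])
  show "continuous_on {0..\<tau>} (\<lambda>s. c * x s)" by (intro continuous_intros x)
  show "(\<lambda>m. grid_sum m (\<lambda>i. \<tau> * real i / real m) \<nu> (\<lambda>s. c * x s)) \<longlonglongrightarrow> c * pairing {0..\<tau>} \<nu> x"
    using tendsto_mult_left[OF unif_tendsto[OF x, of \<nu>], of c]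
    by (simp add: grid_sum_def sum_distrib_left mult.left_commute)
qed

lemma bounded_linear_pairing:
  assumes x: "continuous_on {0..\<tau>} x"
  shows "bounded_linear (\<lambda>\<nu>. pairing {0..\<tau>} \<nu> x)"
proof -
  obtain R where R: "\<And>s. s \<in> {0..\<tau>} \<Longrightarrow> \<bar>x s\<bar> \<le> R"
    using continuous_on_Icc_bounded[OF x] by metis
  show ?thesis
    by (rule bounded_linear_intro[where K = R])
      (auto simp: pairing_add[OF x] pairing_scaleR[OF x] intro: pairing_bound[OF x R])
qed

end

lemma pairing_diff_right:
  fixes \<tau> :: real
  assumes \<tau>: "\<tau> > 0" and x: "continuous_on {0..\<tau>} x" and y: "continuous_on {0..\<tau>} y"
  shows "pairing {0..\<tau>} \<nu> (\<lambda>s. x s - y s) = pairing {0..\<tau>} \<nu> x - pairing {0..\<tau>} \<nu> y"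
proof -
  have "continuous_on {0..\<tau>} (\<lambda>s. (- 1) * y s)" by (intro continuous_intros y)
  then have "pairing {0..\<tau>} \<nu> (\<lambda>s. x s + (- 1) * y s) = pairing {0..\<tau>} \<nu> x + pairing {0..\<tau>} \<nu> (\<lambda>s. (- 1) * y s)"
    by (rule pairing_add_right[OF \<tau> x])
  then show ?thesis
    unfolding pairing_scale_right[OF \<tau> y] by simp
qed

lemma pairing_cong:
  assumes "\<And>s. s \<in> T \<Longrightarrow> x s = y s"
  shows "pairing T \<nu> x = pairing T \<nu> y"
  unfolding pairing_def set_lebesgue_integral_def
  by (intro arg_cong2[where f = "(-)"] Bochner_Integration.integral_cong)
    (auto simp: indicator_def assms)

text \<open>The unit point mass at \<open>s\<close>.\<close>

lift_definition dirac :: "real \<Rightarrow> real signed_measure" is "\<lambda>s A. measure (return borel s) A"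
proof -
  fix s :: real
  interpret prob_space "return borel s" by (rule prob_space_return) simp
  show "signed_borel (\<lambda>A. measure (return borel s) A)"
    unfolding signed_borel_def
  proof (intro conjI allI impI)
    show "measure (return borel s) A = 0" if "A \<notin> sets borel" for A
      using that by (simp add: measure_notin_sets)
    show "(\<lambda>i. measure (return borel s) (F i)) sums measure (return borel s) (\<Union>i. F i)"
      if "range F \<subseteq> sets borel" "disjoint_family F" for F :: "nat \<Rightarrow> real set"
      using that by (intro finite_measure_UNION) auto
  qed
qed

lemma smeasure_dirac: "A \<in> sets borel \<Longrightarrow> smeasure (dirac s) A = indicator A s"
  by transfer (simp add: measure_return)

lemma dirac_measures_on: "s \<in> T \<Longrightarrow> dirac s \<in> measures_on T"
  by (auto simp: measures_on_def smeasure_dirac indicator_def)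

lemma pairing_dirac:
  assumes \<tau>: "\<tau> > 0" and s: "s \<in> {0..\<tau>}" and x: "continuous_on {0..\<tau>} x"
  shows "pairing {0..\<tau>} (dirac s) x = x s"
proof -
  let ?t = "\<lambda>m i. \<tau> * real i / real m"
  note g = uniform_grid[OF \<tau>]
  define i where "i m = (SOME j. j \<in> {1..m} \<and> s \<in> cell (?t m) j)" for m
  have i: "i m \<in> {1..m} \<and> s \<in> cell (?t m) (i m)" if m: "m \<ge> 1" for m
  proof -
    have "s \<in> (\<Union>j\<in>{1..m}. cell (?t m) j)" using cells_cover[OF g[OF m] m] s by simp
    then obtain j where "j \<in> {1..m} \<and> s \<in> cell (?t m) j" by blast
    then show ?thesis unfolding i_def by (rule someI)
  qed
  have val: "grid_sum m (?t m) (dirac s) x = x (?t m (i m))" if m: "m \<ge> 1" for m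
  proof -
    have "smeasure (dirac s) (cell (?t m) j) = (if j = i m then 1 else 0)" if "j \<in> {1..m}" for j
      using disjoint_family_onD[OF disjoint_cells[OF g[OF m]], of j "i m"] i[OF m] that
      by (auto simp: smeasure_dirac indicator_def)
    then have "grid_sum m (?t m) (dirac s) x = (\<Sum>j=1..m. (if j = i m then 1 else 0) * x (?t m j))"
      unfolding grid_sum_def by (intro sum.cong) auto
    also have "\<dots> = (\<Sum>j=1..m. if j = i m then x (?t m j) else 0)" by (intro sum.cong) auto
    also have "\<dots> = x (?t m (i m))" using i[OF m] by (subst sum.delta) auto
    finally show ?thesis .
  qed
  have "(\<lambda>m. ?t m (i m) - s) \<longlonglongrightarrow> 0"
  proof (rule Lim_null_comparison[OF _ uniform_grid_mesh])
    show "\<forall>\<^sub>F m in sequentially. norm (?t m (i m) - s) \<le> mesh m (?t m)"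
      using i cell_mesh[OF g] by (intro eventually_sequentiallyI[of 1]) (auto simp: real_norm_def)
  qed
  then have "(\<lambda>m. ?t m (i m)) \<longlonglongrightarrow> s" by (simp add: LIM_zero_iff)
  moreover have "?t m (i m) \<in> {0..\<tau>}" if "m \<ge> 1" for m
    using grid_range[OF g[OF that], of "i m"] i[OF that] by simp
  then have "\<forall>\<^sub>F m in sequentially. ?t m (i m) \<in> {0..\<tau>}" by (rule eventually_sequentiallyI)
  ultimately have "(\<lambda>m. x (?t m (i m))) \<longlonglongrightarrow> x s"
    by (rule continuous_on_tendsto_compose[OF x _ s])
  then have "(\<lambda>m. grid_sum m (?t m) (dirac s) x) \<longlonglongrightarrow> x s"
    by (rule Lim_transform_eventually) (auto intro!: eventually_sequentiallyI[of 1] simp: val)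
  from LIMSEQ_unique[OF unif_tendsto[OF \<tau> x] this] show ?thesis .
qed

section \<open>Centered normal variables\<close>

text \<open>The moment of order \<open>2 k\<close> of the standard normal distribution.\<close>

definition normal_moment_const :: "nat \<Rightarrow> real" where
  "normal_moment_const k = fact (2 * k) / (2 ^ k * fact k)"

lemma normal_moment_const_pos: "normal_moment_const k > 0"
  by (simp add: normal_moment_const_def)

lemma centered_normal_cases:
  assumes "centered_normal M X"
  obtains "AE \<omega> in M. X \<omega> = 0"
    | \<sigma> where "\<sigma> > 0" "distributed M lborel X (\<lambda>x. ennreal (normal_density 0 \<sigma> x))"
  using assms unfolding centered_normal_def by blast

lemma distributed_normal_even_moment:
  assumes X: "distributed M lborel X (\<lambda>x. ennreal (normal_density 0 \<sigma> x))"
    and \<sigma>: "\<sigma> > 0"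
  shows "(\<integral>\<omega>. X \<omega> ^ (2 * k) \<partial>M) = normal_moment_const k * (\<sigma>\<^sup>2) ^ k"
proof -
  have "(\<integral>\<omega>. X \<omega> ^ (2 * k) \<partial>M) = (\<integral>x. normal_density 0 \<sigma> x * x ^ (2 * k) \<partial>lborel)"
    by (rule distributed_integral[OF X, symmetric]) auto
  also have "\<dots> = fact (2 * k) / ((2 / \<sigma>\<^sup>2) ^ k * fact k)"
    using integral_normal_moment_even[OF \<sigma>, of 0 k] by simp
  also have "\<dots> = normal_moment_const k * (\<sigma>\<^sup>2) ^ k"
    using \<sigma> by (simp add: normal_moment_const_def power_divide field_simps)
  finally show ?thesis .
qed

lemma centered_normal_integrable:
  assumes "prob_space M" and X: "centered_normal M X"
  shows "integrable M (\<lambda>\<omega>. X \<omega> ^ k)"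
proof -
  interpret prob_space M by fact
  have [measurable]: "X \<in> borel_measurable M" using X by (simp add: centered_normal_def)
  from X show ?thesis
  proof (cases rule: centered_normal_cases)
    case 1
    then have "AE \<omega> in M. X \<omega> ^ k = 0 ^ k" by eventually_elim simp
    then show ?thesis by (subst integrable_cong_AE[of _ _ "\<lambda>_. 0 ^ k"]) auto
  next
    case (2 \<sigma>)
    show ?thesis
      using distributed_integrable[OF 2(2), of "\<lambda>x. x ^ k"] integrable_normal_moment[OF 2(1), of 0 k]
      by simp
  qed
qed

lemma centered_normal_mean:
  assumes "prob_space M" and X: "centered_normal M X"
  shows "(\<integral>\<omega>. X \<omega> \<partial>M) = 0"
proof -
  interpret prob_space M by fact
  have [measurable]: "X \<in> borel_measurable M" using X by (simp add: centered_normal_def)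
  from X show ?thesis
  proof (cases rule: centered_normal_cases)
    case 1
    then have "(\<integral>\<omega>. X \<omega> \<partial>M) = (\<integral>\<omega>. 0 \<partial>M)" by (intro integral_cong_AE) auto
    then show ?thesis by simp
  next
    case (2 \<sigma>)
    have "(\<integral>\<omega>. X \<omega> \<partial>M) = (\<integral>x. normal_density 0 \<sigma> x * x \<partial>lborel)"
      by (rule distributed_integral[OF 2(2), symmetric]) auto
    then show ?thesis using integral_normal_moment_nz_1[OF 2(1), of 0] by simp
  qed
qed

lemma centered_normal_even_moment:
  assumes "prob_space M" and X: "centered_normal M X"
  shows "(\<integral>\<omega>. X \<omega> ^ (2 * k) \<partial>M) = normal_moment_const k * (\<integral>\<omega>. (X \<omega>)\<^sup>2 \<partial>M) ^ k"
proof -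
  interpret prob_space M by fact
  have [measurable]: "X \<in> borel_measurable M" using X by (simp add: centered_normal_def)
  from X show ?thesis
  proof (cases rule: centered_normal_cases)
    case 1
    have e: "(\<integral>\<omega>. X \<omega> ^ j \<partial>M) = 0 ^ j" for j
    proof -
      have "(\<integral>\<omega>. X \<omega> ^ j \<partial>M) = (\<integral>\<omega>. 0 ^ j \<partial>M)"
        using 1 by (intro integral_cong_AE) (auto elim!: eventually_mono)
      then show ?thesis by (simp add: prob_space)
    qed
    show ?thesis unfolding e by (cases k) (auto simp: normal_moment_const_def)
  next
    case (2 \<sigma>)
    have "(\<integral>\<omega>. (X \<omega>)\<^sup>2 \<partial>M) = \<sigma>\<^sup>2"
      using distributed_normal_even_moment[OF 2(2,1), of 1]
      by (simp add: normal_moment_const_def fact_2)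
    then show ?thesis using distributed_normal_even_moment[OF 2(2,1), of k] by simp
  qed
qed

text \<open>A centered normal variable that lies in \<open>[- \<eta>, \<eta>]\<close> with probability at least one half has
  standard deviation at most \<open>2 \<eta>\<close>, because its density is bounded by \<open>1 / (\<sigma> \<surd>(2\<pi>))\<close>.\<close>

lemma centered_normal_small_ball:
  assumes "prob_space M" and X: "centered_normal M X" and \<eta>: "\<eta> \<ge> 0"
    and half: "measure M {\<omega> \<in> space M. \<bar>X \<omega>\<bar> \<le> \<eta>} \<ge> 1 / 2"
  shows "(\<integral>\<omega>. (X \<omega>)\<^sup>2 \<partial>M) \<le> 4 * \<eta>\<^sup>2"
proof -
  interpret prob_space M by fact
  have [measurable]: "X \<in> borel_measurable M" using X by (simp add: centered_normal_def)
  from X show ?thesis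
  proof (cases rule: centered_normal_cases)
    case 1
    then have "(\<integral>\<omega>. (X \<omega>)\<^sup>2 \<partial>M) = (\<integral>\<omega>. 0 \<partial>M)" by (intro integral_cong_AE) (auto elim!: eventually_mono)
    then show ?thesis by simp
  next
    case (2 \<sigma>)
    have var: "(\<integral>\<omega>. (X \<omega>)\<^sup>2 \<partial>M) = \<sigma>\<^sup>2"
      using distributed_normal_even_moment[OF 2(2,1), of 1]
      by (simp add: normal_moment_const_def fact_2)
    have dens: "normal_density 0 \<sigma> x \<le> 1 / (2 * \<sigma>)" for x
    proof -
      have "2 * \<sigma> = sqrt (4 * \<sigma>\<^sup>2)" using 2(1) by (simp add: real_sqrt_mult)
      also have "\<dots> \<le> sqrt (2 * pi * \<sigma>\<^sup>2)"
        using pi_ge_two by (intro real_sqrt_le_mono mult_right_mono) auto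
      finally have "1 / sqrt (2 * pi * \<sigma>\<^sup>2) \<le> 1 / (2 * \<sigma>)" using 2(1) by (intro divide_left_mono) auto
      moreover have "exp (- (x - 0)\<^sup>2 / (2 * \<sigma>\<^sup>2)) \<le> 1" by simp
      ultimately show ?thesis unfolding normal_density_def
        using mult_mono[of "1 / sqrt (2 * pi * \<sigma>\<^sup>2)" "1 / (2 * \<sigma>)" "exp (- (x - 0)\<^sup>2 / (2 * \<sigma>\<^sup>2))" 1] 2(1)
        by simp
    qed
    have "measure M {\<omega> \<in> space M. \<bar>X \<omega>\<bar> \<le> \<eta>} = (\<integral>\<omega>. indicat_real {-\<eta>..\<eta>} (X \<omega>) \<partial>M)"
    proof -
      have "(\<integral>\<omega>. indicat_real {-\<eta>..\<eta>} (X \<omega>) \<partial>M) = (\<integral>\<omega>. indicat_real {\<omega> \<in> space M. \<bar>X \<omega>\<bar> \<le> \<eta>} \<omega> \<partial>M)"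
        by (intro Bochner_Integration.integral_cong) (auto simp: indicator_def abs_le_iff)
      then show ?thesis by simp
    qed
    also have "\<dots> = (\<integral>x. normal_density 0 \<sigma> x * indicator {-\<eta>..\<eta>} x \<partial>lborel)"
      by (rule distributed_integral[OF 2(2), symmetric]) auto
    also have "\<dots> \<le> (\<integral>x. 1 / (2 * \<sigma>) * indicator {-\<eta>..\<eta>} x \<partial>lborel)"
    proof (rule integral_mono)
      show "integrable lborel (\<lambda>x. normal_density 0 \<sigma> x * indicat_real {-\<eta>..\<eta>} x)"
        using integrable_normal_density[OF 2(1), of 0] by (intro integrable_real_mult_indicator) auto
      show "integrable lborel (\<lambda>x. 1 / (2 * \<sigma>) * indicat_real {-\<eta>..\<eta>} x)"
        by (intro integrable_mult_right integrable_real_indicator) (simp_all add: emeasure_lborel_Icc_eq)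
      show "normal_density 0 \<sigma> x * indicat_real {-\<eta>..\<eta>} x \<le> 1 / (2 * \<sigma>) * indicat_real {-\<eta>..\<eta>} x" for x
        by (intro mult_right_mono dens) simp
    qed
    also have "\<dots> = \<eta> / \<sigma>" using \<eta> by simp
    finally have "1 / 2 \<le> \<eta> / \<sigma>" using half by linarith
    then have "\<sigma> \<le> 2 * \<eta>" using 2(1) by (simp add: field_simps)
    then have "\<sigma>\<^sup>2 \<le> (2 * \<eta>)\<^sup>2" using 2(1) by (intro power_mono) auto
    then show ?thesis by (simp add: var power_mult_distrib)
  qed
qed

lemma square_mult_le_quartic: "(x * y)\<^sup>2 \<le> x ^ 4 + y ^ 4" for x y :: real
proof -
  have "0 \<le> (x\<^sup>2 - y\<^sup>2)\<^sup>2" "0 \<le> (x * y)\<^sup>2" by simp_all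
  then show ?thesis by (simp add: power2_eq_square power4_eq_xxxx algebra_simps)
qed

section \<open>Passage to the limit under a second moment bound\<close>

text \<open>Pointwise convergence and bounded second moments imply convergence of the means: truncation at
  level \<open>R\<close> costs at most \<open>B / R\<close>, uniformly along the sequence.\<close>

lemma convergence_of_means:
  fixes Q :: "nat \<Rightarrow> 'w \<Rightarrow> real"
  assumes "prob_space M"
    and Q[measurable]: "\<And>k. Q k \<in> borel_measurable M"
    and lim: "\<And>\<omega>. \<omega> \<in> space M \<Longrightarrow> (\<lambda>k. Q k \<omega>) \<longlonglongrightarrow> q \<omega>"
    and B: "\<And>k. (\<integral>\<^sup>+\<omega>. ennreal ((Q k \<omega>)\<^sup>2) \<partial>M) \<le> ennreal B" "B \<ge> 0"
  shows "integrable M (Q k)" and "integrable M q"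
    and "(\<lambda>k. \<integral>\<omega>. Q k \<omega> \<partial>M) \<longlonglongrightarrow> (\<integral>\<omega>. q \<omega> \<partial>M)"
proof -
  interpret prob_space M by fact
  have q[measurable]: "q \<in> borel_measurable M" by (rule borel_measurable_LIMSEQ_real[OF lim Q])
  have sq: "integrable M (\<lambda>\<omega>. (f \<omega>)\<^sup>2)" "(\<integral>\<omega>. (f \<omega>)\<^sup>2 \<partial>M) \<le> B"
    if [measurable]: "f \<in> borel_measurable M" and "(\<integral>\<^sup>+\<omega>. ennreal ((f \<omega>)\<^sup>2) \<partial>M) \<le> ennreal B" for f
  proof -
    show i: "integrable M (\<lambda>\<omega>. (f \<omega>)\<^sup>2)"
      using that(2) by (intro integrableI_bounded) (auto simp: le_less_trans)
    show "(\<integral>\<omega>. (f \<omega>)\<^sup>2 \<partial>M) \<le> B"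
      using that(2) B(2) nn_integral_eq_integral[OF i] by simp
  qed
  have int: "integrable M f"
    if [measurable]: "f \<in> borel_measurable M" and "(\<integral>\<^sup>+\<omega>. ennreal ((f \<omega>)\<^sup>2) \<partial>M) \<le> ennreal B" for f
  proof (rule Bochner_Integration.integrable_bound[of _ "\<lambda>\<omega>. 1 + (f \<omega>)\<^sup>2"])
    show "integrable M (\<lambda>\<omega>. 1 + (f \<omega>)\<^sup>2)" using sq[OF that] by simp
    have "\<bar>x\<bar> \<le> 1 + x\<^sup>2" for x :: real
    proof -
      have "0 \<le> (\<bar>x\<bar> - 1)\<^sup>2" by simp
      then have "2 * \<bar>x\<bar> \<le> 1 + x\<^sup>2" by (simp add: power2_diff)
      then show ?thesis by linarith
    qed
    then show "AE \<omega> in M. norm (f \<omega>) \<le> norm (1 + (f \<omega>)\<^sup>2)" by simp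
  qed simp
  show intQ: "integrable M (Q k)" for k by (rule int[OF Q B(1)])
  have "(\<integral>\<^sup>+\<omega>. ennreal ((q \<omega>)\<^sup>2) \<partial>M) = (\<integral>\<^sup>+\<omega>. liminf (\<lambda>k. ennreal ((Q k \<omega>)\<^sup>2)) \<partial>M)"
    by (intro nn_integral_cong lim_imp_Liminf[symmetric] tendsto_ennrealI tendsto_power lim) auto
  also have "\<dots> \<le> liminf (\<lambda>k. \<integral>\<^sup>+\<omega>. ennreal ((Q k \<omega>)\<^sup>2) \<partial>M)"
    by (rule nn_integral_liminf) simp
  also have "\<dots> \<le> liminf (\<lambda>k::nat. ennreal B)" by (intro Liminf_mono always_eventually allI B)
  also have "\<dots> = ennreal B" by (simp add: Liminf_const)
  finally have qB: "(\<integral>\<^sup>+\<omega>. ennreal ((q \<omega>)\<^sup>2) \<partial>M) \<le> ennreal B" .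
  show intq: "integrable M q" by (rule int[OF q qB])
  define cl where "cl R x = max (- R) (min x R)" for R x :: real
  have cl_m[measurable]: "cl R \<in> borel_measurable borel" for R unfolding cl_def by measurable
  have cl_diff: "\<bar>x - cl R x\<bar> \<le> x\<^sup>2 / R" if "R > 0" for R x
  proof (cases "\<bar>x\<bar> \<le> R")
    case True
    then show ?thesis using that by (auto simp: cl_def min_def max_def)
  next
    case False
    then have "\<bar>x - cl R x\<bar> \<le> \<bar>x\<bar>" using that by (auto simp: cl_def min_def max_def)
    also have "\<bar>x\<bar> * R \<le> \<bar>x\<bar> * \<bar>x\<bar>" using False by (intro mult_left_mono) auto
    then have "\<bar>x\<bar> \<le> x\<^sup>2 / R" using that by (simp add: field_simps power2_eq_square)
    finally show ?thesis .
  qed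
  have cl_int: "integrable M (\<lambda>\<omega>. cl R (f \<omega>))" if "R > 0" and [measurable]: "f \<in> borel_measurable M" for R f
    using that(1) by (intro integrable_const_bound[of _ R]) (auto simp: cl_def)
  have trunc: "\<bar>(\<integral>\<omega>. f \<omega> \<partial>M) - (\<integral>\<omega>. cl R (f \<omega>) \<partial>M)\<bar> \<le> B / R"
    if R: "R > 0" and f[measurable]: "f \<in> borel_measurable M"
      and fB: "(\<integral>\<^sup>+\<omega>. ennreal ((f \<omega>)\<^sup>2) \<partial>M) \<le> ennreal B" for R f
  proof -
    have "\<bar>(\<integral>\<omega>. f \<omega> \<partial>M) - (\<integral>\<omega>. cl R (f \<omega>) \<partial>M)\<bar> = \<bar>\<integral>\<omega>. f \<omega> - cl R (f \<omega>) \<partial>M\<bar>"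
      using int[OF f fB] cl_int[OF R f] by simp
    also have "\<dots> \<le> (\<integral>\<omega>. \<bar>f \<omega> - cl R (f \<omega>)\<bar> \<partial>M)" by (rule integral_abs_bound)
    also have "\<dots> \<le> (\<integral>\<omega>. (f \<omega>)\<^sup>2 / R \<partial>M)"
      using int[OF f fB] cl_int[OF R f] sq(1)[OF f fB] cl_diff[OF R] by (intro integral_mono) auto
    also have "\<dots> \<le> B / R" using sq(2)[OF f fB] R by (simp add: divide_right_mono)
    finally show ?thesis .
  qed
  show "(\<lambda>k. \<integral>\<omega>. Q k \<omega> \<partial>M) \<longlonglongrightarrow> (\<integral>\<omega>. q \<omega> \<partial>M)"
  proof (rule LIMSEQ_I)
    fix r :: real assume r: "r > 0"
    define R where "R = 4 * (B + 1) / r"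
    have R: "R > 0" "B / R < r / 3" using r B(2) by (auto simp: R_def field_simps intro: add_nonneg_pos)
    have "(\<lambda>k. \<integral>\<omega>. cl R (Q k \<omega>) \<partial>M) \<longlonglongrightarrow> (\<integral>\<omega>. cl R (q \<omega>) \<partial>M)"
    proof (rule integral_dominated_convergence[where w = "\<lambda>_. R"])
      show "AE \<omega> in M. (\<lambda>k. cl R (Q k \<omega>)) \<longlonglongrightarrow> cl R (q \<omega>)"
        unfolding cl_def by (intro AE_I2 tendsto_intros lim)
      show "AE \<omega> in M. norm (cl R (Q k \<omega>)) \<le> R" for k using R(1) by (auto simp: cl_def)
    qed auto
    from LIMSEQ_D[OF this, of "r / 3"] r obtain k0 where
      k0: "\<And>k. k \<ge> k0 \<Longrightarrow> \<bar>(\<integral>\<omega>. cl R (Q k \<omega>) \<partial>M) - (\<integral>\<omega>. cl R (q \<omega>) \<partial>M)\<bar> < r / 3"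
      by auto
    have "norm ((\<integral>\<omega>. Q k \<omega> \<partial>M) - (\<integral>\<omega>. q \<omega> \<partial>M)) < r" if "k \<ge> k0" for k
      using k0[OF that] trunc[OF R(1) Q B(1), of k] trunc[OF R(1) q qB] R(2)
      unfolding real_norm_def by linarith
    then show "\<exists>k0. \<forall>k\<ge>k0. norm ((\<integral>\<omega>. Q k \<omega> \<partial>M) - (\<integral>\<omega>. q \<omega> \<partial>M)) < r" by blast
  qed
qed

section \<open>A chaining bound for processes indexed by a bounded set\<close>

lemma card_int_vec_le:
  fixes S :: "int set"
  assumes "finite S"
  shows "finite {z :: int^'p. \<forall>i. z $ i \<in> S}" "card {z :: int^'p. \<forall>i. z $ i \<in> S} \<le> card S ^ CARD('p)"
proof -
  let ?P = "PiE (UNIV :: 'p set) (\<lambda>_. S)"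
  have sub: "{z :: int^'p. \<forall>i. z $ i \<in> S} \<subseteq> vec_lambda ` ?P"
  proof
    fix z :: "int^'p" assume "z \<in> {z. \<forall>i. z $ i \<in> S}"
    then show "z \<in> vec_lambda ` ?P" by (intro image_eqI[of _ _ "vec_nth z"]) (auto simp: vec_nth_inverse)
  qed
  have fin: "finite ?P" using assms by (intro finite_PiE) auto
  then show "finite {z :: int^'p. \<forall>i. z $ i \<in> S}" using sub by (rule finite_surj)
  have "card {z :: int^'p. \<forall>i. z $ i \<in> S} \<le> card ?P" by (rule surj_card_le[OF fin sub])
  also have "card ?P = card S ^ CARD('p)" by (simp add: card_PiE)
  finally show "card {z :: int^'p. \<forall>i. z $ i \<in> S} \<le> card S ^ CARD('p)" .
qed

text \<open>Nets of mesh \<open>O(4\<^sup>-\<^sup>j)\<close> inside an arbitrary bounded set: one point is chosen from each dyadic cube that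
  meets the set, and \<open>\<pi> j\<close> maps a point to the representative of its cube.\<close>

lemma dyadic_nets:
  fixes \<Theta> :: "(real^'p) set"
  assumes "bounded \<Theta>"
  obtains A :: nat and \<pi> :: "nat \<Rightarrow> real^'p \<Rightarrow> real^'p"
  where "\<And>j x. x \<in> \<Theta> \<Longrightarrow> \<pi> j x \<in> \<Theta>"
    and "\<And>j x. x \<in> \<Theta> \<Longrightarrow> norm (\<pi> j x - x) \<le> real CARD('p) / 4 ^ j"
    and "\<And>j. finite (\<pi> j ` \<Theta>)"
    and "\<And>j. card (\<pi> j ` \<Theta>) \<le> (A * 4 ^ j) ^ CARD('p)"
proof -
  obtain R0 where "\<forall>x\<in>\<Theta>. norm x \<le> R0" using assms unfolding bounded_iff by blast
  moreover obtain R :: nat where "R0 \<le> real R" using real_arch_simple by blast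
  ultimately have R: "\<And>x. x \<in> \<Theta> \<Longrightarrow> norm x \<le> real R" by force
  define idx :: "nat \<Rightarrow> real^'p \<Rightarrow> int^'p" where "idx j x = (\<chi> i. \<lfloor>4 ^ j * x $ i\<rfloor>)" for j x
  define rep where "rep j z = (SOME y. y \<in> \<Theta> \<and> idx j y = z)" for j z
  have rep: "rep j (idx j x) \<in> \<Theta> \<and> idx j (rep j (idx j x)) = idx j x" if "x \<in> \<Theta>" for j x
    unfolding rep_def by (rule someI[of _ x]) (simp add: that)
  define S :: "nat \<Rightarrow> int set" where "S j = {- (4 ^ j * (int R + 1)) .. 4 ^ j * (int R + 1)}" for j
  have cS: "card (S j) \<le> (2 * R + 3) * 4 ^ j" for j
  proof -
    have "int (card (S j)) = 2 * (4 ^ j * (int R + 1)) + 1" by (simp add: S_def)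
    also have "\<dots> \<le> 2 * (4 ^ j * (int R + 1)) + 4 ^ j" by simp
    also have "\<dots> = int ((2 * R + 3) * 4 ^ j)" by (simp add: algebra_simps)
    finally show ?thesis by linarith
  qed
  have idxS: "idx j ` \<Theta> \<subseteq> {z. \<forall>i. z $ i \<in> S j}" for j
  proof clarify
    fix x i assume x: "x \<in> \<Theta>"
    have "\<bar>x $ i\<bar> \<le> real R" using component_le_norm_cart[of x i] R[OF x] by linarith
    then have "\<bar>4 ^ j * x $ i\<bar> \<le> 4 ^ j * real R" by (simp add: abs_mult)
    moreover have "(1::real) \<le> 4 ^ j" by simp
    ultimately have "- (4 ^ j * (real R + 1)) \<le> 4 ^ j * x $ i" "4 ^ j * x $ i \<le> 4 ^ j * (real R + 1)"
      unfolding distrib_left mult_1_right by linarith+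
    moreover have "4 ^ j * (real R + 1) = real_of_int (4 ^ j * (int R + 1))" by simp
    ultimately have "- (4 ^ j * (int R + 1)) \<le> \<lfloor>4 ^ j * x $ i\<rfloor>" "\<lfloor>4 ^ j * x $ i\<rfloor> \<le> 4 ^ j * (int R + 1)"
      by linarith+
    then show "idx j x $ i \<in> S j" by (simp add: S_def idx_def)
  qed
  have fS: "finite (S j)" for j by (simp add: S_def)
  note fin = finite_subset[OF idxS card_int_vec_le(1)[OF fS]]
  have card: "card (idx j ` \<Theta>) \<le> ((2 * R + 3) * 4 ^ j) ^ CARD('p)" for j
    using card_mono[OF card_int_vec_le(1)[OF fS] idxS] card_int_vec_le(2)[OF fS, where 'p = 'p]
      power_mono[OF cS[of j], of "CARD('p)"] by (meson le0 order_trans)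
  have img: "(\<lambda>x. rep j (idx j x)) ` \<Theta> = rep j ` (idx j ` \<Theta>)" for j by auto
  show thesis
  proof (rule that[of "\<lambda>j x. rep j (idx j x)" "2 * R + 3"])
    show "rep j (idx j x) \<in> \<Theta>" if "x \<in> \<Theta>" for j x using rep[OF that] by simp
    show "norm (rep j (idx j x) - x) \<le> real CARD('p) / 4 ^ j" if x: "x \<in> \<Theta>" for j x
    proof -
      let ?y = "rep j (idx j x)"
      have "\<bar>(?y - x) $ i\<bar> \<le> 1 / 4 ^ j" for i
      proof -
        have "idx j ?y $ i = idx j x $ i" using rep[OF x] by simp
        then have "\<lfloor>4 ^ j * ?y $ i\<rfloor> = \<lfloor>4 ^ j * x $ i\<rfloor>" by (simp add: idx_def)
        then have "\<bar>4 ^ j * ?y $ i - 4 ^ j * x $ i\<bar> \<le> 1" by linarith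
        moreover have "4 ^ j * ?y $ i - 4 ^ j * x $ i = 4 ^ j * (?y - x) $ i" by (simp add: right_diff_distrib)
        ultimately have "4 ^ j * \<bar>(?y - x) $ i\<bar> \<le> 1" by (simp add: abs_mult)
        then show ?thesis by (simp add: pos_le_divide_eq mult.commute)
      qed
      then have "(\<Sum>i\<in>UNIV. \<bar>(?y - x) $ i\<bar>) \<le> (\<Sum>i\<in>(UNIV::'p set). 1 / 4 ^ j)" by (intro sum_mono)
      then show ?thesis using norm_le_l1_cart[of "?y - x"] by simp
    qed
    show "finite ((\<lambda>x. rep j (idx j x)) ` \<Theta>)" for j unfolding img by (intro finite_imageI fin)
    show "card ((\<lambda>x. rep j (idx j x)) ` \<Theta>) \<le> ((2 * R + 3) * 4 ^ j) ^ CARD('p)" for j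
      unfolding img using card_image_le[OF fin, of "rep j" j] card[of j] by linarith
  qed
qed

text \<open>A process with continuous paths that is bounded and Lipschitz as a map into \<open>L\<^sup>q\<close>; \<open>C\<close> bounds the \<open>q\<close>-th
  powers of the norms.\<close>

definition lipschitz_moments ::
  "'w measure \<Rightarrow> nat \<Rightarrow> real \<Rightarrow> 'a::real_normed_vector set \<Rightarrow> ('a \<Rightarrow> 'w \<Rightarrow> real) \<Rightarrow> bool" where
  "lipschitz_moments M q C A Y \<longleftrightarrow>
     (\<forall>x\<in>A. Y x \<in> borel_measurable M) \<and>
     (\<forall>\<omega>\<in>space M. continuous_on A (\<lambda>x. Y x \<omega>)) \<and>
     (\<forall>x\<in>A. (\<integral>\<^sup>+\<omega>. ennreal (\<bar>Y x \<omega>\<bar> ^ q) \<partial>M) \<le> ennreal C) \<and>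
     (\<forall>x\<in>A. \<forall>y\<in>A. (\<integral>\<^sup>+\<omega>. ennreal (\<bar>Y x \<omega> - Y y \<omega>\<bar> ^ q) \<partial>M) \<le> ennreal (C * norm (x - y) ^ q))"

text \<open>The \<open>q\<close>-th moment of the supremum over \<open>A\<close> is at most \<open>B\<close>.  A measurable majorant stands for the
  supremum, which for uncountable \<open>A\<close> need not be measurable.\<close>

definition sup_moment_le ::
  "'w measure \<Rightarrow> nat \<Rightarrow> real \<Rightarrow> 'a set \<Rightarrow> ('a \<Rightarrow> 'w \<Rightarrow> real) \<Rightarrow> bool" where
  "sup_moment_le M q B A Y \<longleftrightarrow> (\<exists>S\<in>borel_measurable M.
     (\<forall>\<omega>\<in>space M. \<forall>x\<in>A. ennreal (\<bar>Y x \<omega>\<bar> ^ q) \<le> S \<omega>) \<and> (\<integral>\<^sup>+\<omega>. S \<omega> \<partial>M) \<le> ennreal B)"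

text \<open>A process that is Lipschitz in \<open>L\<^sup>q\<close>, with \<open>q\<close> large compared to the dimension, has a supremum
  whose \<open>q\<close>-th moment is bounded by a constant that does not depend on the process.  The process is
  expanded along the nets; the \<open>j\<close>-th increment is weighted by \<open>2\<^sup>j\<close>, which turns the sum over \<open>j\<close> of the
  suprema into a sum of \<open>q\<close>-th powers.  There are \<open>O(2\<^bsup>4pj\<^esup>)\<close> pairs of neighbouring net points at level \<open>j\<close>, each
  contributing \<open>O(2\<^bsup>-jq\<^esup>)\<close>, so that \<open>q = 4p + 2\<close> makes the series converge.\<close>

lemma chaining_bound:
  fixes \<Theta> :: "(real^'p) set" and C :: real and M :: "'w measure"
  assumes "bounded \<Theta>" and C: "C \<ge> 0" and q: "q = 4 * CARD('p) + 2"
  obtains B where "B \<ge> 0" and "\<And>Y. lipschitz_moments M q C \<Theta> Y \<Longrightarrow> sup_moment_le M q B \<Theta> Y"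
proof -
  let ?p = "CARD('p)"
  obtain A \<pi> where \<pi>: "\<And>j x. x \<in> \<Theta> \<Longrightarrow> \<pi> j x \<in> \<Theta>"
    "\<And>j x. x \<in> \<Theta> \<Longrightarrow> norm (\<pi> j x - x) \<le> real ?p / 4 ^ j"
    "\<And>j. finite (\<pi> j ` \<Theta>)" "\<And>j. card (\<pi> j ` \<Theta>) \<le> (A * 4 ^ j) ^ ?p"
    by (rule dyadic_nets[OF assms(1)]) blast
  define F where "F j = \<pi> j ` \<Theta>" for j
  have F: "finite (F j)" "card (F j) \<le> (A * 4 ^ j) ^ ?p" "F j \<subseteq> \<Theta>" for j
    using \<pi> by (auto simp: F_def)
  define P where "P j = {z \<in> F j \<times> F (Suc j). norm (fst z - snd z) \<le> 2 * real ?p / 4 ^ j}" for j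
  have P: "finite (P j)" "P j \<subseteq> \<Theta> \<times> \<Theta>" for j
    using F by (auto simp: P_def intro: finite_subset[of _ "F j \<times> F (Suc j)"])
  define D where "D = real (A ^ (2 * ?p) * 4 ^ ?p)"
  have cardP: "real (card (P j)) \<le> D * 2 ^ (4 * ?p * j)" for j
  proof -
    have "card (P j) \<le> card (F j \<times> F (Suc j))" using F by (intro card_mono) (auto simp: P_def)
    also have "\<dots> \<le> (A * 4 ^ j) ^ ?p * (A * 4 ^ Suc j) ^ ?p"
      unfolding card_cartesian_product by (intro mult_mono F) auto
    also have "\<dots> = A ^ (2 * ?p) * 4 ^ ?p * (4 ^ j) ^ (2 * ?p)"
      by (simp only: mult_2 power_add power_mult_distrib power_Suc) (simp add: mult_ac)
    also have "(4 ^ j) ^ (2 * ?p) = (2::nat) ^ (4 * ?p * j)"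
    proof -
      have "(4::nat) = 2 ^ 2" by simp
      then show ?thesis by (simp only: power_mult[symmetric]) (simp add: mult_ac)
    qed
    finally have "card (P j) \<le> A ^ (2 * ?p) * 4 ^ ?p * 2 ^ (4 * ?p * j)" .
    then have "real (card (P j)) \<le> real (A ^ (2 * ?p) * 4 ^ ?p * 2 ^ (4 * ?p * j))" by (rule of_nat_mono)
    then show ?thesis by (simp add: D_def)
  qed
  define E where "E = D * C * (2 * real ?p) ^ q"
  have E0: "E \<ge> 0" using C by (simp add: E_def D_def)
  define B where "B = 3 ^ q * (real ((A * 4 ^ 0) ^ ?p) * C + 2 * E)"
  show thesis
  proof (rule that[of B])
    show "B \<ge> 0" using C E0 by (simp add: B_def)
    fix Y :: "real^'p \<Rightarrow> 'w \<Rightarrow> real"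
    assume Y: "lipschitz_moments M q C \<Theta> Y"
    then have Ym: "\<And>x. x \<in> \<Theta> \<Longrightarrow> Y x \<in> borel_measurable M"
      and Yc: "\<And>\<omega>. \<omega> \<in> space M \<Longrightarrow> continuous_on \<Theta> (\<lambda>x. Y x \<omega>)"
      and Y0: "\<And>x. x \<in> \<Theta> \<Longrightarrow> (\<integral>\<^sup>+\<omega>. ennreal (\<bar>Y x \<omega>\<bar> ^ q) \<partial>M) \<le> ennreal C"
      and Y1: "\<And>x y. x \<in> \<Theta> \<Longrightarrow> y \<in> \<Theta> \<Longrightarrow>
        (\<integral>\<^sup>+\<omega>. ennreal (\<bar>Y x \<omega> - Y y \<omega>\<bar> ^ q) \<partial>M) \<le> ennreal (C * norm (x - y) ^ q)"
      unfolding lipschitz_moments_def by auto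
    define T0 where "T0 \<omega> = (\<Sum>y\<in>F 0. ennreal (\<bar>Y y \<omega>\<bar> ^ q))" for \<omega>
    define T1 where "T1 j \<omega> = (\<Sum>z\<in>P j. ennreal (2 ^ (j * q)) * ennreal (\<bar>Y (fst z) \<omega> - Y (snd z) \<omega>\<bar> ^ q))" for j \<omega>
    define T where "T \<omega> = T0 \<omega> + (\<Sum>j. T1 j \<omega>)" for \<omega>
    have m0[measurable]: "T0 \<in> borel_measurable M"
      unfolding T0_def using Ym F(3)[of 0] by (intro borel_measurable_sum) auto
    have mz: "(\<lambda>\<omega>. ennreal (\<bar>Y (fst z) \<omega> - Y (snd z) \<omega>\<bar> ^ q)) \<in> borel_measurable M" if "z \<in> P j" for z j
    proof -
      have [measurable]: "Y (fst z) \<in> borel_measurable M" "Y (snd z) \<in> borel_measurable M"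
        using that P(2)[of j] by (auto intro!: Ym)
      show ?thesis by measurable
    qed
    have m1[measurable]: "T1 j \<in> borel_measurable M" for j
      unfolding T1_def using mz by (intro borel_measurable_sum borel_measurable_times) auto
    have mT[measurable]: "T \<in> borel_measurable M" unfolding T_def by measurable
    have i0: "(\<integral>\<^sup>+\<omega>. T0 \<omega> \<partial>M) \<le> ennreal (real ((A * 4 ^ 0) ^ ?p) * C)"
    proof -
      have "(\<integral>\<^sup>+\<omega>. T0 \<omega> \<partial>M) = (\<Sum>y\<in>F 0. \<integral>\<^sup>+\<omega>. ennreal (\<bar>Y y \<omega>\<bar> ^ q) \<partial>M)"
        unfolding T0_def using Ym F(3)[of 0] by (intro nn_integral_sum) auto
      also have "\<dots> \<le> (\<Sum>y\<in>F 0. ennreal C)" using F(3)[of 0] by (intro sum_mono Y0) auto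
      also have "\<dots> = ennreal (real (card (F 0)) * C)"
        using C by (simp add: ennreal_mult ennreal_of_nat_eq_real_of_nat)
      also have "\<dots> \<le> ennreal (real ((A * 4 ^ 0) ^ ?p) * C)"
        using F(2)[of 0] C by (intro ennreal_leI mult_right_mono of_nat_mono)
      finally show ?thesis .
    qed
    have i1: "(\<integral>\<^sup>+\<omega>. T1 j \<omega> \<partial>M) \<le> ennreal (E * (1/4) ^ j)" for j
    proof -
      have summand: "(\<integral>\<^sup>+\<omega>. ennreal (2 ^ (j * q)) * ennreal (\<bar>Y (fst z) \<omega> - Y (snd z) \<omega>\<bar> ^ q) \<partial>M)
          \<le> ennreal (2 ^ (j * q) * (C * (2 * real ?p / 4 ^ j) ^ q))" if z: "z \<in> P j" for z
      proof -
        have zz: "fst z \<in> \<Theta>" "snd z \<in> \<Theta>" "norm (fst z - snd z) \<le> 2 * real ?p / 4 ^ j"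
          using z P(2)[of j] by (auto simp: P_def)
        have "(\<integral>\<^sup>+\<omega>. ennreal (2 ^ (j * q)) * ennreal (\<bar>Y (fst z) \<omega> - Y (snd z) \<omega>\<bar> ^ q) \<partial>M)
            = ennreal (2 ^ (j * q)) * (\<integral>\<^sup>+\<omega>. ennreal (\<bar>Y (fst z) \<omega> - Y (snd z) \<omega>\<bar> ^ q) \<partial>M)"
          using mz[OF z] by (rule nn_integral_cmult)
        also have "\<dots> \<le> ennreal (2 ^ (j * q)) * ennreal (C * (2 * real ?p / 4 ^ j) ^ q)"
          using C zz(3)
          by (intro mult_left_mono order_trans[OF Y1[OF zz(1,2)]] ennreal_leI mult_left_mono power_mono) auto
        finally show ?thesis using C by (simp add: ennreal_mult)
      qed
      have "(\<integral>\<^sup>+\<omega>. T1 j \<omega> \<partial>M) = (\<Sum>z\<in>P j. \<integral>\<^sup>+\<omega>. ennreal (2 ^ (j * q)) * ennreal (\<bar>Y (fst z) \<omega> - Y (snd z) \<omega>\<bar> ^ q) \<partial>M)"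
        unfolding T1_def using mz by (intro nn_integral_sum borel_measurable_times) auto
      also have "\<dots> \<le> (\<Sum>z\<in>P j. ennreal (2 ^ (j * q) * (C * (2 * real ?p / 4 ^ j) ^ q)))"
        by (intro sum_mono summand)
      also have "\<dots> = ennreal (real (card (P j)) * (2 ^ (j * q) * (C * (2 * real ?p / 4 ^ j) ^ q)))"
        using C by (simp add: ennreal_mult ennreal_of_nat_eq_real_of_nat)
      also have "\<dots> \<le> ennreal (D * 2 ^ (4 * ?p * j) * (2 ^ (j * q) * (C * (2 * real ?p / 4 ^ j) ^ q)))"
        using C by (intro ennreal_leI mult_right_mono cardP) auto
      also have "D * 2 ^ (4 * ?p * j) * (2 ^ (j * q) * (C * (2 * real ?p / 4 ^ j) ^ q)) =
          E * (2 ^ (4 * ?p * j) * 2 ^ (j * q) / (4 ^ j) ^ q)"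
        by (simp add: E_def power_divide power_mult_distrib mult_ac)
      also have "2 ^ (4 * ?p * j) * 2 ^ (j * q) / (4 ^ j) ^ q = ((1/4::real)) ^ j"
      proof -
        have "(4::real) = 2 ^ 2" by simp
        then have "(4 ^ j) ^ q = (2::real) ^ (2 * j * q)" by (simp only: power_mult[symmetric])
        also have "2 * j * q = 4 * ?p * j + j * q + 2 * j" by (simp add: q algebra_simps)
        also have "(2::real) ^ \<dots> = 2 ^ (4 * ?p * j) * 2 ^ (j * q) * 4 ^ j"
          by (simp add: power_add power_mult)
        finally show ?thesis by (simp add: power_divide)
      qed
      finally show ?thesis .
    qed
    have "(\<integral>\<^sup>+\<omega>. T \<omega> \<partial>M) = (\<integral>\<^sup>+\<omega>. T0 \<omega> \<partial>M) + (\<Sum>j. \<integral>\<^sup>+\<omega>. T1 j \<omega> \<partial>M)"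
      unfolding T_def by (simp add: nn_integral_add nn_integral_suminf)
    also have "\<dots> \<le> ennreal (real ((A * 4 ^ 0) ^ ?p) * C) + (\<Sum>j. ennreal (E * (1/4) ^ j))"
      by (intro add_mono i0 suminf_le i1) auto
    also have "(\<Sum>j. ennreal (E * (1/4) ^ j)) = ennreal (E * (4/3))"
    proof -
      have "(\<lambda>j. E * (1/4) ^ j) sums (E * (1 / (1 - 1/4)))"
        by (intro sums_mult geometric_sums) simp
      then show ?thesis using E0 by (intro suminf_ennreal_eq) auto
    qed
    also have "ennreal (real ((A * 4 ^ 0) ^ ?p) * C) + ennreal (E * (4/3))
        \<le> ennreal (real ((A * 4 ^ 0) ^ ?p) * C + 2 * E)"
      using C E0 by (subst ennreal_plus[symmetric]) (auto intro!: ennreal_leI)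
    finally have iT: "(\<integral>\<^sup>+\<omega>. T \<omega> \<partial>M) \<le> ennreal (real ((A * 4 ^ 0) ^ ?p) * C + 2 * E)" .
    have bound: "ennreal (\<bar>Y x \<omega>\<bar> ^ q) \<le> ennreal (3 ^ q) * T \<omega>" if \<omega>: "\<omega> \<in> space M" and x: "x \<in> \<Theta>" for \<omega> x
    proof (cases "T \<omega> = \<infinity>")
      case True
      then show ?thesis by (simp add: ennreal_mult_eq_top_iff)
    next
      case False
      define s where "s = enn2real (T \<omega>)"
      have s: "T \<omega> = ennreal s" "s \<ge> 0" using False by (auto simp: s_def less_top)
      have q0: "q > 0" by (simp add: q)
      define \<rho> where "\<rho> = root q s"
      have \<rho>: "\<rho> \<ge> 0" "\<rho> ^ q = s" using q0 s(2) by (auto simp: \<rho>_def)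
      have le_\<rho>: "a \<le> \<rho>" if "ennreal (a ^ q) \<le> T \<omega>" for a
      proof (rule ccontr)
        assume "\<not> a \<le> \<rho>"
        then have "\<rho> ^ q < a ^ q" using \<rho>(1) q0 by (intro power_strict_mono) auto
        moreover have "a ^ q \<le> s" using that s by (simp add: ennreal_le_iff)
        ultimately show False using \<rho>(2) by simp
      qed
      have c0: "\<bar>Y (\<pi> 0 x) \<omega>\<bar> \<le> \<rho>"
      proof (rule le_\<rho>)
        have "ennreal (\<bar>Y (\<pi> 0 x) \<omega>\<bar> ^ q) \<le> T0 \<omega>"
          unfolding T0_def using x F(1)[of 0] by (intro member_le_sum) (auto simp: F_def)
        also have "\<dots> \<le> T \<omega>" by (simp add: T_def)
        finally show "ennreal (\<bar>Y (\<pi> 0 x) \<omega>\<bar> ^ q) \<le> T \<omega>" .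
      qed
      have c1: "\<bar>Y (\<pi> (Suc j) x) \<omega> - Y (\<pi> j x) \<omega>\<bar> \<le> \<rho> * (1/2) ^ j" for j
      proof -
        let ?z = "(\<pi> j x, \<pi> (Suc j) x)"
        have "norm (\<pi> j x - \<pi> (Suc j) x) \<le> norm (\<pi> j x - x) + norm (\<pi> (Suc j) x - x)"
          by (metis norm_minus_commute norm_triangle_sub dist_norm dist_triangle2)
        also have "\<dots> \<le> real ?p / 4 ^ j + real ?p / 4 ^ Suc j" by (intro add_mono \<pi>(2) x)
        also have "\<dots> \<le> 2 * real ?p / 4 ^ j" by (simp add: field_simps)
        finally have z: "?z \<in> P j" using x by (simp add: P_def F_def)
        have "2 ^ j * \<bar>Y (\<pi> (Suc j) x) \<omega> - Y (\<pi> j x) \<omega>\<bar> \<le> \<rho>"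
        proof (rule le_\<rho>)
          have "ennreal ((2 ^ j * \<bar>Y (\<pi> (Suc j) x) \<omega> - Y (\<pi> j x) \<omega>\<bar>) ^ q)
              = ennreal (2 ^ (j * q)) * ennreal (\<bar>Y (fst ?z) \<omega> - Y (snd ?z) \<omega>\<bar> ^ q)"
            by (simp add: ennreal_mult[symmetric] power_mult_distrib power_mult abs_minus_commute)
          also have "\<dots> \<le> T1 j \<omega>"
            unfolding T1_def
            using member_le_sum[of ?z "P j" "\<lambda>z. ennreal (2 ^ (j * q)) * ennreal (\<bar>Y (fst z) \<omega> - Y (snd z) \<omega>\<bar> ^ q)"]
              z P(1)[of j] by simp
          also have "T1 j \<omega> \<le> (\<Sum>j. T1 j \<omega>)"
            using sum_le_suminf[of "\<lambda>j. T1 j \<omega>" "{j}"] by simp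
          also have "\<dots> \<le> T \<omega>" by (simp add: T_def)
          finally show "ennreal ((2 ^ j * \<bar>Y (\<pi> (Suc j) x) \<omega> - Y (\<pi> j x) \<omega>\<bar>) ^ q) \<le> T \<omega>" .
        qed
        then show ?thesis by (simp add: field_simps power_divide)
      qed
      have cm: "\<bar>Y (\<pi> m x) \<omega>\<bar> \<le> \<rho> + \<rho> * (2 - 2 * (1/2) ^ m)" for m
      proof (induction m)
        case 0
        then show ?case using c0 by simp
      next
        case (Suc m)
        have "\<bar>Y (\<pi> (Suc m) x) \<omega>\<bar> \<le> \<bar>Y (\<pi> m x) \<omega>\<bar> + \<rho> * (1/2) ^ m" using c1[of m] by linarith
        then show ?case using Suc by (simp add: algebra_simps)
      qed
      have "(\<lambda>m. \<pi> m x) \<longlonglongrightarrow> x"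
      proof (rule LIM_zero_cancel, rule Lim_null_comparison)
        show "\<forall>\<^sub>F m in sequentially. norm (\<pi> m x - x) \<le> real ?p * (1/4) ^ m"
          using \<pi>(2)[OF x] by (simp add: power_divide)
        show "(\<lambda>m. real ?p * (1/4) ^ m) \<longlonglongrightarrow> 0"
          by (intro tendsto_mult_right_zero LIMSEQ_realpow_zero) auto
      qed
      then have "(\<lambda>m. Y (\<pi> m x) \<omega>) \<longlonglongrightarrow> Y x \<omega>"
        by (rule continuous_on_tendsto_compose[OF Yc[OF \<omega>] _ x]) (simp add: \<pi>(1)[OF x])
      then have "\<bar>Y x \<omega>\<bar> \<le> 3 * \<rho>"
      proof (rule LIMSEQ_le_const2[OF tendsto_rabs])
        have "\<bar>Y (\<pi> m x) \<omega>\<bar> \<le> 3 * \<rho>" for m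
        proof -
          have "\<rho> * (2 - 2 * (1/2) ^ m) \<le> \<rho> * 2" using \<rho>(1) by (intro mult_left_mono) auto
          then show ?thesis using cm[of m] by linarith
        qed
        then show "\<exists>N. \<forall>m\<ge>N. \<bar>Y (\<pi> m x) \<omega>\<bar> \<le> 3 * \<rho>" by blast
      qed
      then have "\<bar>Y x \<omega>\<bar> ^ q \<le> (3 * \<rho>) ^ q" by (intro power_mono) auto
      also have "\<dots> = 3 ^ q * s" by (simp add: power_mult_distrib \<rho>(2))
      finally show ?thesis using s by (simp add: ennreal_mult[symmetric] ennreal_leI)
    qed
    show "sup_moment_le M q B \<Theta> Y"
      unfolding sup_moment_le_def
    proof (intro bexI[of _ "\<lambda>\<omega>. ennreal (3 ^ q) * T \<omega>"] conjI ballI)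
      have "(\<integral>\<^sup>+\<omega>. ennreal (3 ^ q) * T \<omega> \<partial>M) = ennreal (3 ^ q) * (\<integral>\<^sup>+\<omega>. T \<omega> \<partial>M)"
        by (rule nn_integral_cmult) simp
      also have "\<dots> \<le> ennreal (3 ^ q) * ennreal (real ((A * 4 ^ 0) ^ ?p) * C + 2 * E)"
        by (intro mult_left_mono iT) simp
      also have "\<dots> = ennreal B" using C E0 by (simp add: B_def ennreal_mult)
      finally show "(\<integral>\<^sup>+\<omega>. ennreal (3 ^ q) * T \<omega> \<partial>M) \<le> ennreal B" .
    qed (auto intro: bound)
  qed
qed

section \<open>The bilinear form of a continuous kernel\<close>

text \<open>A symmetric continuous kernel on the square of \<open>{0..\<tau>}\<close>; no definiteness is assumed.\<close>

locale continuous_kernel =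
  fixes \<tau> :: real and K :: "real \<Rightarrow> real \<Rightarrow> real"
  assumes \<tau>: "\<tau> > 0"
    and K_cont: "continuous_on ({0..\<tau>} \<times> {0..\<tau>}) (\<lambda>(s, u). K s u)"
    and K_sym: "K s u = K u s"
begin

abbreviation "T \<equiv> {0..\<tau>}"

text \<open>The double integral of the kernel, and its value on the discretised measures.\<close>

definition bil :: "real signed_measure \<Rightarrow> real signed_measure \<Rightarrow> real" where
  "bil \<nu> \<rho> = pairing T \<nu> (cov_op T K \<rho>)"

definition grid_bil :: "nat \<Rightarrow> (nat \<Rightarrow> real) \<Rightarrow> real signed_measure \<Rightarrow> real signed_measure \<Rightarrow> real" where
  "grid_bil n t \<nu> \<rho> = (\<Sum>i=1..n. \<Sum>j=1..n. smeasure \<nu> (cell t i) * smeasure \<rho> (cell t j) * K (t i) (t j))"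

text \<open>The kernel oscillates by at most \<open>d\<close> on each cell of the product grid.\<close>

definition cell_osc :: "nat \<Rightarrow> (nat \<Rightarrow> real) \<Rightarrow> real \<Rightarrow> bool" where
  "cell_osc n t d \<longleftrightarrow> (\<forall>i\<in>{1..n}. \<forall>j\<in>{1..n}. \<forall>s\<in>cell t i. \<forall>u\<in>cell t j. \<bar>K (t i) (t j) - K s u\<bar> \<le> d)"

lemma K_bounded:
  obtains \<kappa> where "\<kappa> \<ge> 0" "\<And>s u. s \<in> T \<Longrightarrow> u \<in> T \<Longrightarrow> \<bar>K s u\<bar> \<le> \<kappa>"
proof -
  have "compact (T \<times> T)" by (intro compact_Times compact_Icc)
  then have "bounded ((\<lambda>(s, u). K s u) ` (T \<times> T))"
    by (intro compact_imp_bounded compact_continuous_image K_cont)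
  then obtain \<kappa> where "\<kappa> > 0" "\<forall>y\<in>(\<lambda>(s, u). K s u) ` (T \<times> T). norm y \<le> \<kappa>"
    unfolding bounded_pos by metis
  then show thesis by (intro that[of \<kappa>]) auto
qed

lemma K_unif:
  assumes "e > 0"
  obtains d where "d > 0" "\<And>s u s' u'. s \<in> T \<Longrightarrow> u \<in> T \<Longrightarrow> s' \<in> T \<Longrightarrow> u' \<in> T \<Longrightarrow>
    \<bar>s - s'\<bar> < d \<Longrightarrow> \<bar>u - u'\<bar> < d \<Longrightarrow> \<bar>K s u - K s' u'\<bar> < e"
proof -
  have "uniformly_continuous_on (T \<times> T) (\<lambda>(s, u). K s u)"
    by (intro compact_uniformly_continuous K_cont compact_Times compact_Icc)
  then obtain d where d: "d > 0" "\<And>x x'. x \<in> T \<times> T \<Longrightarrow> x' \<in> T \<times> T \<Longrightarrow> dist x' x < d \<Longrightarrow>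
      dist ((\<lambda>(s, u). K s u) x') ((\<lambda>(s, u). K s u) x) < e"
    using assms unfolding uniformly_continuous_on_def by metis
  have "\<bar>K s u - K s' u'\<bar> < e" if "s \<in> T" "u \<in> T" "s' \<in> T" "u' \<in> T" "\<bar>s - s'\<bar> < d / 2" "\<bar>u - u'\<bar> < d / 2"
    for s u s' u'
  proof -
    have "dist (s, u) (s', u') \<le> \<bar>s - s'\<bar> + \<bar>u - u'\<bar>"
      using norm_Pair_le[of "s - s'" "u - u'"] by (simp add: dist_norm)
    then have "dist (s, u) (s', u') < d" using that by linarith
    then show ?thesis using d(2)[of "(s', u')" "(s, u)"] that by (simp add: dist_real_def)
  qed
  then show thesis using d(1) by (intro that[of "d / 2"]) auto
qed

lemma K_cont_right: "s \<in> T \<Longrightarrow> continuous_on T (K s)"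
proof -
  assume s: "s \<in> T"
  have "continuous_on T (\<lambda>u. (\<lambda>(s, u). K s u) (s, u))"
    by (rule continuous_on_compose2[OF K_cont]) (auto intro!: continuous_intros simp: s[simplified])
  then show ?thesis by simp
qed

lemma cov_op_diff_le:
  assumes "s \<in> T" "s' \<in> T" "\<And>u. u \<in> T \<Longrightarrow> \<bar>K s u - K s' u\<bar> \<le> e"
  shows "\<bar>cov_op T K \<rho> s - cov_op T K \<rho> s'\<bar> \<le> norm \<rho> * e"
proof -
  note c = K_cont_right[OF assms(1)] K_cont_right[OF assms(2)]
  have "\<bar>pairing T \<rho> (\<lambda>u. K s u - K s' u)\<bar> \<le> norm \<rho> * e"
    by (intro pairing_bound \<tau> continuous_on_diff c assms(3))
  then show ?thesis unfolding cov_op_def by (simp add: pairing_diff_right[OF \<tau> c])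
qed

lemma cov_op_cont: "continuous_on T (cov_op T K \<rho>)"
  unfolding continuous_on_iff
proof (intro ballI allI impI)
  fix s e :: real assume s: "s \<in> T" and e: "e > 0"
  define e' where "e' = e / (norm \<rho> + 1)"
  have pos: "norm \<rho> + 1 > 0" by (simp add: add_nonneg_pos)
  have e': "e' > 0" "norm \<rho> * e' < e" using e pos by (simp_all add: e'_def pos_divide_less_eq algebra_simps)
  obtain d where d: "d > 0" "\<And>s u s' u'. s \<in> T \<Longrightarrow> u \<in> T \<Longrightarrow> s' \<in> T \<Longrightarrow> u' \<in> T \<Longrightarrow>
    \<bar>s - s'\<bar> < d \<Longrightarrow> \<bar>u - u'\<bar> < d \<Longrightarrow> \<bar>K s u - K s' u'\<bar> < e'" by (rule K_unif[OF e'(1)]) blast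
  show "\<exists>d>0. \<forall>s'\<in>T. dist s' s < d \<longrightarrow> dist (cov_op T K \<rho> s') (cov_op T K \<rho> s) < e"
  proof (intro exI[of _ d] conjI ballI impI d(1))
    fix s' assume s': "s' \<in> T" "dist s' s < d"
    have "\<bar>K s' u - K s u\<bar> \<le> e'" if "u \<in> T" for u
      using d(2)[of s' u s u] s s' that d(1) by (simp add: dist_real_def)
    then have "\<bar>cov_op T K \<rho> s' - cov_op T K \<rho> s\<bar> \<le> norm \<rho> * e'"
      by (intro cov_op_diff_le s s'(1))
    then show "dist (cov_op T K \<rho> s') (cov_op T K \<rho> s) < e" using e'(2) by (simp add: dist_real_def)
  qed
qed

lemma cov_op_bound:
  assumes "s \<in> T" "\<And>u. u \<in> T \<Longrightarrow> \<bar>K s u\<bar> \<le> e"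
  shows "\<bar>cov_op T K \<rho> s\<bar> \<le> norm \<rho> * e"
  unfolding cov_op_def by (rule pairing_bound[OF \<tau> K_cont_right[OF assms(1)] assms(2)])

lemma cov_op_add: "s \<in> T \<Longrightarrow> cov_op T K (\<rho> + \<rho>') s = cov_op T K \<rho> s + cov_op T K \<rho>' s"
  unfolding cov_op_def by (intro pairing_add \<tau> K_cont_right)

lemma cov_op_scaleR: "s \<in> T \<Longrightarrow> cov_op T K (c *\<^sub>R \<rho>) s = c * cov_op T K \<rho> s"
  unfolding cov_op_def by (intro pairing_scaleR \<tau> K_cont_right)

lemma bounded_bilinear_bil: "bounded_bilinear bil"
proof
  fix \<nu> \<nu>' \<rho> \<rho>' :: "real signed_measure" and c :: real
  show "bil (\<nu> + \<nu>') \<rho> = bil \<nu> \<rho> + bil \<nu>' \<rho>"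
    unfolding bil_def by (intro pairing_add \<tau> cov_op_cont)
  show "bil (c *\<^sub>R \<nu>) \<rho> = c *\<^sub>R bil \<nu> \<rho>"
    unfolding bil_def using pairing_scaleR[OF \<tau> cov_op_cont] by simp
  have "bil \<nu> (\<rho> + \<rho>') = pairing T \<nu> (\<lambda>s. cov_op T K \<rho> s + cov_op T K \<rho>' s)"
    unfolding bil_def by (rule pairing_cong) (rule cov_op_add)
  then show "bil \<nu> (\<rho> + \<rho>') = bil \<nu> \<rho> + bil \<nu> \<rho>'"
    by (simp add: bil_def pairing_add_right[OF \<tau> cov_op_cont cov_op_cont])
  have "bil \<nu> (c *\<^sub>R \<rho>) = pairing T \<nu> (\<lambda>s. c * cov_op T K \<rho> s)"
    unfolding bil_def by (rule pairing_cong) (rule cov_op_scaleR)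
  then show "bil \<nu> (c *\<^sub>R \<rho>) = c *\<^sub>R bil \<nu> \<rho>"
    by (simp add: bil_def pairing_scale_right[OF \<tau> cov_op_cont])
next
  obtain \<kappa> where \<kappa>: "\<kappa> \<ge> 0" "\<And>s u. s \<in> T \<Longrightarrow> u \<in> T \<Longrightarrow> \<bar>K s u\<bar> \<le> \<kappa>" by (rule K_bounded) blast
  show "\<exists>C. \<forall>\<nu> \<rho>. norm (bil \<nu> \<rho>) \<le> norm \<nu> * norm \<rho> * C"
  proof (intro exI allI)
    fix \<nu> \<rho> :: "real signed_measure"
    have "\<bar>cov_op T K \<rho> s\<bar> \<le> norm \<rho> * \<kappa>" if "s \<in> T" for s by (intro cov_op_bound that \<kappa>(2))
    then have "\<bar>bil \<nu> \<rho>\<bar> \<le> norm \<nu> * (norm \<rho> * \<kappa>)"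
      unfolding bil_def by (intro pairing_bound \<tau> cov_op_cont)
    then show "norm (bil \<nu> \<rho>) \<le> norm \<nu> * norm \<rho> * \<kappa>" by (simp add: mult.assoc)
  qed
qed

lemma bil_dirac: "s \<in> T \<Longrightarrow> bil (dirac s) \<rho> = cov_op T K \<rho> s"
  unfolding bil_def by (intro pairing_dirac \<tau> cov_op_cont)

lemma grid_bil_eq: "grid_bil n t \<nu> \<rho> = grid_sum n t \<nu> (\<lambda>s. grid_sum n t \<rho> (K s))"
  by (simp add: grid_bil_def grid_sum_def sum_distrib_left mult.assoc)

lemma grid_bil_sym: "grid_bil n t \<nu> \<rho> = grid_bil n t \<rho> \<nu>"
  unfolding grid_bil_def by (subst sum.swap) (simp add: K_sym mult_ac)

lemma grid_bil_le:
  assumes g: "is_grid \<tau> n t" and \<kappa>: "\<kappa> \<ge> 0" "\<And>s u. s \<in> T \<Longrightarrow> u \<in> T \<Longrightarrow> \<bar>K s u\<bar> \<le> \<kappa>"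
  shows "\<bar>grid_bil n t \<nu> \<rho>\<bar> \<le> \<kappa> * norm \<nu> * norm \<rho>"
proof -
  have "\<bar>grid_bil n t \<nu> \<rho>\<bar> \<le> norm \<nu> * (norm \<rho> * \<kappa>)"
    unfolding grid_bil_eq
    by (intro grid_sum_bound[OF g] \<kappa> mult_nonneg_nonneg norm_ge_zero grid_range[OF g]) auto
  then show ?thesis by (simp add: mult_ac)
qed

lemma cell_osc_node:
  assumes g: "is_grid \<tau> n t" and d: "cell_osc n t d" and i: "i \<in> {1..n}" and j: "j \<in> {1..n}" "u \<in> cell t j"
  shows "\<bar>K (t i) (t j) - K (t i) u\<bar> \<le> d"
  using d i j cell_subset(4)[OF g i] unfolding cell_osc_def by blast

lemma cov_op_osc:
  assumes g: "is_grid \<tau> n t" and n: "n \<ge> 1" and d: "cell_osc n t d"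
    and i: "i \<in> {1..n}" "s \<in> cell t i"
  shows "\<bar>cov_op T K \<rho> (t i) - cov_op T K \<rho> s\<bar> \<le> norm \<rho> * (2 * d)"
proof (rule cov_op_diff_le)
  show "t i \<in> T" "s \<in> T" using grid_range[OF g, of i] cell_subset_interval[OF g i(1)] i by auto
  fix u assume "u \<in> T"
  then obtain j where j: "j \<in> {1..n}" "u \<in> cell t j" using cells_cover[OF g n] by blast
  have "\<bar>K (t i) (t j) - K s u\<bar> \<le> d" using d i j unfolding cell_osc_def by blast
  then show "\<bar>K (t i) u - K s u\<bar> \<le> 2 * d" using cell_osc_node[OF g d i(1) j] by linarith
qed

lemma grid_sum_cov_op:
  assumes g: "is_grid \<tau> n t" and n: "n \<ge> 1" and d: "cell_osc n t d"
  shows "\<bar>grid_sum n t \<nu> (cov_op T K \<rho>) - bil \<nu> \<rho>\<bar> \<le> 4 * d * norm \<nu> * norm \<rho>"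
proof -
  have "\<bar>grid_sum n t \<nu> (cov_op T K \<rho>) - bil \<nu> \<rho>\<bar> \<le> 2 * norm \<nu> * (norm \<rho> * (2 * d))"
    unfolding bil_def by (rule grid_sum_pairing[OF g n cov_op_cont cov_op_osc[OF g n d]])
  then show ?thesis by (simp add: mult_ac)
qed

lemma cell_osc_nonneg:
  assumes g: "is_grid \<tau> n t" and n: "n \<ge> 1" and d: "cell_osc n t d"
  shows "d \<ge> 0"
  using cell_osc_node[OF g d, of 1 1 "t 1"] cell_subset(4)[OF g, of 1] n by simp

lemma grid_bil_bil:
  assumes g: "is_grid \<tau> n t" and n: "n \<ge> 1" and d: "cell_osc n t d"
  shows "\<bar>grid_bil n t \<nu> \<rho> - bil \<nu> \<rho>\<bar> \<le> 6 * d * norm \<nu> * norm \<rho>"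
proof -
  have "\<bar>grid_sum n t \<nu> (\<lambda>s. grid_sum n t \<rho> (K s) - cov_op T K \<rho> s)\<bar> \<le> norm \<nu> * (2 * norm \<rho> * d)"
  proof (rule grid_sum_bound[OF g])
    fix i assume i: "i \<in> {1..n}"
    then have "t i \<in> T" using grid_range[OF g] by auto
    then show "\<bar>grid_sum n t \<rho> (K (t i)) - cov_op T K \<rho> (t i)\<bar> \<le> 2 * norm \<rho> * d"
      unfolding cov_op_def
      by (intro grid_sum_pairing[OF g n] K_cont_right cell_osc_node[OF g d i])
  next
    show "0 \<le> 2 * norm \<rho> * d" using cell_osc_nonneg[OF assms] by simp
  qed
  moreover have "grid_sum n t \<nu> (\<lambda>s. grid_sum n t \<rho> (K s) - cov_op T K \<rho> s)
      = grid_bil n t \<nu> \<rho> - grid_sum n t \<nu> (cov_op T K \<rho>)"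
    unfolding grid_bil_eq by (simp add: grid_sum_def[of n t \<nu>] right_diff_distrib sum_subtractf)
  ultimately have "\<bar>grid_bil n t \<nu> \<rho> - grid_sum n t \<nu> (cov_op T K \<rho>)\<bar> \<le> 2 * d * norm \<nu> * norm \<rho>"
    by (simp add: mult_ac)
  then show ?thesis using grid_sum_cov_op[OF assms, of \<nu> \<rho>] by (simp add: algebra_simps)
qed

lemma cell_osc_uniform_grid:
  assumes "e > 0"
  shows "\<forall>\<^sub>F m in sequentially. m \<ge> 1 \<and> cell_osc m (\<lambda>i. \<tau> * real i / real m) e"
proof -
  let ?t = "\<lambda>m i. \<tau> * real i / real m"
  obtain d where d: "d > 0" "\<And>s u s' u'. s \<in> T \<Longrightarrow> u \<in> T \<Longrightarrow> s' \<in> T \<Longrightarrow> u' \<in> T \<Longrightarrow>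
    \<bar>s - s'\<bar> < d \<Longrightarrow> \<bar>u - u'\<bar> < d \<Longrightarrow> \<bar>K s u - K s' u'\<bar> < e" by (rule K_unif[OF assms]) blast
  have "\<forall>\<^sub>F m in sequentially. mesh m (?t m) < d \<and> m \<ge> 1"
    using order_tendstoD(2)[OF uniform_grid_mesh d(1)] eventually_ge_at_top[of 1] by (rule eventually_conj)
  then show ?thesis
  proof eventually_elim
    case (elim m)
    note g = uniform_grid[OF \<tau>, of m]
    have m: "m \<ge> 1" using elim by simp
    have near: "?t m i \<in> T \<and> s \<in> T \<and> \<bar>?t m i - s\<bar> < d" if "i \<in> {1..m}" "s \<in> cell (?t m) i" for i s
      using grid_range[OF g[OF m], of i] cell_subset_interval[OF g[OF m] that(1)] cell_mesh[OF g[OF m] that] that elim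
      by auto
    show ?case
      unfolding cell_osc_def using m near d(2) by (meson less_imp_le)
  qed
qed

lemma grid_bil_tendsto:
  "(\<lambda>m. grid_bil m (\<lambda>i. \<tau> * real i / real m) \<nu> \<rho>) \<longlonglongrightarrow> bil \<nu> \<rho>"
proof (rule LIMSEQ_I)
  fix r :: real assume r: "r > 0"
  define e where "e = r / (6 * norm \<nu> * norm \<rho> + 1)"
  have pos: "6 * norm \<nu> * norm \<rho> + 1 > 0" by (simp add: add_nonneg_pos)
  have e: "e > 0" "6 * e * norm \<nu> * norm \<rho> < r" using r pos by (auto simp: e_def field_simps)
  from cell_osc_uniform_grid[OF e(1)]
  have "\<forall>\<^sub>F m in sequentially. norm (grid_bil m (\<lambda>i. \<tau> * real i / real m) \<nu> \<rho> - bil \<nu> \<rho>) < r"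
  proof eventually_elim
    case (elim m)
    with grid_bil_bil[OF uniform_grid[OF \<tau>, of m], of e \<nu> \<rho>] e(2) show ?case by simp
  qed
  then show "\<exists>no. \<forall>m\<ge>no. norm (grid_bil m (\<lambda>i. \<tau> * real i / real m) \<nu> \<rho> - bil \<nu> \<rho>) < r"
    by (simp add: eventually_sequentially)
qed

lemma bil_sym: "bil \<nu> \<rho> = bil \<rho> \<nu>"
  using LIMSEQ_unique[OF grid_bil_tendsto[of \<nu> \<rho>]] grid_bil_tendsto[of \<rho> \<nu>]
  by (simp add: grid_bil_sym[of _ _ \<nu> \<rho>])

end

section \<open>Gaussian vectors in the space of continuous functions\<close>

lemma centered_normal_cong:
  assumes "\<And>\<omega>. \<omega> \<in> space M \<Longrightarrow> X \<omega> = Y \<omega>"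
  shows "centered_normal M X \<longleftrightarrow> centered_normal M Y"
proof -
  have "X \<in> borel_measurable M \<longleftrightarrow> Y \<in> borel_measurable M"
    "X \<in> M \<rightarrow>\<^sub>M lborel \<longleftrightarrow> Y \<in> M \<rightarrow>\<^sub>M lborel"
    using assms by (auto cong: measurable_cong)
  moreover have "distr M lborel X = distr M lborel Y" by (rule distr_cong) (auto simp: assms)
  moreover have "(AE \<omega> in M. X \<omega> = 0) \<longleftrightarrow> (AE \<omega> in M. Y \<omega> = 0)" by (rule AE_cong) (simp add: assms)
  ultimately show ?thesis unfolding centered_normal_def distributed_def by simp
qed

lemma integrable_mult_of_squares:
  fixes X Y :: "'w \<Rightarrow> real"
  assumes [measurable]: "X \<in> borel_measurable M" "Y \<in> borel_measurable M"
    and "integrable M (\<lambda>\<omega>. (X \<omega>)\<^sup>2)" "integrable M (\<lambda>\<omega>. (Y \<omega>)\<^sup>2)"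
  shows "integrable M (\<lambda>\<omega>. X \<omega> * Y \<omega>)"
proof (rule Bochner_Integration.integrable_bound[of _ "\<lambda>\<omega>. (X \<omega>)\<^sup>2 + (Y \<omega>)\<^sup>2"])
  have "\<bar>x * y\<bar> \<le> x\<^sup>2 + y\<^sup>2" for x y :: real
  proof -
    have "2 * (\<bar>x\<bar> * \<bar>y\<bar>) \<le> x\<^sup>2 + y\<^sup>2" using sum_squares_bound[of "\<bar>x\<bar>" "\<bar>y\<bar>"] by simp
    moreover have "0 \<le> \<bar>x\<bar> * \<bar>y\<bar>" by simp
    ultimately show ?thesis unfolding abs_mult by linarith
  qed
  then show "AE \<omega> in M. norm (X \<omega> * Y \<omega>) \<le> norm ((X \<omega>)\<^sup>2 + (Y \<omega>)\<^sup>2)" by simp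
qed (use assms in auto)

text \<open>A centered Gaussian vector on \<open>C[0, \<tau>]\<close> together with its covariance function.\<close>

locale gaussian_process =
  fixes M :: "'w measure" and Z :: "'w \<Rightarrow> real \<Rightarrow> real" and \<tau> :: real and K :: "real \<Rightarrow> real \<Rightarrow> real"
  assumes prob: "prob_space M" and \<tau>_pos: "\<tau> > 0"
    and Z: "centered_gaussian_vector M {0..\<tau>} Z" and K_cov: "K = cov_fun M Z"
begin

sublocale prob_space M by (rule prob)

lemma path_continuous:
  assumes "\<omega> \<in> space M"
  shows "continuous_on {0..\<tau>} (Z \<omega>)"
proof -
  have "Z \<in> M \<rightarrow>\<^sub>M C_borel {0..\<tau>}" using Z by (simp add: centered_gaussian_vector_def)
  from measurable_space[OF this assms] have "Z \<omega> \<in> mspace (C_metric {0..\<tau>})"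
    by (simp add: C_borel_def space_measure_of_conv)
  then show ?thesis by (simp add: C_metric_def)
qed

lemma lincomb_normal:
  assumes I: "finite I" and s: "\<And>i. i \<in> I \<Longrightarrow> s i \<in> {0..\<tau>}"
  shows "centered_normal M (\<lambda>\<omega>. \<Sum>i\<in>I. c i * Z \<omega> (s i))"
proof -
  define \<nu> where "\<nu> = (\<Sum>i\<in>I. c i *\<^sub>R dirac (s i))"
  have "\<nu> \<in> measures_on {0..\<tau>}"
    unfolding \<nu>_def by (intro measures_on_sum measures_on_scaleR dirac_measures_on s)
  then have "centered_normal M (\<lambda>\<omega>. pairing {0..\<tau>} \<nu> (Z \<omega>))"
    using Z by (auto simp: centered_gaussian_vector_def)
  moreover have "pairing {0..\<tau>} \<nu> (Z \<omega>) = (\<Sum>i\<in>I. c i * Z \<omega> (s i))" if \<omega>: "\<omega> \<in> space M" for \<omega>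
  proof -
    note lin = bounded_linear.linear[OF bounded_linear_pairing[OF \<tau>_pos path_continuous[OF \<omega>]]]
    show ?thesis
      unfolding \<nu>_def linear_sum[OF lin] linear_scale[OF lin]
      by (intro sum.cong refl) (simp add: pairing_dirac[OF \<tau>_pos s path_continuous[OF \<omega>]])
  qed
  ultimately show ?thesis by (simp cong: centered_normal_cong)
qed

lemma point_normal: "s \<in> {0..\<tau>} \<Longrightarrow> centered_normal M (\<lambda>\<omega>. Z \<omega> s)"
  using lincomb_normal[of "{s}" id "\<lambda>_. 1"] by simp

lemma point_measurable: "s \<in> {0..\<tau>} \<Longrightarrow> (\<lambda>\<omega>. Z \<omega> s) \<in> borel_measurable M"
  using point_normal by (simp add: centered_normal_def)

lemma increment_normal: "s \<in> {0..\<tau>} \<Longrightarrow> u \<in> {0..\<tau>} \<Longrightarrow> centered_normal M (\<lambda>\<omega>. Z \<omega> s - Z \<omega> u)"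
  using lincomb_normal[of "{True, False}" "\<lambda>b. if b then s else u" "\<lambda>b. if b then 1 else - 1"] by simp

lemma product_integrable:
  "s \<in> {0..\<tau>} \<Longrightarrow> u \<in> {0..\<tau>} \<Longrightarrow> integrable M (\<lambda>\<omega>. Z \<omega> s * Z \<omega> u)"
  by (intro integrable_mult_of_squares point_measurable centered_normal_integrable[OF prob point_normal])

lemma K_eq:
  assumes "s \<in> {0..\<tau>}" "u \<in> {0..\<tau>}"
  shows "K s u = (\<integral>\<omega>. Z \<omega> s * Z \<omega> u \<partial>M)"
  unfolding K_cov cov_fun_def
  using centered_normal_mean[OF prob point_normal[OF assms(1)]]
    centered_normal_mean[OF prob point_normal[OF assms(2)]] by simp

lemma lincomb_product:
  assumes "finite I" "finite J" "\<And>i. i \<in> I \<Longrightarrow> s i \<in> {0..\<tau>}" "\<And>j. j \<in> J \<Longrightarrow> u j \<in> {0..\<tau>}"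
  shows "(\<integral>\<omega>. (\<Sum>i\<in>I. c i * Z \<omega> (s i)) * (\<Sum>j\<in>J. d j * Z \<omega> (u j)) \<partial>M) =
    (\<Sum>i\<in>I. \<Sum>j\<in>J. c i * d j * K (s i) (u j))"
proof -
  have i: "integrable M (\<lambda>\<omega>. c i * d j * (Z \<omega> (s i) * Z \<omega> (u j)))" if "i \<in> I" "j \<in> J" for i j
    by (intro integrable_mult_right product_integrable assms that)
  have "(\<integral>\<omega>. (\<Sum>i\<in>I. c i * Z \<omega> (s i)) * (\<Sum>j\<in>J. d j * Z \<omega> (u j)) \<partial>M) =
      (\<integral>\<omega>. (\<Sum>i\<in>I. \<Sum>j\<in>J. c i * d j * (Z \<omega> (s i) * Z \<omega> (u j))) \<partial>M)"
    by (simp add: sum_product mult_ac)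
  also have "\<dots> = (\<Sum>i\<in>I. \<integral>\<omega>. (\<Sum>j\<in>J. c i * d j * (Z \<omega> (s i) * Z \<omega> (u j))) \<partial>M)"
    by (intro Bochner_Integration.integral_sum Bochner_Integration.integrable_sum i)
  also have "\<dots> = (\<Sum>i\<in>I. \<Sum>j\<in>J. \<integral>\<omega>. c i * d j * (Z \<omega> (s i) * Z \<omega> (u j)) \<partial>M)"
    by (intro sum.cong refl Bochner_Integration.integral_sum i)
  also have "\<dots> = (\<Sum>i\<in>I. \<Sum>j\<in>J. c i * d j * K (s i) (u j))"
    by (intro sum.cong refl) (simp add: K_eq[OF assms(3,4)])
  finally show ?thesis .
qed

text \<open>Continuity of the covariance function.  Path continuity only gives \<open>Z s\<^sub>m \<rightarrow> Z s\<close> pointwise; since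
  the increments are normal, they are small in mean square as soon as they are small with
  probability one half.\<close>

lemma increment_variance_tendsto:
  assumes s: "\<And>m. s m \<in> {0..\<tau>}" "a \<in> {0..\<tau>}" "s \<longlonglongrightarrow> a"
  shows "(\<lambda>m. \<integral>\<omega>. (Z \<omega> (s m) - Z \<omega> a)\<^sup>2 \<partial>M) \<longlonglongrightarrow> 0"
proof (rule LIMSEQ_I)
  fix r :: real assume r: "r > 0"
  define \<eta> where "\<eta> = sqrt (r / 8)"
  have \<eta>: "\<eta> > 0" "4 * \<eta>\<^sup>2 < r" using r by (auto simp: \<eta>_def)
  define A where "A m = {\<omega> \<in> space M. \<bar>Z \<omega> (s m) - Z \<omega> a\<bar> \<le> \<eta>}" for m
  have X: "centered_normal M (\<lambda>\<omega>. Z \<omega> (s m) - Z \<omega> a)" for m by (intro increment_normal s)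
  have [measurable]: "(\<lambda>\<omega>. Z \<omega> (s m) - Z \<omega> a) \<in> borel_measurable M" for m
    using X by (simp add: centered_normal_def)
  have A[measurable]: "A m \<in> sets M" for m unfolding A_def by measurable
  have "(\<lambda>m. \<integral>\<omega>. indicat_real (A m) \<omega> \<partial>M) \<longlonglongrightarrow> (\<integral>\<omega>. 1 \<partial>M)"
  proof (rule integral_dominated_convergence[where w = "\<lambda>_. 1"])
    show "AE \<omega> in M. (\<lambda>m. indicat_real (A m) \<omega>) \<longlonglongrightarrow> 1"
    proof (rule AE_I2)
      fix \<omega> assume \<omega>: "\<omega> \<in> space M"
      have "(\<lambda>m. Z \<omega> (s m)) \<longlonglongrightarrow> Z \<omega> a"
        by (rule continuous_on_tendsto_compose[OF path_continuous[OF \<omega>] s(3) s(2)]) (simp add: s(1)[simplified])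
      then have "\<forall>\<^sub>F m in sequentially. dist (Z \<omega> (s m)) (Z \<omega> a) < \<eta>" by (rule tendstoD) (rule \<eta>(1))
      then have "\<forall>\<^sub>F m in sequentially. indicat_real (A m) \<omega> = 1"
        by eventually_elim (use \<omega> in \<open>auto simp: A_def dist_real_def\<close>)
      then show "(\<lambda>m. indicat_real (A m) \<omega>) \<longlonglongrightarrow> 1" by (rule tendsto_eventually)
    qed
  qed (auto simp: indicator_def)
  then have "(\<lambda>m. measure M (A m)) \<longlonglongrightarrow> 1" by (simp add: prob_space)
  then have "\<forall>\<^sub>F m in sequentially. measure M (A m) > 1 / 2" by (rule order_tendstoD) simp
  then have "\<forall>\<^sub>F m in sequentially. norm ((\<integral>\<omega>. (Z \<omega> (s m) - Z \<omega> a)\<^sup>2 \<partial>M) - 0) < r"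
  proof eventually_elim
    case (elim m)
    have "(\<integral>\<omega>. (Z \<omega> (s m) - Z \<omega> a)\<^sup>2 \<partial>M) \<le> 4 * \<eta>\<^sup>2"
      using elim \<eta>(1) by (intro centered_normal_small_ball[OF prob X]) (auto simp: A_def)
    moreover have "0 \<le> (\<integral>\<omega>. (Z \<omega> (s m) - Z \<omega> a)\<^sup>2 \<partial>M)" by (intro integral_nonneg_AE) simp
    ultimately show ?case using \<eta>(2) by simp
  qed
  then show "\<exists>no. \<forall>m\<ge>no. norm ((\<integral>\<omega>. (Z \<omega> (s m) - Z \<omega> a)\<^sup>2 \<partial>M) - 0) < r"
    by (simp add: eventually_sequentially)
qed

lemma K_tendsto:
  assumes s: "\<And>m. s m \<in> {0..\<tau>}" "a \<in> {0..\<tau>}" "s \<longlonglongrightarrow> a"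
    and u: "\<And>m. u m \<in> {0..\<tau>}" "b \<in> {0..\<tau>}" "u \<longlonglongrightarrow> b"
  shows "(\<lambda>m. K (s m) (u m)) \<longlonglongrightarrow> K a b"
proof -
  define V where "V m = 2 * (\<integral>\<omega>. (Z \<omega> (s m) - Z \<omega> a)\<^sup>2 \<partial>M) + 2 * K a a" for m
  define W where "W m = 2 * (\<integral>\<omega>. (Z \<omega> (u m) - Z \<omega> b)\<^sup>2 \<partial>M) + 2 * K b b" for m
  have le: "K x x \<le> 2 * (\<integral>\<omega>. (Z \<omega> x - Z \<omega> c)\<^sup>2 \<partial>M) + 2 * K c c" if "x \<in> {0..\<tau>}" "c \<in> {0..\<tau>}" for x c
  proof -
    have i: "integrable M (\<lambda>\<omega>. (Z \<omega> x - Z \<omega> c)\<^sup>2)" "integrable M (\<lambda>\<omega>. Z \<omega> c * Z \<omega> c)" "integrable M (\<lambda>\<omega>. Z \<omega> x * Z \<omega> x)"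
      using that centered_normal_integrable[OF prob increment_normal[OF that]] product_integrable by auto
    have "y * y \<le> 2 * (y - z)\<^sup>2 + 2 * (z * z)" for y z :: real
      using zero_le_power2[of "y - 2 * z"] by (simp add: power2_eq_square algebra_simps)
    then have "K x x \<le> (\<integral>\<omega>. 2 * (Z \<omega> x - Z \<omega> c)\<^sup>2 + 2 * (Z \<omega> c * Z \<omega> c) \<partial>M)"
      unfolding K_eq[OF that(1,1)] using i by (intro integral_mono) auto
    then show ?thesis using i by (simp add: K_eq[OF that(2,2)])
  qed
  have VW: "K (s m) (s m) \<le> V m" "K (u m) (u m) \<le> W m" for m
    unfolding V_def W_def by (intro le s u)+
  have "V \<longlonglongrightarrow> 2 * 0 + 2 * K a a" unfolding V_def
    by (intro tendsto_intros increment_variance_tendsto s)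
  then have "Bseq V" by (intro convergent_imp_Bseq convergentI)
  then obtain v where v: "\<And>m. norm (V m) \<le> v" by (auto simp: Bseq_def)
  have "W \<longlonglongrightarrow> 2 * 0 + 2 * K b b" unfolding W_def
    by (intro tendsto_intros increment_variance_tendsto u)
  then have "Bseq W" by (intro convergent_imp_Bseq convergentI)
  then obtain w where w: "\<And>m. norm (W m) \<le> w" by (auto simp: Bseq_def)
  have K0: "0 \<le> K x x" if "x \<in> {0..\<tau>}" for x unfolding K_eq[OF that that] by (intro integral_nonneg_AE) simp
  have q: "(\<integral>\<omega>. Z \<omega> x ^ 4 \<partial>M) = normal_moment_const 2 * (K x x)\<^sup>2" "integrable M (\<lambda>\<omega>. Z \<omega> x ^ 4)" if "x \<in> {0..\<tau>}" for x
    using centered_normal_even_moment[OF prob point_normal[OF that], of 2]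
      centered_normal_integrable[OF prob point_normal[OF that], of 4]
    by (simp_all add: K_eq[OF that that] power2_eq_square)
  let ?c = "normal_moment_const 2"
  have "(\<lambda>m. \<integral>\<omega>. Z \<omega> (s m) * Z \<omega> (u m) \<partial>M) \<longlonglongrightarrow> (\<integral>\<omega>. Z \<omega> a * Z \<omega> b \<partial>M)"
  proof (rule convergence_of_means(3)[OF prob, where B = "?c * v\<^sup>2 + ?c * w\<^sup>2"])
    show "(\<lambda>\<omega>. Z \<omega> (s m) * Z \<omega> (u m)) \<in> borel_measurable M" for m
      by (intro borel_measurable_times point_measurable s u)
    show "(\<lambda>m. Z \<omega> (s m) * Z \<omega> (u m)) \<longlonglongrightarrow> Z \<omega> a * Z \<omega> b" if \<omega>: "\<omega> \<in> space M" for \<omega>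
      by (intro tendsto_mult continuous_on_tendsto_compose[OF path_continuous[OF \<omega>]] s(2,3) u(2,3))
        (simp_all add: s(1)[simplified] u(1)[simplified])
    show "0 \<le> ?c * v\<^sup>2 + ?c * w\<^sup>2" using normal_moment_const_pos[of 2] by simp
    fix m
    have "(\<integral>\<^sup>+\<omega>. ennreal ((Z \<omega> (s m) * Z \<omega> (u m))\<^sup>2) \<partial>M) \<le> (\<integral>\<^sup>+\<omega>. ennreal (Z \<omega> (s m) ^ 4 + Z \<omega> (u m) ^ 4) \<partial>M)"
      by (intro nn_integral_mono ennreal_leI square_mult_le_quartic)
    also have "\<dots> = ennreal (\<integral>\<omega>. Z \<omega> (s m) ^ 4 + Z \<omega> (u m) ^ 4 \<partial>M)"
      using q[OF s(1), of m] q[OF u(1), of m] by (intro nn_integral_eq_integral) auto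
    also have "\<dots> = ennreal (?c * (K (s m) (s m))\<^sup>2 + ?c * (K (u m) (u m))\<^sup>2)"
      using q[OF s(1), of m] q[OF u(1), of m] by simp
    also have "\<dots> \<le> ennreal (?c * v\<^sup>2 + ?c * w\<^sup>2)"
    proof (intro ennreal_leI add_mono mult_left_mono power_mono)
      show "K (s m) (s m) \<le> v" using VW(1)[of m] v[of m] by simp
      show "K (u m) (u m) \<le> w" using VW(2)[of m] w[of m] by simp
    qed (use normal_moment_const_pos[of 2] K0 s(1) u(1) in \<open>auto intro: less_imp_le\<close>)
    finally show "(\<integral>\<^sup>+\<omega>. ennreal ((Z \<omega> (s m) * Z \<omega> (u m))\<^sup>2) \<partial>M) \<le> ennreal (?c * v\<^sup>2 + ?c * w\<^sup>2)" .
  qed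
  then show ?thesis using s u by (simp add: K_eq)
qed

sublocale continuous_kernel \<tau> K
proof
  show "\<tau> > 0" by (rule \<tau>_pos)
  show "K s u = K u s" for s u unfolding K_cov cov_fun_def by (simp add: mult.commute)
  show "continuous_on ({0..\<tau>} \<times> {0..\<tau>}) (\<lambda>(s, u). K s u)"
  proof (rule continuous_on_sequentiallyI)
    fix x :: "nat \<Rightarrow> real \<times> real" and a
    assume x: "\<forall>m. x m \<in> {0..\<tau>} \<times> {0..\<tau>}" "a \<in> {0..\<tau>} \<times> {0..\<tau>}" "x \<longlonglongrightarrow> a"
    have "(\<lambda>m. K (fst (x m)) (snd (x m))) \<longlonglongrightarrow> K (fst a) (snd a)"
      using x by (intro K_tendsto tendsto_fst tendsto_snd) (auto simp: mem_Times_iff)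
    then show "(\<lambda>m. (\<lambda>(s, u). K s u) (x m)) \<longlonglongrightarrow> (\<lambda>(s, u). K s u) a"
      by (simp add: case_prod_unfold)
  qed
qed

lemma grid_sum_normal:
  assumes "is_grid \<tau> n t"
  shows "centered_normal M (\<lambda>\<omega>. grid_sum n t \<nu> (Z \<omega>))"
  unfolding grid_sum_def using grid_range[OF assms] by (intro lincomb_normal) auto

lemma grid_sum_measurable:
  assumes "is_grid \<tau> n t"
  shows "(\<lambda>\<omega>. grid_sum n t \<nu> (Z \<omega>)) \<in> borel_measurable M"
  using grid_sum_normal[OF assms] by (simp add: centered_normal_def)

lemma grid_sum_product:
  assumes "is_grid \<tau> n t"
  shows "(\<integral>\<omega>. grid_sum n t \<nu> (Z \<omega>) * grid_sum n t \<rho> (Z \<omega>) \<partial>M) = grid_bil n t \<nu> \<rho>"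
  unfolding grid_sum_def grid_bil_def using grid_range[OF assms] by (intro lincomb_product) auto

text \<open>The bound is the same for all grids and depends on \<open>\<nu>\<close> through its total variation only.\<close>

lemma grid_sum_moment:
  assumes g: "is_grid \<tau> n t" and \<kappa>: "\<kappa> \<ge> 0" "\<And>s u. s \<in> T \<Longrightarrow> u \<in> T \<Longrightarrow> \<bar>K s u\<bar> \<le> \<kappa>"
  shows "(\<integral>\<^sup>+\<omega>. ennreal (\<bar>grid_sum n t \<nu> (Z \<omega>)\<bar> ^ (2 * k)) \<partial>M)
    \<le> ennreal (normal_moment_const k * \<kappa> ^ k * norm \<nu> ^ (2 * k))"
proof -
  note X = grid_sum_normal[OF g, of \<nu>]
  have "(\<integral>\<^sup>+\<omega>. ennreal (\<bar>grid_sum n t \<nu> (Z \<omega>)\<bar> ^ (2 * k)) \<partial>M) = (\<integral>\<^sup>+\<omega>. ennreal (grid_sum n t \<nu> (Z \<omega>) ^ (2 * k)) \<partial>M)"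
    by (simp add: power_even_abs)
  also have "\<dots> = ennreal (\<integral>\<omega>. grid_sum n t \<nu> (Z \<omega>) ^ (2 * k) \<partial>M)"
    by (intro nn_integral_eq_integral centered_normal_integrable[OF prob X]) simp
  also have "(\<integral>\<omega>. grid_sum n t \<nu> (Z \<omega>) ^ (2 * k) \<partial>M) = normal_moment_const k * grid_bil n t \<nu> \<nu> ^ k"
    unfolding centered_normal_even_moment[OF prob X]
    using grid_sum_product[OF g, of \<nu> \<nu>] by (simp add: power2_eq_square)
  also have "ennreal \<dots> \<le> ennreal (normal_moment_const k * (\<kappa> * norm \<nu> * norm \<nu>) ^ k)"
  proof (intro ennreal_leI mult_left_mono power_mono)
    show "grid_bil n t \<nu> \<nu> \<le> \<kappa> * norm \<nu> * norm \<nu>"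
      using grid_bil_le[OF g \<kappa>, of \<nu> \<nu>] by simp
    have "0 \<le> (\<integral>\<omega>. grid_sum n t \<nu> (Z \<omega>) * grid_sum n t \<nu> (Z \<omega>) \<partial>M)" by (intro integral_nonneg_AE) simp
    then show "0 \<le> grid_bil n t \<nu> \<nu>" by (simp add: grid_sum_product[OF g])
  qed (simp add: normal_moment_const_pos less_imp_le)
  also have "normal_moment_const k * (\<kappa> * norm \<nu> * norm \<nu>) ^ k = normal_moment_const k * \<kappa> ^ k * norm \<nu> ^ (2 * k)"
    by (simp only: power_mult_distrib mult_2 power_add mult.assoc)
  finally show ?thesis .
qed

lemma bil_nonneg: "bil \<nu> \<nu> \<ge> 0"
proof (rule LIMSEQ_le_const[OF grid_bil_tendsto])
  have "grid_bil m (\<lambda>i. \<tau> * real i / real m) \<nu> \<nu> \<ge> 0" if "m \<ge> 1" for m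
    unfolding grid_sum_product[OF uniform_grid[OF \<tau> that], symmetric] by (intro integral_nonneg_AE) simp
  then show "\<exists>N. \<forall>m\<ge>N. 0 \<le> grid_bil m (\<lambda>i. \<tau> * real i / real m) \<nu> \<nu>" by blast
qed

end

section \<open>Differentiable families\<close>

lemma has_derivative_partial_derivs:
  fixes f :: "real^'p \<Rightarrow> 'b::real_normed_vector"
  assumes "f differentiable (at x)"
  shows "(f has_derivative (\<lambda>v. \<Sum>i\<in>UNIV. v $ i *\<^sub>R partial_deriv i f x)) (at x)"
proof -
  let ?D = "frechet_derivative f (at x)"
  have D: "(f has_derivative ?D) (at x)" using assms frechet_derivative_works by blast
  then have lin: "linear ?D" by (rule has_derivative_linear)
  have "?D v = (\<Sum>i\<in>UNIV. v $ i *\<^sub>R partial_deriv i f x)" for v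
  proof -
    have "?D v = ?D (\<Sum>i\<in>UNIV. v $ i *\<^sub>R axis i 1)"
      using basis_expansion[of v] by (simp add: scalar_mult_eq_scaleR)
    then show ?thesis by (simp add: linear_sum[OF lin] linear_scale[OF lin] partial_deriv_def)
  qed
  then have "?D = (\<lambda>v. \<Sum>i\<in>UNIV. v $ i *\<^sub>R partial_deriv i f x)" by (rule ext)
  with D show ?thesis by simp
qed

lemma norm_partial_sum_le:
  fixes g :: "'p::finite \<Rightarrow> 'b::real_normed_vector" and v :: "real^'p"
  assumes "\<And>i. norm (g i) \<le> S"
  shows "norm (\<Sum>i\<in>UNIV. v $ i *\<^sub>R g i) \<le> real CARD('p) * S * norm v"
proof -
  have "norm (v $ i *\<^sub>R g i) \<le> norm v * S" for i
    unfolding norm_scaleR real_norm_def by (intro mult_mono component_le_norm_cart assms) auto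
  then have "norm (\<Sum>i\<in>UNIV. v $ i *\<^sub>R g i) \<le> (\<Sum>i\<in>(UNIV::'p set). norm v * S)"
    by (intro sum_norm_le)
  then show ?thesis by (simp add: mult_ac)
qed

lemma mean_value_bound:
  fixes f :: "real^'p \<Rightarrow> 'b::real_normed_vector"
  assumes "convex \<Theta>"
    and f: "\<And>x. x \<in> interior \<Theta> \<Longrightarrow> (f has_derivative (\<lambda>v. \<Sum>i\<in>UNIV. v $ i *\<^sub>R g i x)) (at x)"
    and S: "\<And>i x. x \<in> interior \<Theta> \<Longrightarrow> norm (g i x) \<le> S"
    and x: "x \<in> interior \<Theta>" and y: "y \<in> interior \<Theta>"
  shows "norm (f x - f y) \<le> real CARD('p) * S * norm (x - y)"
proof (rule differentiable_bound[OF convex_interior[OF assms(1)] _ _ x y])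
  fix z assume z: "z \<in> interior \<Theta>"
  show "(f has_derivative (\<lambda>v. \<Sum>i\<in>UNIV. v $ i *\<^sub>R g i z)) (at z within interior \<Theta>)"
    using f[OF z] by (rule has_derivative_at_withinI)
  have "0 \<le> S" using S[OF z] norm_ge_zero order_trans by blast
  then show "onorm (\<lambda>v. \<Sum>i\<in>UNIV. v $ i *\<^sub>R g i z) \<le> real CARD('p) * S"
    by (intro onorm_le norm_partial_sum_le S z)
qed

text \<open>The same bound up to the boundary, by letting the end point move along a segment.\<close>

lemma mean_value_bound_closure:
  fixes f :: "real^'p \<Rightarrow> 'b::real_normed_vector"
  assumes "convex \<Theta>" and c: "continuous_on \<Theta> f"
    and f: "\<And>x. x \<in> interior \<Theta> \<Longrightarrow> (f has_derivative (\<lambda>v. \<Sum>i\<in>UNIV. v $ i *\<^sub>R g i x)) (at x)"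
    and S: "\<And>i x. x \<in> interior \<Theta> \<Longrightarrow> norm (g i x) \<le> S"
    and x: "x \<in> \<Theta>" and y: "y \<in> interior \<Theta>"
  shows "norm (f x - f y) \<le> real CARD('p) * S * norm (x - y)"
proof -
  define z where "z m = x - (1 / real (Suc m)) *\<^sub>R (x - y)" for m
  have z: "z m \<in> interior \<Theta>" for m
    unfolding z_def by (rule mem_interior_convex_shrink[OF assms(1) y x]) auto
  have "z \<longlonglongrightarrow> x - 0 *\<^sub>R (x - y)" unfolding z_def
    by (intro tendsto_intros lim_const_over_n[THEN LIMSEQ_Suc])
  then have zx: "z \<longlonglongrightarrow> x" by simp
  have "(\<lambda>m. f (z m)) \<longlonglongrightarrow> f x"
    by (rule continuous_on_tendsto_compose[OF c zx x])
      (intro always_eventually allI subsetD[OF interior_subset z])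
  then have "(\<lambda>m. norm (f (z m) - f y)) \<longlonglongrightarrow> norm (f x - f y)" by (intro tendsto_intros)
  moreover have "(\<lambda>m. real CARD('p) * S * norm (z m - y)) \<longlonglongrightarrow> real CARD('p) * S * norm (x - y)"
    by (intro tendsto_intros zx)
  ultimately show ?thesis
    by (rule LIMSEQ_le) (intro exI[of _ 0] allI impI mean_value_bound[OF assms(1) f S z y])
qed

text \<open>First-order expansion at scale \<open>e k\<close>, along points at distance \<open>O(e k)\<close>.\<close>

lemma has_derivative_sequence:
  fixes f :: "'a::real_normed_vector \<Rightarrow> 'b::real_normed_vector"
  assumes f: "(f has_derivative f') (at x)"
    and e: "\<And>k. e k > 0" "e \<longlonglongrightarrow> 0" and y: "\<And>k. norm (y k - x) \<le> R * e k"
  shows "(\<lambda>k. (1 / e k) *\<^sub>R (f (y k) - f x) - f' ((1 / e k) *\<^sub>R (y k - x))) \<longlonglongrightarrow> 0"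
proof (rule LIMSEQ_I)
  fix r :: real assume r: "r > 0"
  have R: "R \<ge> 0"
  proof -
    have "0 \<le> R * e 0" using y[of 0] norm_ge_zero order_trans by blast
    then show ?thesis using e(1)[of 0] by (simp add: zero_le_mult_iff)
  qed
  define r' where "r' = r / (R + 1)"
  have r': "r' > 0" "r' * R < r" using r R by (auto simp: r'_def field_simps)
  from f r'(1) obtain d where d: "d > 0"
    "\<And>z. norm (z - x) < d \<Longrightarrow> norm (f z - f x - f' (z - x)) \<le> r' * norm (z - x)"
    unfolding has_derivative_at_alt by blast
  have lin: "linear f'" using f by (rule has_derivative_linear)
  have "(\<lambda>k. R * e k) \<longlonglongrightarrow> 0" using tendsto_mult_left[OF e(2), of R] by simp
  then have "\<forall>\<^sub>F k in sequentially. R * e k < d" by (rule order_tendstoD) (rule d(1))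
  then have "\<forall>\<^sub>F k in sequentially.
      norm ((1 / e k) *\<^sub>R (f (y k) - f x) - f' ((1 / e k) *\<^sub>R (y k - x)) - 0) < r"
  proof eventually_elim
    case (elim k)
    have "(1 / e k) *\<^sub>R (f (y k) - f x) - f' ((1 / e k) *\<^sub>R (y k - x))
        = (1 / e k) *\<^sub>R (f (y k) - f x - f' (y k - x))"
      unfolding linear_scale[OF lin] by (simp only: scaleR_diff_right)
    then have "norm ((1 / e k) *\<^sub>R (f (y k) - f x) - f' ((1 / e k) *\<^sub>R (y k - x)))
        = (1 / e k) * norm (f (y k) - f x - f' (y k - x))" using e(1)[of k] by simp
    also have "\<dots> \<le> (1 / e k) * (r' * norm (y k - x))"
      using d(2)[of "y k"] y[of k] elim e(1)[of k] by (intro mult_left_mono) auto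
    also have "\<dots> \<le> (1 / e k) * (r' * (R * e k))"
      using y[of k] e(1)[of k] r'(1) by (intro mult_left_mono) auto
    also have "\<dots> < r" using e(1)[of k] r'(2) by simp
    finally show ?case by simp
  qed
  then show "\<exists>no. \<forall>k\<ge>no. norm ((1 / e k) *\<^sub>R (f (y k) - f x) - f' ((1 / e k) *\<^sub>R (y k - x)) - 0) < r"
    by (simp add: eventually_sequentially)
qed

text \<open>The continuous extensions of the partial derivatives to the compact set \<open>\<Theta>\<close> enter through the
  boundedness that they imply on the interior.\<close>

lemma Ck_on_two_bounds:
  fixes f :: "real^'p \<Rightarrow> 'b::real_normed_vector"
  assumes f: "Ck_on 2 \<Theta> f" and "compact \<Theta>" "convex \<Theta>"
  obtains L where "L \<ge> 0"
    and "\<And>x. x \<in> interior \<Theta> \<Longrightarrow> (f has_derivative (\<lambda>v. \<Sum>i\<in>UNIV. v $ i *\<^sub>R partial_deriv i f x)) (at x)"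
    and "\<And>i x. x \<in> interior \<Theta> \<Longrightarrow> norm (partial_deriv i f x) \<le> L"
    and "\<And>i x y. x \<in> interior \<Theta> \<Longrightarrow> y \<in> interior \<Theta> \<Longrightarrow>
      norm (partial_deriv i f x - partial_deriv i f y) \<le> L * norm (x - y)"
proof -
  have diff: "partial_derivs is f differentiable_on interior \<Theta>" if "length is < 2" for "is"
    using f that unfolding Ck_on_def by blast
  have bnd: "\<exists>c. \<forall>x\<in>interior \<Theta>. norm (partial_derivs is f x) \<le> c" if is2: "length is \<le> 2" for "is"
  proof -
    obtain g where g: "continuous_on \<Theta> g" "\<And>x. x \<in> interior \<Theta> \<Longrightarrow> g x = partial_derivs is f x"
      using f is2 unfolding Ck_on_def by metis
    have "bounded (g ` \<Theta>)" by (intro compact_imp_bounded compact_continuous_image g assms(2))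
    then obtain c where "\<forall>y\<in>g ` \<Theta>. norm y \<le> c" unfolding bounded_iff by metis
    then show ?thesis using g(2) interior_subset[of \<Theta>] by (intro exI[of _ c]) force
  qed
  have d0: "f differentiable (at x)" if "x \<in> interior \<Theta>" for x
    using diff[of "[]"] that by (simp add: partial_derivs_def differentiable_on_eq_differentiable_at)
  have d1: "partial_deriv i f differentiable (at x)" if "x \<in> interior \<Theta>" for i x
    using diff[of "[i]"] that by (simp add: partial_derivs_def differentiable_on_eq_differentiable_at)
  obtain b1 where b1: "\<And>i x. x \<in> interior \<Theta> \<Longrightarrow> norm (partial_deriv i f x) \<le> b1 i"
  proof -
    have "\<forall>i. \<exists>c. \<forall>x\<in>interior \<Theta>. norm (partial_deriv i f x) \<le> c"
    proof
      fix i show "\<exists>c. \<forall>x\<in>interior \<Theta>. norm (partial_deriv i f x) \<le> c"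
        using bnd[of "[i]"] by (simp add: partial_derivs_def)
    qed
    from choice[OF this] obtain b1 where "\<forall>i. \<forall>x\<in>interior \<Theta>. norm (partial_deriv i f x) \<le> b1 i" ..
    then show thesis by (intro that[of b1]) simp
  qed
  obtain b2 where b2: "\<And>i j x. x \<in> interior \<Theta> \<Longrightarrow> norm (partial_deriv j (partial_deriv i f) x) \<le> b2 (i, j)"
  proof -
    have "\<forall>z. \<exists>c. \<forall>x\<in>interior \<Theta>. norm (partial_deriv (snd z) (partial_deriv (fst z) f) x) \<le> c"
    proof
      fix z :: "'p \<times> 'p"
      show "\<exists>c. \<forall>x\<in>interior \<Theta>. norm (partial_deriv (snd z) (partial_deriv (fst z) f) x) \<le> c"
        using bnd[of "[fst z, snd z]"] by (simp add: partial_derivs_def)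
    qed
    from choice[OF this] obtain b2 where
      "\<forall>z. \<forall>x\<in>interior \<Theta>. norm (partial_deriv (snd z) (partial_deriv (fst z) f) x) \<le> b2 z" ..
    then show thesis by (intro that[of b2]) (metis fst_conv snd_conv)
  qed
  define c1 where "c1 = (\<Sum>i\<in>UNIV. \<bar>b1 i\<bar>)"
  define c2 where "c2 = (\<Sum>z\<in>UNIV. \<bar>b2 z\<bar>)"
  have c1: "norm (partial_deriv i f x) \<le> c1" if "x \<in> interior \<Theta>" for i x
  proof -
    have "\<bar>b1 i\<bar> \<le> c1" unfolding c1_def by (intro member_le_sum) auto
    then show ?thesis using b1[OF that, of i] by linarith
  qed
  have c2: "norm (partial_deriv j (partial_deriv i f) x) \<le> c2" if "x \<in> interior \<Theta>" for i j x
  proof -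
    have "\<bar>b2 (i, j)\<bar> \<le> c2" unfolding c2_def by (intro member_le_sum) auto
    then show ?thesis using b2[OF that, of j i] by linarith
  qed
  have c0: "c1 \<ge> 0" "c2 \<ge> 0" by (auto simp: c1_def c2_def intro: sum_nonneg)
  show thesis
  proof (rule that[of "c1 + real CARD('p) * c2"])
    show "0 \<le> c1 + real CARD('p) * c2" using c0 by simp
    show "(f has_derivative (\<lambda>v. \<Sum>i\<in>UNIV. v $ i *\<^sub>R partial_deriv i f x)) (at x)"
      if "x \<in> interior \<Theta>" for x by (intro has_derivative_partial_derivs d0 that)
    show "norm (partial_deriv i f x) \<le> c1 + real CARD('p) * c2" if "x \<in> interior \<Theta>" for i x
      using c1[OF that, of i] c0 by (simp add: add_increasing2)
    show "norm (partial_deriv i f x - partial_deriv i f y) \<le> (c1 + real CARD('p) * c2) * norm (x - y)"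
      if "x \<in> interior \<Theta>" "y \<in> interior \<Theta>" for i x y
    proof -
      have "norm (partial_deriv i f x - partial_deriv i f y) \<le> real CARD('p) * c2 * norm (x - y)"
        by (rule mean_value_bound[OF assms(3) has_derivative_partial_derivs[OF d1] c2 that])
      also have "\<dots> \<le> (c1 + real CARD('p) * c2) * norm (x - y)"
        using c0 by (intro mult_right_mono) auto
      finally show ?thesis .
    qed
  qed
qed

section \<open>The parametric model\<close>

lemma bounded_linear_grid_sum: "bounded_linear (\<lambda>\<nu>. grid_sum n t \<nu> x)"
  unfolding grid_sum_def
  by (intro bounded_linear_sum bounded_linear_mult_const bounded_linear_smeasure)

text \<open>A twice continuously differentiable family of signed measures that is identifiable at the interior point
  \<open>\<theta>\<^sub>0\<close> and has an invertible matrix \<open>\<Sigma>\<close> there.\<close>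

locale gaussian_model = gaussian_process M Z \<tau> K
  for M :: "'w measure" and Z \<tau> K +
  fixes \<Theta> :: "(real^'p) set" and \<theta>\<^sub>0 :: "real^'p" and \<mu> :: "real^'p \<Rightarrow> real signed_measure"
  assumes compact_\<Theta>: "compact \<Theta>" and convex_\<Theta>: "convex \<Theta>" and \<theta>\<^sub>0_int: "\<theta>\<^sub>0 \<in> interior \<Theta>"
    and \<mu>_cont: "continuous_on \<Theta> \<mu>" and \<mu>_C2: "Ck_on 2 \<Theta> \<mu>"
    and identifiable: "\<And>\<theta>. \<theta> \<in> \<Theta> \<Longrightarrow>
      (\<forall>s\<in>{0..\<tau>}. cov_op {0..\<tau>} K (\<mu> \<theta>) s = cov_op {0..\<tau>} K (\<mu> \<theta>\<^sub>0) s) \<Longrightarrow> \<theta> = \<theta>\<^sub>0"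
    and regular: "invertible (\<chi> i j. bil (partial_deriv i \<mu> \<theta>\<^sub>0) (partial_deriv j \<mu> \<theta>\<^sub>0) :: real^'p^'p)"
begin

sublocale bil: bounded_bilinear bil by (rule bounded_bilinear_bil)

text \<open>The deviation \<open>\<Delta>\<close> of the model from its value at \<open>\<theta>\<^sub>0\<close>, the partial derivatives \<open>D\<close> at \<open>\<theta>\<^sub>0\<close>, and the
  derivative \<open>tangent\<close> at \<open>\<theta>\<^sub>0\<close> as a linear map.\<close>

definition \<Delta> :: "real^'p \<Rightarrow> real signed_measure" where "\<Delta> \<theta> = \<mu> \<theta> - \<mu> \<theta>\<^sub>0"

definition D :: "'p \<Rightarrow> real signed_measure" where "D i = partial_deriv i \<mu> \<theta>\<^sub>0"

definition tangent :: "real^'p \<Rightarrow> real signed_measure" where "tangent w = (\<Sum>i\<in>UNIV. w $ i *\<^sub>R D i)"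

lemma \<theta>\<^sub>0_in: "\<theta>\<^sub>0 \<in> \<Theta>"
  using \<theta>\<^sub>0_int interior_subset by blast

lemma \<mu>_derivative: "(\<mu> has_derivative tangent) (at \<theta>\<^sub>0)"
proof -
  obtain L where "\<And>x. x \<in> interior \<Theta> \<Longrightarrow> (\<mu> has_derivative (\<lambda>v. \<Sum>i\<in>UNIV. v $ i *\<^sub>R partial_deriv i \<mu> x)) (at x)"
    by (rule Ck_on_two_bounds[OF \<mu>_C2 compact_\<Theta> convex_\<Theta>]) blast
  from this[OF \<theta>\<^sub>0_int] show ?thesis by (simp add: tangent_def[abs_def] D_def)
qed

lemma bounded_linear_tangent: "bounded_linear tangent"
  using \<mu>_derivative by (rule has_derivative_bounded_linear)

text \<open>Null vectors of a positive semidefinite form lie in its kernel.\<close>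

lemma bil_null:
  assumes "bil \<nu> \<nu> = 0"
  shows "bil \<nu> \<rho> = 0"
proof (rule ccontr)
  assume nz: "bil \<nu> \<rho> \<noteq> 0"
  \<comment> \<open>The multiple of \<open>\<nu>\<close> that would give \<open>\<rho> + x \<nu>\<close> the squared length \<open>- 1\<close>.\<close>
  define x where "x = - (bil \<rho> \<rho> + 1) / (2 * bil \<nu> \<rho>)"
  have "0 \<le> bil (\<rho> + x *\<^sub>R \<nu>) (\<rho> + x *\<^sub>R \<nu>)" by (rule bil_nonneg)
  also have "\<dots> = bil \<rho> \<rho> + 2 * x * bil \<nu> \<rho>"
    by (simp add: bil.add_left bil.add_right bil.scaleR_left bil.scaleR_right assms bil_sym[of \<rho> \<nu>])
  also have "\<dots> = - 1" using nz by (simp add: x_def field_simps)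
  finally show False by simp
qed

lemma bil_tangent: "bil (tangent v) (tangent w) = (\<Sum>i\<in>UNIV. \<Sum>j\<in>UNIV. v $ i * w $ j * bil (D i) (D j))"
  unfolding tangent_def bil.sum_left unfolding bil.sum_right
  by (simp add: bil.scaleR_left bil.scaleR_right mult_ac)

lemma tangent_null:
  assumes "bil (tangent w) (tangent w) = 0"
  shows "w = 0"
proof -
  let ?\<Sigma> = "\<chi> i j. bil (D i) (D j) :: real^'p^'p"
  have "?\<Sigma> *v w = 0"
  proof (rule vec_eq_iff[THEN iffD2], rule allI)
    fix i
    have "bil (tangent w) (D i) = 0" by (rule bil_null[OF assms])
    then have "(\<Sum>j\<in>UNIV. w $ j * bil (D j) (D i)) = 0"
      by (simp add: tangent_def bil.sum_left bil.scaleR_left)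
    then show "(?\<Sigma> *v w) $ i = 0 $ i"
      by (simp add: matrix_vector_mult_def bil_sym[of "D i"] mult.commute)
  qed
  moreover obtain A where "A ** ?\<Sigma> = mat 1" using regular unfolding invertible_def D_def by blast
  ultimately show ?thesis
    by (metis matrix_vector_mul_assoc matrix_vector_mul_lid matrix_vector_mult_0_right)
qed

lemma tangent_coercive:
  obtains c where "c > 0" "\<And>w. c * (norm w)\<^sup>2 \<le> bil (tangent w) (tangent w)"
proof -
  have cont: "continuous_on (sphere 0 1) (\<lambda>w. bil (tangent w) (tangent w))"
    by (intro bil.continuous_on linear_continuous_on bounded_linear_tangent)
  have "sphere (0::real^'p) 1 \<noteq> {}"
    by (metis ex_in_conv mem_sphere_0 vector_choose_size zero_le_one)
  then obtain w0 where w0: "w0 \<in> sphere 0 1"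
    "\<And>w. w \<in> sphere 0 1 \<Longrightarrow> bil (tangent w0) (tangent w0) \<le> bil (tangent w) (tangent w)"
    using continuous_attains_inf[OF compact_sphere _ cont] by blast
  define c where "c = bil (tangent w0) (tangent w0)"
  have "c \<noteq> 0" using tangent_null[of w0] w0(1) unfolding c_def by auto
  then have c: "c > 0" using bil_nonneg[of "tangent w0"] by (simp add: c_def)
  have "c * (norm w)\<^sup>2 \<le> bil (tangent w) (tangent w)" for w
  proof (cases "w = 0")
    case True
    then show ?thesis using bil_nonneg by simp
  next
    case False
    let ?u = "(1 / norm w) *\<^sub>R w"
    have "c \<le> bil (tangent ?u) (tangent ?u)" unfolding c_def by (rule w0(2)) (use False in simp)
    also have "\<dots> = bil (tangent w) (tangent w) / (norm w)\<^sup>2"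
      unfolding linear_scale[OF bounded_linear.linear[OF bounded_linear_tangent]]
      by (simp add: bil.scaleR_left bil.scaleR_right power2_eq_square)
    finally show ?thesis using False by (simp add: field_simps)
  qed
  with c show thesis by (rule that)
qed

lemma bil_diff_tendsto:
  assumes ab: "(\<lambda>k. a k - b k) \<longlonglongrightarrow> (0 :: real signed_measure)" and b: "\<And>k. norm (b k) \<le> R"
  shows "(\<lambda>k. bil (a k) (a k) - bil (b k) (b k)) \<longlonglongrightarrow> 0"
proof -
  obtain C where C: "C > 0" "\<And>x y. norm (bil x y) \<le> norm x * norm y * C" using bil.pos_bounded by blast
  show ?thesis
  proof (rule Lim_null_comparison)
    let ?d = "\<lambda>k. norm (a k - b k)"
    show "\<forall>\<^sub>F k in sequentially. norm (bil (a k) (a k) - bil (b k) (b k)) \<le> C * ?d k * (?d k + 2 * R)"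
    proof (intro always_eventually allI)
      fix k
      have "bil (a k) (a k) - bil (b k) (b k) = bil (a k - b k) (a k - b k) + 2 * bil (a k - b k) (b k)"
        by (simp add: bil.diff_left bil.diff_right bil_sym[of "b k" "a k"])
      then have "norm (bil (a k) (a k) - bil (b k) (b k)) \<le> ?d k * ?d k * C + 2 * (?d k * norm (b k) * C)"
        using C(2)[of "a k - b k" "a k - b k"] C(2)[of "a k - b k" "b k"]
        unfolding real_norm_def by linarith
      also have "\<dots> \<le> ?d k * ?d k * C + 2 * (?d k * R * C)"
        using C(1) b[of k] by (intro add_left_mono mult_left_mono mult_right_mono) auto
      finally show "norm (bil (a k) (a k) - bil (b k) (b k)) \<le> C * ?d k * (?d k + 2 * R)"
        by (simp add: algebra_simps)
    qed
    have "?d \<longlonglongrightarrow> 0" using ab by (rule tendsto_norm_zero)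
    then have "(\<lambda>k. C * ?d k * (?d k + 2 * R)) \<longlonglongrightarrow> C * 0 * (0 + 2 * R)" by (intro tendsto_intros)
    then show "(\<lambda>k. C * ?d k * (?d k + 2 * R)) \<longlonglongrightarrow> 0" by simp
  qed
qed

lemma \<Delta>_expansion:
  assumes "\<And>k. e k > 0" "e \<longlonglongrightarrow> 0" "\<And>k. norm (y k - \<theta>\<^sub>0) \<le> R * e k"
  shows "(\<lambda>k. (1 / e k) *\<^sub>R \<Delta> (y k) - tangent ((1 / e k) *\<^sub>R (y k - \<theta>\<^sub>0))) \<longlonglongrightarrow> 0"
  unfolding \<Delta>_def by (rule has_derivative_sequence[OF \<mu>_derivative assms])

lemma bil_\<Delta>_zero:
  assumes "\<theta> \<in> \<Theta>" "bil (\<Delta> \<theta>) (\<Delta> \<theta>) = 0"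
  shows "\<theta> = \<theta>\<^sub>0"
proof (rule identifiable[OF assms(1)], rule ballI)
  fix s assume s: "s \<in> {0..\<tau>}"
  have "bil (dirac s) (\<Delta> \<theta>) = 0" using bil_null[OF assms(2)] bil_sym by metis
  then show "cov_op {0..\<tau>} K (\<mu> \<theta>) s = cov_op {0..\<tau>} K (\<mu> \<theta>\<^sub>0) s"
    by (simp add: \<Delta>_def bil.diff_right bil_dirac[OF s])
qed

text \<open>Along a sequence violating every such bound, a limit point has \<open>bil (\<Delta> l) (\<Delta> l) = 0\<close>, hence equals
  \<open>\<theta>\<^sub>0\<close> by identifiability; the expansion at \<open>\<theta>\<^sub>0\<close> then contradicts the definiteness of \<open>\<Sigma>\<close>.\<close>

lemma \<Delta>_coercive:
  obtains c where "c > 0" "\<And>\<theta>. \<theta> \<in> \<Theta> \<Longrightarrow> c * (norm (\<theta> - \<theta>\<^sub>0))\<^sup>2 \<le> bil (\<Delta> \<theta>) (\<Delta> \<theta>)"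
proof -
  have "\<exists>c>0. \<forall>\<theta>\<in>\<Theta>. c * (norm (\<theta> - \<theta>\<^sub>0))\<^sup>2 \<le> bil (\<Delta> \<theta>) (\<Delta> \<theta>)"
  proof (rule ccontr)
    assume neg: "\<not> ?thesis"
    have "\<forall>m. \<exists>\<theta>\<in>\<Theta>. bil (\<Delta> \<theta>) (\<Delta> \<theta>) < 1 / real (Suc m) * (norm (\<theta> - \<theta>\<^sub>0))\<^sup>2"
    proof
      fix m
      have "1 / real (Suc m) > 0" by simp
      then show "\<exists>\<theta>\<in>\<Theta>. bil (\<Delta> \<theta>) (\<Delta> \<theta>) < 1 / real (Suc m) * (norm (\<theta> - \<theta>\<^sub>0))\<^sup>2"
        using neg not_le by blast
    qed
    then obtain x where x: "\<And>m. x m \<in> \<Theta>"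
      "\<And>m. bil (\<Delta> (x m)) (\<Delta> (x m)) < 1 / real (Suc m) * (norm (x m - \<theta>\<^sub>0))\<^sup>2" by metis
    obtain l r where l: "l \<in> \<Theta>" and r: "strict_mono r" "(x \<circ> r) \<longlonglongrightarrow> l"
      using compact_imp_seq_compact[OF compact_\<Theta>] x(1) unfolding seq_compact_def by metis
    define y where "y m = x (r m)" for m
    define e where "e m = norm (y m - \<theta>\<^sub>0)" for m
    have yl: "y \<longlonglongrightarrow> l" using r(2) by (simp add: y_def[abs_def] comp_def)
    have y\<Theta>: "y m \<in> \<Theta>" for m by (simp add: y_def x)
    have small: "bil (\<Delta> (y m)) (\<Delta> (y m)) \<le> 1 / real (Suc m) * (e m)\<^sup>2" for m
    proof -
      have "1 / real (Suc (r m)) \<le> 1 / real (Suc m)"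
        using seq_suble[OF r(1), of m] by (simp add: frac_le)
      then have "1 / real (Suc (r m)) * (e m)\<^sup>2 \<le> 1 / real (Suc m) * (e m)\<^sup>2"
        by (intro mult_right_mono) auto
      then show ?thesis using x(2)[of "r m"] by (simp add: y_def e_def)
    qed
    have e_pos: "e m > 0" for m
    proof (rule ccontr)
      assume "\<not> e m > 0"
      then have "e m = 0" by (simp add: e_def)
      then show False using x(2)[of "r m"] bil_nonneg[of "\<Delta> (y m)"] by (simp add: y_def e_def)
    qed
    have "(\<lambda>m. bil (\<Delta> (y m)) (\<Delta> (y m))) \<longlonglongrightarrow> bil (\<Delta> l) (\<Delta> l)"
      unfolding \<Delta>_def
      by (intro bil.tendsto tendsto_diff tendsto_const continuous_on_tendsto_compose[OF \<mu>_cont yl l]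
          always_eventually allI y\<Theta>)
    moreover have "(\<lambda>m. 1 / real (Suc m) * (e m)\<^sup>2) \<longlonglongrightarrow> 0 * (norm (l - \<theta>\<^sub>0))\<^sup>2"
      unfolding e_def by (intro tendsto_intros yl lim_const_over_n[THEN LIMSEQ_Suc])
    ultimately have "bil (\<Delta> l) (\<Delta> l) \<le> 0 * (norm (l - \<theta>\<^sub>0))\<^sup>2"
      by (rule LIMSEQ_le) (use small in blast)
    then have "bil (\<Delta> l) (\<Delta> l) = 0" using bil_nonneg[of "\<Delta> l"] by simp
    then have l0: "l = \<theta>\<^sub>0" by (rule bil_\<Delta>_zero[OF l])
    have e0: "e \<longlonglongrightarrow> 0" unfolding e_def using tendsto_norm_zero[OF LIM_zero[OF yl]] by (simp add: l0)
    define w where "w m = (1 / e m) *\<^sub>R (y m - \<theta>\<^sub>0)" for m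
    have w1: "norm (w m) = 1" for m using e_pos[of m] by (simp add: w_def e_def)
    have "(\<lambda>m. (1 / e m) *\<^sub>R \<Delta> (y m) - tangent (w m)) \<longlonglongrightarrow> 0"
      unfolding w_def by (rule \<Delta>_expansion[where R = 1, OF e_pos e0]) (simp add: e_def)
    moreover obtain R where "\<And>v. norm (tangent v) \<le> norm v * R"
      using bounded_linear.bounded[OF bounded_linear_tangent] by blast
    then have "norm (tangent (w m)) \<le> R" for m using w1[of m] by (metis mult_1)
    ultimately have lim: "(\<lambda>m. bil ((1 / e m) *\<^sub>R \<Delta> (y m)) ((1 / e m) *\<^sub>R \<Delta> (y m)) - bil (tangent (w m)) (tangent (w m))) \<longlonglongrightarrow> 0"
      by (rule bil_diff_tendsto)
    obtain c where c: "c > 0" "\<And>w. c * (norm w)\<^sup>2 \<le> bil (tangent w) (tangent w)" by (rule tangent_coercive) blast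
    have "0 \<le> 0 - c"
    proof (rule LIMSEQ_le[OF lim])
      show "(\<lambda>m. 1 / real (Suc m) - c) \<longlonglongrightarrow> 0 - c" by (intro tendsto_intros lim_const_over_n[THEN LIMSEQ_Suc])
      have "bil ((1 / e m) *\<^sub>R \<Delta> (y m)) ((1 / e m) *\<^sub>R \<Delta> (y m)) - bil (tangent (w m)) (tangent (w m)) \<le> 1 / real (Suc m) - c" for m
      proof -
        have "bil ((1 / e m) *\<^sub>R \<Delta> (y m)) ((1 / e m) *\<^sub>R \<Delta> (y m)) = bil (\<Delta> (y m)) (\<Delta> (y m)) / (e m)\<^sup>2"
          by (simp add: bil.scaleR_left bil.scaleR_right power2_eq_square)
        also have "\<dots> \<le> 1 / real (Suc m)" using small[of m] e_pos[of m] by (simp add: pos_divide_le_eq)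
        finally show ?thesis using c(2)[of "w m"] w1[of m] by simp
      qed
      then show "\<exists>N. \<forall>m\<ge>N. bil ((1 / e m) *\<^sub>R \<Delta> (y m)) ((1 / e m) *\<^sub>R \<Delta> (y m)) - bil (tangent (w m)) (tangent (w m)) \<le> 1 / real (Suc m) - c"
        by blast
    qed
    then show False using c(1) by simp
  qed
  then show thesis using that by blast
qed

lemma \<mu>_bounded:
  obtains R where "R \<ge> 0" "\<And>\<theta>. \<theta> \<in> \<Theta> \<Longrightarrow> norm (\<mu> \<theta>) \<le> R"
proof -
  have "bounded (\<mu> ` \<Theta>)" by (intro compact_imp_bounded compact_continuous_image \<mu>_cont compact_\<Theta>)
  then obtain R where "R > 0" "\<forall>y\<in>\<mu> ` \<Theta>. norm y \<le> R" unfolding bounded_pos by metis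
  then show thesis by (intro that[of R]) auto
qed

text \<open>A bound on the discretised pairings with the partial derivatives of the model bounds the
  discretised pairings with \<open>\<Delta> \<theta>\<close>, by the mean value theorem.\<close>

lemma grid_sum_\<Delta>_bound:
  assumes S: "\<And>i x. x \<in> interior \<Theta> \<Longrightarrow> \<bar>grid_sum n t (partial_deriv i \<mu> x) z\<bar> \<le> s" and \<theta>: "\<theta> \<in> \<Theta>"
  shows "\<bar>grid_sum n t (\<Delta> \<theta>) z\<bar> \<le> real CARD('p) * s * norm (\<theta> - \<theta>\<^sub>0)"
proof -
  note bl = bounded_linear_grid_sum[of n t z]
  note lin = bounded_linear.linear[OF bl]
  obtain L where L: "\<And>x. x \<in> interior \<Theta> \<Longrightarrow> (\<mu> has_derivative (\<lambda>v. \<Sum>i\<in>UNIV. v $ i *\<^sub>R partial_deriv i \<mu> x)) (at x)"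
    by (rule Ck_on_two_bounds[OF \<mu>_C2 compact_\<Theta> convex_\<Theta>]) blast
  have der: "((\<lambda>x. grid_sum n t (\<mu> x) z) has_derivative
      (\<lambda>v. \<Sum>i\<in>UNIV. v $ i *\<^sub>R grid_sum n t (partial_deriv i \<mu> x) z)) (at x)" if "x \<in> interior \<Theta>" for x
    using bounded_linear.has_derivative[OF bl L[OF that]]
    by (simp add: linear_sum[OF lin] linear_scale[OF lin])
  have "norm (grid_sum n t (\<mu> \<theta>) z - grid_sum n t (\<mu> \<theta>\<^sub>0) z) \<le> real CARD('p) * s * norm (\<theta> - \<theta>\<^sub>0)"
    by (rule mean_value_bound_closure[OF convex_\<Theta> bounded_linear.continuous_on[OF bl \<mu>_cont] der _ \<theta> \<theta>\<^sub>0_int])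
      (simp_all add: S)
  then show ?thesis by (simp add: \<Delta>_def grid_sum_diff)
qed

text \<open>The processes \<open>x \<mapsto> grid_sum n t (\<partial>\<^sub>i \<mu> x) (Z \<omega>)\<close> satisfy the chaining bound uniformly over all grids.\<close>

lemma grid_sum_sup_moment:
  fixes q :: nat
  assumes q: "q = 4 * CARD('p) + 2"
  obtains B where "B \<ge> 0" and "\<And>n t. is_grid \<tau> n t \<Longrightarrow> sup_moment_le M q B (UNIV \<times> interior \<Theta>)
    (\<lambda>x \<omega>. grid_sum n t (partial_deriv (fst x) \<mu> (snd x)) (Z \<omega>))"
proof -
  let ?D = "\<lambda>i x. partial_deriv i \<mu> x"
  obtain L where L: "L \<ge> 0" "\<And>i x. x \<in> interior \<Theta> \<Longrightarrow> norm (?D i x) \<le> L"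
    "\<And>i x y. x \<in> interior \<Theta> \<Longrightarrow> y \<in> interior \<Theta> \<Longrightarrow> norm (?D i x - ?D i y) \<le> L * norm (x - y)"
    by (rule Ck_on_two_bounds[OF \<mu>_C2 compact_\<Theta> convex_\<Theta>]) blast
  obtain \<kappa> where \<kappa>: "\<kappa> \<ge> 0" "\<And>s u. s \<in> T \<Longrightarrow> u \<in> T \<Longrightarrow> \<bar>K s u\<bar> \<le> \<kappa>" by (rule K_bounded) blast
  define k where "k = 2 * CARD('p) + 1"
  have qk: "q = 2 * k" by (simp add: q k_def)
  define C where "C = normal_moment_const k * \<kappa> ^ k * L ^ q"
  have c0: "normal_moment_const k * \<kappa> ^ k \<ge> 0" using \<kappa>(1) normal_moment_const_pos[of k] by simp
  have C: "C \<ge> 0" using c0 L(1) by (simp add: C_def)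
  have bi: "bounded (interior \<Theta>)" using compact_imp_bounded[OF compact_\<Theta>] interior_subset by (rule bounded_subset)
  obtain B where B: "B \<ge> 0"
    "\<And>Y. lipschitz_moments M q C (interior \<Theta>) Y \<Longrightarrow> sup_moment_le M q B (interior \<Theta>) Y"
    by (rule chaining_bound[OF bi C q, of M]) blast
  show thesis
  proof (rule that[of "real CARD('p) * B"])
    show "real CARD('p) * B \<ge> 0" using B(1) by simp
    fix n t assume g: "is_grid \<tau> n t"
    have "sup_moment_le M q B (interior \<Theta>) (\<lambda>x \<omega>. grid_sum n t (?D i x) (Z \<omega>))" for i
    proof (rule B(2), unfold lipschitz_moments_def, intro conjI ballI)
      show "(\<lambda>\<omega>. grid_sum n t (?D i x) (Z \<omega>)) \<in> borel_measurable M" for x by (rule grid_sum_measurable[OF g])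
      have "L-lipschitz_on (interior \<Theta>) (?D i)"
        by (rule lipschitz_onI) (auto simp: dist_norm intro: L)
      then have "continuous_on (interior \<Theta>) (?D i)" by (rule lipschitz_on_continuous_on)
      then show "continuous_on (interior \<Theta>) (\<lambda>x. grid_sum n t (?D i x) (Z \<omega>))" for \<omega>
        by (rule bounded_linear.continuous_on[OF bounded_linear_grid_sum])
      show "(\<integral>\<^sup>+\<omega>. ennreal (\<bar>grid_sum n t (?D i x) (Z \<omega>)\<bar> ^ q) \<partial>M) \<le> ennreal C" if x: "x \<in> interior \<Theta>" for x
      proof -
        have "(\<integral>\<^sup>+\<omega>. ennreal (\<bar>grid_sum n t (?D i x) (Z \<omega>)\<bar> ^ q) \<partial>M)
            \<le> ennreal (normal_moment_const k * \<kappa> ^ k * norm (?D i x) ^ q)"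
          unfolding qk by (rule grid_sum_moment[OF g \<kappa>])
        also have "\<dots> \<le> ennreal C"
          unfolding C_def using L(2)[OF x] c0 by (intro ennreal_leI mult_left_mono power_mono) auto
        finally show ?thesis .
      qed
      show "(\<integral>\<^sup>+\<omega>. ennreal (\<bar>grid_sum n t (?D i x) (Z \<omega>) - grid_sum n t (?D i y) (Z \<omega>)\<bar> ^ q) \<partial>M)
          \<le> ennreal (C * norm (x - y) ^ q)" if xy: "x \<in> interior \<Theta>" "y \<in> interior \<Theta>" for x y
      proof -
        have "(\<integral>\<^sup>+\<omega>. ennreal (\<bar>grid_sum n t (?D i x - ?D i y) (Z \<omega>)\<bar> ^ q) \<partial>M)
            \<le> ennreal (normal_moment_const k * \<kappa> ^ k * norm (?D i x - ?D i y) ^ q)"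
          unfolding qk by (rule grid_sum_moment[OF g \<kappa>])
        also have "\<dots> \<le> ennreal (normal_moment_const k * \<kappa> ^ k * (L * norm (x - y)) ^ q)"
          using L(3)[OF xy] c0 by (intro ennreal_leI mult_left_mono power_mono) auto
        also have "normal_moment_const k * \<kappa> ^ k * (L * norm (x - y)) ^ q = C * norm (x - y) ^ q"
          by (simp add: C_def power_mult_distrib)
        finally show ?thesis by (simp add: grid_sum_diff)
      qed
    qed
    then have "\<forall>i. \<exists>S. S \<in> borel_measurable M \<and> (\<forall>\<omega>\<in>space M. \<forall>x\<in>interior \<Theta>. ennreal (\<bar>grid_sum n t (?D i x) (Z \<omega>)\<bar> ^ q) \<le> S \<omega>) \<and>
      (\<integral>\<^sup>+\<omega>. S \<omega> \<partial>M) \<le> ennreal B" unfolding sup_moment_le_def by blast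
    from choice[OF this] obtain S where S: "\<And>i. S i \<in> borel_measurable M"
      "\<And>i \<omega> x. \<omega> \<in> space M \<Longrightarrow> x \<in> interior \<Theta> \<Longrightarrow> ennreal (\<bar>grid_sum n t (?D i x) (Z \<omega>)\<bar> ^ q) \<le> S i \<omega>"
      "\<And>i. (\<integral>\<^sup>+\<omega>. S i \<omega> \<partial>M) \<le> ennreal B" by blast
    show "sup_moment_le M q (real CARD('p) * B) (UNIV \<times> interior \<Theta>)
        (\<lambda>x \<omega>. grid_sum n t (?D (fst x) (snd x)) (Z \<omega>))"
      unfolding sup_moment_le_def
    proof (intro bexI[of _ "\<lambda>\<omega>. \<Sum>i\<in>UNIV. S i \<omega>"] conjI ballI allI)
      show "(\<lambda>\<omega>. \<Sum>i\<in>UNIV. S i \<omega>) \<in> borel_measurable M" using S(1) by (intro borel_measurable_sum)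
      show "ennreal (\<bar>grid_sum n t (?D (fst x) (snd x)) (Z \<omega>)\<bar> ^ q) \<le> (\<Sum>i\<in>UNIV. S i \<omega>)"
        if "\<omega> \<in> space M" "x \<in> UNIV \<times> interior \<Theta>" for \<omega> x
        using that by (intro order_trans[OF S(2)] member_le_sum) auto
      have "(\<integral>\<^sup>+\<omega>. (\<Sum>i\<in>UNIV. S i \<omega>) \<partial>M) = (\<Sum>i\<in>UNIV. \<integral>\<^sup>+\<omega>. S i \<omega> \<partial>M)"
        using S(1) by (intro nn_integral_sum)
      also have "\<dots> \<le> (\<Sum>i\<in>(UNIV::'p set). ennreal B)" by (intro sum_mono S(3))
      also have "\<dots> = ennreal (real CARD('p) * B)"
        using B(1) by (simp add: ennreal_mult ennreal_of_nat_eq_real_of_nat)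
      finally show "(\<integral>\<^sup>+\<omega>. (\<Sum>i\<in>UNIV. S i \<omega>) \<partial>M) \<le> ennreal (real CARD('p) * B)" .
    qed
  qed
qed

end

section \<open>Asymptotics of the maximizer\<close>

lemma square_bound_of_quadratic:
  fixes x a b :: real
  assumes "x\<^sup>2 \<le> a * x + b"
  shows "x\<^sup>2 \<le> a\<^sup>2 + 2 * b"
proof -
  have "0 \<le> (x - a)\<^sup>2" by simp
  then have "2 * (a * x) \<le> x\<^sup>2 + a\<^sup>2" by (simp add: power2_diff algebra_simps)
  then show ?thesis using assms by linarith
qed

text \<open>A sequence of grids and noise levels along which the oscillation \<open>\<delta>\<close> of the kernel on the cells is
  \<open>o(\<epsilon>\<^sup>2)\<close>.\<close>

locale gaussian_model_sequence = gaussian_model M Z \<tau> K \<Theta> \<theta>\<^sub>0 \<mu>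
  for M :: "'w measure" and Z \<tau> K and \<Theta> :: "(real^'p) set" and \<theta>\<^sub>0 \<mu> +
  fixes N :: "nat \<Rightarrow> nat" and g :: "nat \<Rightarrow> nat \<Rightarrow> real" and \<epsilon> \<delta> :: "nat \<Rightarrow> real"
  assumes grid: "\<And>k. is_grid \<tau> (N k) (g k)" and N_pos: "\<And>k. N k \<ge> 1"
    and osc: "\<And>k. cell_osc (N k) (g k) (\<delta> k)"
    and \<epsilon>_pos: "\<And>k. \<epsilon> k > 0" and \<epsilon>_lim: "\<epsilon> \<longlonglongrightarrow> 0"
    and \<delta>_lim: "(\<lambda>k. \<delta> k / (\<epsilon> k)\<^sup>2) \<longlonglongrightarrow> 0"
    and pairing_lim: "\<And>\<nu> x. continuous_on {0..\<tau>} x \<Longrightarrow>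
      (\<lambda>k. grid_sum (N k) (g k) \<nu> x) \<longlonglongrightarrow> pairing {0..\<tau>} \<nu> x"
begin

abbreviation I :: "nat \<Rightarrow> real signed_measure \<Rightarrow> (real \<Rightarrow> real) \<Rightarrow> real" where
  "I k \<nu> z \<equiv> grid_sum (N k) (g k) \<nu> z"

text \<open>The discretised contrast of the observation \<open>h\<^sub>0 + \<epsilon> z\<close>, where \<open>z\<close> is a path of the noise, and its
  noiseless limit.\<close>

definition contrast :: "nat \<Rightarrow> (real \<Rightarrow> real) \<Rightarrow> real^'p \<Rightarrow> real" where
  "contrast k z \<theta> = Phi_disc (N k) (g k) K (\<lambda>s. cov_op T K (\<mu> \<theta>\<^sub>0) s + \<epsilon> k * z s) (\<mu> \<theta>)"

definition limit_contrast :: "real^'p \<Rightarrow> real" where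
  "limit_contrast \<theta> = Phi_lim T K (cov_op T K (\<mu> \<theta>\<^sub>0)) (\<mu> \<theta>)"

text \<open>The discretisation error of the noiseless contrast.\<close>

definition bias :: "nat \<Rightarrow> real^'p \<Rightarrow> real" where
  "bias k \<theta> = (I k (\<mu> \<theta>) (cov_op T K (\<mu> \<theta>\<^sub>0)) - bil (\<mu> \<theta>) (\<mu> \<theta>\<^sub>0)) -
     1/2 * (grid_bil (N k) (g k) (\<mu> \<theta>) (\<mu> \<theta>) - bil (\<mu> \<theta>) (\<mu> \<theta>))"

lemma limit_contrast_eq: "limit_contrast \<theta> = 1/2 * bil (\<mu> \<theta>\<^sub>0) (\<mu> \<theta>\<^sub>0) - 1/2 * bil (\<Delta> \<theta>) (\<Delta> \<theta>)"
proof -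
  have "limit_contrast \<theta> = bil (\<mu> \<theta>) (\<mu> \<theta>\<^sub>0) - 1/2 * bil (\<mu> \<theta>) (\<mu> \<theta>)"
    by (simp add: limit_contrast_def Phi_lim_def bil_def)
  then show ?thesis
    by (simp add: \<Delta>_def bil.diff_left bil.diff_right bil_sym[of "\<mu> \<theta>\<^sub>0" "\<mu> \<theta>"] algebra_simps)
qed

lemma contrast_eq: "contrast k z \<theta> = limit_contrast \<theta> + bias k \<theta> + \<epsilon> k * I k (\<mu> \<theta>) z"
proof -
  have "contrast k z \<theta> = I k (\<mu> \<theta>) (cov_op T K (\<mu> \<theta>\<^sub>0)) + \<epsilon> k * I k (\<mu> \<theta>) z
      - 1/2 * grid_bil (N k) (g k) (\<mu> \<theta>) (\<mu> \<theta>)"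
    by (simp add: contrast_def Phi_disc_def grid_sum_def grid_bil_def distrib_left sum.distrib
        sum_distrib_left mult.left_commute)
  then show ?thesis
    by (simp add: limit_contrast_def Phi_lim_def bil_def[symmetric] bias_def diff_divide_distrib)
qed

lemma \<delta>_nonneg: "\<delta> k \<ge> 0"
  by (rule cell_osc_nonneg[OF grid N_pos osc])

lemma bias_le:
  assumes R: "\<And>\<theta>. \<theta> \<in> \<Theta> \<Longrightarrow> norm (\<mu> \<theta>) \<le> R" "R \<ge> 0" and \<theta>: "\<theta> \<in> \<Theta>"
  shows "\<bar>bias k \<theta>\<bar> \<le> 7 * R\<^sup>2 * \<delta> k"
proof -
  have RR: "norm (\<mu> \<theta>) * norm (\<mu> \<theta>') \<le> R\<^sup>2" if "\<theta>' \<in> \<Theta>" for \<theta>'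
    unfolding power2_eq_square by (intro mult_mono R \<theta> that) auto
  have "\<bar>I k (\<mu> \<theta>) (cov_op T K (\<mu> \<theta>\<^sub>0)) - bil (\<mu> \<theta>) (\<mu> \<theta>\<^sub>0)\<bar> \<le> 4 * \<delta> k * (norm (\<mu> \<theta>) * norm (\<mu> \<theta>\<^sub>0))"
    using grid_sum_cov_op[OF grid N_pos osc] by (simp add: mult.assoc)
  also have "\<dots> \<le> 4 * \<delta> k * R\<^sup>2" by (intro mult_left_mono RR \<theta>\<^sub>0_in) (simp add: \<delta>_nonneg)
  finally have 1: "\<bar>I k (\<mu> \<theta>) (cov_op T K (\<mu> \<theta>\<^sub>0)) - bil (\<mu> \<theta>) (\<mu> \<theta>\<^sub>0)\<bar> \<le> 4 * \<delta> k * R\<^sup>2" .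
  have "\<bar>grid_bil (N k) (g k) (\<mu> \<theta>) (\<mu> \<theta>) - bil (\<mu> \<theta>) (\<mu> \<theta>)\<bar> \<le> 6 * \<delta> k * (norm (\<mu> \<theta>) * norm (\<mu> \<theta>))"
    using grid_bil_bil[OF grid N_pos osc] by (simp add: mult.assoc)
  also have "\<dots> \<le> 6 * \<delta> k * R\<^sup>2" by (intro mult_left_mono RR \<theta>) (simp add: \<delta>_nonneg)
  finally have 2: "\<bar>grid_bil (N k) (g k) (\<mu> \<theta>) (\<mu> \<theta>) - bil (\<mu> \<theta>) (\<mu> \<theta>)\<bar> \<le> 6 * \<delta> k * R\<^sup>2" .
  show ?thesis using 1 2 unfolding bias_def by (simp add: abs_le_iff field_simps)
qed

definition maximizes :: "nat \<Rightarrow> (real \<Rightarrow> real) \<Rightarrow> real^'p \<Rightarrow> bool" where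
  "maximizes k z \<theta> \<longleftrightarrow> \<theta> \<in> \<Theta> \<and> (\<forall>\<theta>'\<in>\<Theta>. contrast k z \<theta>' \<le> contrast k z \<theta>)"

lemma basic_inequality:
  assumes "maximizes k z \<theta>" "\<theta>' \<in> \<Theta>"
  shows "- 1/2 * bil (\<Delta> \<theta>') (\<Delta> \<theta>') + \<epsilon> k * I k (\<Delta> \<theta>') z + bias k \<theta>' \<le>
    - 1/2 * bil (\<Delta> \<theta>) (\<Delta> \<theta>) + \<epsilon> k * I k (\<Delta> \<theta>) z + bias k \<theta>"
proof -
  have eq: "contrast k z x = 1/2 * bil (\<mu> \<theta>\<^sub>0) (\<mu> \<theta>\<^sub>0) + \<epsilon> k * I k (\<mu> \<theta>\<^sub>0) z +
      (- 1/2 * bil (\<Delta> x) (\<Delta> x) + \<epsilon> k * I k (\<Delta> x) z + bias k x)" for x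
    by (simp add: contrast_eq limit_contrast_eq \<Delta>_def[of x] grid_sum_diff algebra_simps)
  have "contrast k z \<theta>' \<le> contrast k z \<theta>" using assms by (simp add: maximizes_def)
  then show ?thesis unfolding eq by linarith
qed

text \<open>Comparing the maximizer with \<open>\<theta>\<^sub>0\<close> gives \<open>c \<bar>w\<bar>\<^sup>2 \<le> 2 p s \<bar>w\<bar> + O(\<delta> / \<epsilon>\<^sup>2)\<close> for the rescaled error
  \<open>w\<close>.\<close>

lemma rate:
  assumes max: "maximizes k z \<theta>"
    and R: "\<And>\<theta>. \<theta> \<in> \<Theta> \<Longrightarrow> norm (\<mu> \<theta>) \<le> R" "R \<ge> 0"
    and c: "c > 0" "\<And>\<theta>. \<theta> \<in> \<Theta> \<Longrightarrow> c * (norm (\<theta> - \<theta>\<^sub>0))\<^sup>2 \<le> bil (\<Delta> \<theta>) (\<Delta> \<theta>)"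
    and S: "\<And>i x. x \<in> interior \<Theta> \<Longrightarrow> \<bar>I k (partial_deriv i \<mu> x) z\<bar> \<le> s"
  shows "(norm (\<theta> - \<theta>\<^sub>0) / \<epsilon> k)\<^sup>2 \<le> (2 * real CARD('p) * s / c)\<^sup>2 + 56 * R\<^sup>2 / c * (\<delta> k / (\<epsilon> k)\<^sup>2)"
proof -
  let ?x = "norm (\<theta> - \<theta>\<^sub>0)"
  have \<theta>: "\<theta> \<in> \<Theta>" using max by (simp add: maximizes_def)
  have zero: "\<Delta> \<theta>\<^sub>0 = 0" by (simp add: \<Delta>_def)
  have I0: "I k 0 z = 0" by (simp add: grid_sum_def smeasure_zero)
  have "bias k \<theta>\<^sub>0 \<le> - 1/2 * bil (\<Delta> \<theta>) (\<Delta> \<theta>) + \<epsilon> k * I k (\<Delta> \<theta>) z + bias k \<theta>"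
    using basic_inequality[OF max \<theta>\<^sub>0_in] by (simp add: zero I0 bil.zero_left)
  then have "bil (\<Delta> \<theta>) (\<Delta> \<theta>) \<le> 2 * (\<epsilon> k * I k (\<Delta> \<theta>) z) + 2 * bias k \<theta> - 2 * bias k \<theta>\<^sub>0" by linarith
  also have "\<dots> \<le> 2 * (\<epsilon> k * I k (\<Delta> \<theta>) z) + 28 * R\<^sup>2 * \<delta> k"
    using bias_le[OF R \<theta>, of k] bias_le[OF R \<theta>\<^sub>0_in, of k] by (simp add: abs_le_iff)
  also have "\<epsilon> k * I k (\<Delta> \<theta>) z \<le> \<epsilon> k * (real CARD('p) * s * ?x)"
    using grid_sum_\<Delta>_bound[OF S \<theta>] \<epsilon>_pos[of k] by (intro mult_left_mono) (auto simp: abs_le_iff)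
  finally have "c * ?x\<^sup>2 \<le> 2 * (\<epsilon> k * (real CARD('p) * s * ?x)) + 28 * R\<^sup>2 * \<delta> k"
    using c(2)[OF \<theta>] by linarith
  then have "c * ?x\<^sup>2 / (c * (\<epsilon> k)\<^sup>2) \<le> (2 * (\<epsilon> k * (real CARD('p) * s * ?x)) + 28 * R\<^sup>2 * \<delta> k) / (c * (\<epsilon> k)\<^sup>2)"
    using c(1) \<epsilon>_pos[of k] by (intro divide_right_mono) auto
  then have "(?x / \<epsilon> k)\<^sup>2 \<le> 2 * real CARD('p) * s / c * (?x / \<epsilon> k) + 28 * R\<^sup>2 / c * (\<delta> k / (\<epsilon> k)\<^sup>2)"
    using c(1) \<epsilon>_pos[of k] by (simp add: power_divide add_divide_distrib power2_eq_square mult_ac)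
  from square_bound_of_quadratic[OF this] show ?thesis by simp
qed

text \<open>The score at \<open>\<theta>\<^sub>0\<close>: the pairings of the noise with the partial derivatives of the model.\<close>

definition G :: "'p \<Rightarrow> (real \<Rightarrow> real) \<Rightarrow> real" where "G i z = pairing T (D i) z"

lemma I_bound:
  assumes "\<And>s. s \<in> T \<Longrightarrow> \<bar>z s\<bar> \<le> m" "m \<ge> 0"
  shows "\<bar>I k \<nu> z\<bar> \<le> norm \<nu> * m"
  using grid_range[OF grid] assms by (intro grid_sum_bound[OF grid]) auto

text \<open>Along a fixed continuous path, the rescaled error of the maximizer converges to \<open>A G\<close>, where \<open>A\<close> is
  the inverse of \<open>\<Sigma>\<close>: the rescaled contrast is asymptotically the concave quadratic
  \<open>w \<mapsto> - w\<^sup>T \<Sigma> w / 2 + w\<^sup>T G\<close>.\<close>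

lemma maximizer_noise_tendsto:
  assumes z: "continuous_on T z" and max: "\<And>k. maximizes k z (\<theta> k)"
    and A: "(\<chi> i j. bil (D i) (D j)) ** (A :: real^'p^'p) = mat 1"
  shows "(\<lambda>k. I k (\<Delta> (\<theta> k)) z / \<epsilon> k) \<longlonglongrightarrow> (\<Sum>i\<in>UNIV. \<Sum>j\<in>UNIV. A $ i $ j * (G i z * G j z))"
proof -
  define W where "W = A *v (\<chi> i. G i z)"
  have bilW: "bil (tangent w) (tangent W) = (\<Sum>i\<in>UNIV. w $ i * G i z)" for w
  proof -
    have "(\<chi> i j. bil (D i) (D j)) *v W = (\<chi> i. G i z)"
      by (simp add: W_def matrix_vector_mul_assoc A)
    then have "(\<Sum>j\<in>UNIV. bil (D i) (D j) * W $ j) = G i z" for i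
      by (simp add: vec_eq_iff matrix_vector_mult_def)
    moreover have "bil (tangent w) (tangent W) = (\<Sum>i\<in>UNIV. w $ i * (\<Sum>j\<in>UNIV. bil (D i) (D j) * W $ j))"
      unfolding bil_tangent by (simp add: sum_distrib_left mult_ac)
    ultimately show ?thesis by simp
  qed
  obtain R where R: "R \<ge> 0" "\<And>\<theta>. \<theta> \<in> \<Theta> \<Longrightarrow> norm (\<mu> \<theta>) \<le> R" by (rule \<mu>_bounded) blast
  obtain c where c: "c > 0" "\<And>\<theta>. \<theta> \<in> \<Theta> \<Longrightarrow> c * (norm (\<theta> - \<theta>\<^sub>0))\<^sup>2 \<le> bil (\<Delta> \<theta>) (\<Delta> \<theta>)"
    by (rule \<Delta>_coercive) blast
  obtain c' where c': "c' > 0" "\<And>w. c' * (norm w)\<^sup>2 \<le> bil (tangent w) (tangent w)"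
    by (rule tangent_coercive) blast
  obtain m where m: "m \<ge> 0" "\<And>s. s \<in> T \<Longrightarrow> \<bar>z s\<bar> \<le> m" using continuous_on_Icc_bounded[OF z] by blast
  obtain L where L: "L \<ge> 0" "\<And>i x. x \<in> interior \<Theta> \<Longrightarrow> norm (partial_deriv i \<mu> x) \<le> L"
    by (rule Ck_on_two_bounds[OF \<mu>_C2 compact_\<Theta> convex_\<Theta>]) blast
  have S: "\<bar>I k (partial_deriv i \<mu> x) z\<bar> \<le> L * m" if "x \<in> interior \<Theta>" for i x k
    by (rule order_trans[OF I_bound[OF m(2,1)] mult_right_mono[OF L(2)[OF that] m(1)]])
  have "Bseq (\<lambda>k. \<delta> k / (\<epsilon> k)\<^sup>2)" by (intro convergent_imp_Bseq convergentI[OF \<delta>_lim])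
  then obtain b where b': "\<And>k. norm (\<delta> k / (\<epsilon> k)\<^sup>2) \<le> b" by (auto simp: Bseq_def)
  have b: "\<delta> k / (\<epsilon> k)\<^sup>2 \<le> b" for k using b'[of k] unfolding real_norm_def by linarith
  have b_nn: "b \<ge> 0" using b'[of 0] norm_ge_zero order_trans by blast
  define r2 where "r2 = (2 * real CARD('p) * (L * m) / c)\<^sup>2 + 56 * R\<^sup>2 / c * b"
  define r where "r = sqrt r2 + norm W"
  have \<theta>: "\<theta> k \<in> \<Theta>" for k using max by (simp add: maximizes_def)
  define w where "w k = (1 / \<epsilon> k) *\<^sub>R (\<theta> k - \<theta>\<^sub>0)" for k
  have w_le: "norm (w k) \<le> r" for k
  proof -
    have "(norm (w k))\<^sup>2 = (norm (\<theta> k - \<theta>\<^sub>0) / \<epsilon> k)\<^sup>2" using \<epsilon>_pos[of k] by (simp add: w_def)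
    also have "\<dots> \<le> (2 * real CARD('p) * (L * m) / c)\<^sup>2 + 56 * R\<^sup>2 / c * (\<delta> k / (\<epsilon> k)\<^sup>2)"
      by (rule rate[OF max R(2,1) c S])
    also have "\<dots> \<le> r2" unfolding r2_def using b[of k] c(1) by (intro add_left_mono mult_left_mono) auto
    finally have "norm (w k) \<le> sqrt r2" by (rule real_le_rsqrt)
    then show ?thesis by (simp add: r_def add_increasing2)
  qed
  have \<theta>_le: "norm (\<theta> k - \<theta>\<^sub>0) \<le> r * \<epsilon> k" for k
    using w_le[of k] \<epsilon>_pos[of k] by (simp add: w_def pos_divide_le_eq)
  \<comment> \<open>The competitor of the maximizer: the maximizer of the limiting quadratic, scaled back.\<close>
  define y where "y k = \<theta>\<^sub>0 + \<epsilon> k *\<^sub>R W" for k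
  have y_le: "norm (y k - \<theta>\<^sub>0) \<le> norm W * \<epsilon> k" for k using \<epsilon>_pos[of k] by (simp add: y_def)
  have y_in: "\<forall>\<^sub>F k in sequentially. y k \<in> \<Theta>"
  proof -
    have "y \<longlonglongrightarrow> \<theta>\<^sub>0 + 0 *\<^sub>R W" unfolding y_def by (intro tendsto_intros \<epsilon>_lim)
    then have "\<forall>\<^sub>F k in sequentially. y k \<in> interior \<Theta>"
      using \<theta>\<^sub>0_int by (intro topological_tendstoD) auto
    then show ?thesis by eventually_elim (use interior_subset in blast)
  qed
  define a where "a k = (1 / \<epsilon> k) *\<^sub>R \<Delta> (\<theta> k)" for k
  define a' where "a' k = (1 / \<epsilon> k) *\<^sub>R \<Delta> (y k)" for k
  have a: "(\<lambda>k. a k - tangent (w k)) \<longlonglongrightarrow> 0"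
    unfolding a_def w_def by (rule \<Delta>_expansion[OF \<epsilon>_pos \<epsilon>_lim \<theta>_le])
  have a': "(\<lambda>k. a' k - tangent W) \<longlonglongrightarrow> 0"
  proof -
    have "(1 / \<epsilon> k) *\<^sub>R (y k - \<theta>\<^sub>0) = W" for k using \<epsilon>_pos[of k] by (simp add: y_def)
    then show ?thesis using \<Delta>_expansion[OF \<epsilon>_pos \<epsilon>_lim y_le] by (simp add: a'_def)
  qed
  obtain Ct where Ct: "\<And>v. norm (tangent v) \<le> norm v * Ct" "Ct \<ge> 0"
    using bounded_linear.nonneg_bounded[OF bounded_linear_tangent] by blast
  have tw: "norm (tangent (w k)) \<le> r * Ct" for k
    using Ct(1)[of "w k"] mult_right_mono[OF w_le[of k] Ct(2)] by linarith
  have noise: "(\<lambda>k. I k (x k) z - (\<Sum>i\<in>UNIV. v k $ i * G i z)) \<longlonglongrightarrow> 0"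
    if x: "(\<lambda>k. x k - tangent (v k)) \<longlonglongrightarrow> 0" and v: "\<And>k. norm (v k) \<le> r" for x v
  proof -
    have eq: "I k (x k) z - (\<Sum>i\<in>UNIV. v k $ i * G i z) =
        I k (x k - tangent (v k)) z + (\<Sum>i\<in>UNIV. v k $ i * (I k (D i) z - G i z))" for k
    proof -
      note lin = bounded_linear.linear[OF bounded_linear_grid_sum[of "N k" "g k" z]]
      have "I k (tangent (v k)) z = (\<Sum>i\<in>UNIV. v k $ i * I k (D i) z)"
        unfolding tangent_def linear_sum[OF lin] linear_scale[OF lin] by simp
      then show ?thesis by (simp add: grid_sum_diff right_diff_distrib sum_subtractf)
    qed
    have "(\<lambda>k. I k (x k - tangent (v k)) z) \<longlonglongrightarrow> 0"
    proof (rule Lim_null_comparison)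
      show "\<forall>\<^sub>F k in sequentially. norm (I k (x k - tangent (v k)) z) \<le> norm (x k - tangent (v k)) * m"
        using I_bound[OF m(2,1)] by simp
      show "(\<lambda>k. norm (x k - tangent (v k)) * m) \<longlonglongrightarrow> 0"
        using tendsto_mult_right[OF tendsto_norm_zero[OF x], of m] by simp
    qed
    moreover have "(\<lambda>k. v k $ i * (I k (D i) z - G i z)) \<longlonglongrightarrow> 0" for i
    proof (rule Lim_null_comparison)
      show "\<forall>\<^sub>F k in sequentially. norm (v k $ i * (I k (D i) z - G i z)) \<le> r * norm (I k (D i) z - G i z)"
        unfolding norm_mult using component_le_norm_cart v
        by (intro always_eventually allI mult_right_mono) (auto intro: order_trans)
      have "(\<lambda>k. I k (D i) z - G i z) \<longlonglongrightarrow> 0" unfolding G_def by (intro LIM_zero pairing_lim z)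
      from tendsto_mult_left[OF tendsto_norm_zero[OF this], of r]
      show "(\<lambda>k. r * norm (I k (D i) z - G i z)) \<longlonglongrightarrow> 0" by simp
    qed
    then have "(\<lambda>k. \<Sum>i\<in>UNIV. v k $ i * (I k (D i) z - G i z)) \<longlonglongrightarrow> 0" by (rule tendsto_null_sum)
    ultimately show ?thesis unfolding eq by (rule tendsto_add_zero)
  qed
  have bias0: "(\<lambda>k. bias k (x k) / (\<epsilon> k)\<^sup>2) \<longlonglongrightarrow> 0" if "\<forall>\<^sub>F k in sequentially. x k \<in> \<Theta>" for x
  proof (rule Lim_null_comparison)
    show "\<forall>\<^sub>F k in sequentially. norm (bias k (x k) / (\<epsilon> k)\<^sup>2) \<le> 7 * R\<^sup>2 * (\<delta> k / (\<epsilon> k)\<^sup>2)"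
      using that
    proof eventually_elim
      case (elim k)
      then show ?case using bias_le[OF R(2,1) elim, of k] \<epsilon>_pos[of k] by (simp add: divide_right_mono)
    qed
    show "(\<lambda>k. 7 * R\<^sup>2 * (\<delta> k / (\<epsilon> k)\<^sup>2)) \<longlonglongrightarrow> 0" using tendsto_mult_left[OF \<delta>_lim, of "7 * R\<^sup>2"] by simp
  qed
  define obj where "obj x k = (- 1/2 * bil (\<Delta> x) (\<Delta> x) + \<epsilon> k * I k (\<Delta> x) z + bias k x) / (\<epsilon> k)\<^sup>2" for x k
  have obj_eq: "obj x k = - 1/2 * bil ((1 / \<epsilon> k) *\<^sub>R \<Delta> x) ((1 / \<epsilon> k) *\<^sub>R \<Delta> x) + I k ((1 / \<epsilon> k) *\<^sub>R \<Delta> x) z + bias k x / (\<epsilon> k)\<^sup>2" for x k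
    using \<epsilon>_pos[of k]
    by (simp add: obj_def bil.scaleR_left bil.scaleR_right grid_sum_scaleR add_divide_distrib diff_divide_distrib power2_eq_square)
  have obj_lim: "(\<lambda>k. obj (x k) k - (- 1/2 * bil (tangent (v k)) (tangent (v k)) + bil (tangent (v k)) (tangent W))) \<longlonglongrightarrow> 0"
    if x: "(\<lambda>k. (1 / \<epsilon> k) *\<^sub>R \<Delta> (x k) - tangent (v k)) \<longlonglongrightarrow> 0" and v: "\<And>k. norm (v k) \<le> r" "\<And>k. norm (tangent (v k)) \<le> r * Ct"
      and x': "\<forall>\<^sub>F k in sequentially. x k \<in> \<Theta>" for x v
  proof -
    let ?a = "\<lambda>k. (1 / \<epsilon> k) *\<^sub>R \<Delta> (x k)"
    have "(\<lambda>k. - 1/2 * (bil (?a k) (?a k) - bil (tangent (v k)) (tangent (v k))) +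
        (I k (?a k) z - (\<Sum>i\<in>UNIV. v k $ i * G i z)) + bias k (x k) / (\<epsilon> k)\<^sup>2) \<longlonglongrightarrow> - 1/2 * 0 + 0 + 0"
      by (intro tendsto_add tendsto_mult tendsto_const bil_diff_tendsto[OF x v(2)] noise[OF x v(1)] bias0[OF x'])
    moreover have "- 1/2 * (bil (?a k) (?a k) - bil (tangent (v k)) (tangent (v k))) +
        (I k (?a k) z - (\<Sum>i\<in>UNIV. v k $ i * G i z)) + bias k (x k) / (\<epsilon> k)\<^sup>2 =
        obj (x k) k - (- 1/2 * bil (tangent (v k)) (tangent (v k)) + bil (tangent (v k)) (tangent W))" for k
      unfolding obj_eq bilW by (simp add: field_simps)
    ultimately show ?thesis by simp
  qed
  have Wr: "norm W \<le> r" "norm (tangent W) \<le> r * Ct"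
  proof -
    have "0 \<le> r2" using b_nn c(1) by (simp add: r2_def)
    then show "norm W \<le> r" by (simp add: r_def)
    then show "norm (tangent W) \<le> r * Ct"
      using Ct(1)[of W] mult_right_mono[OF _ Ct(2), of "norm W" r] by linarith
  qed
  note lim1 = obj_lim[OF a[unfolded a_def] w_le tw always_eventually[OF allI[OF \<theta>]]]
  note lim2 = obj_lim[OF a'[unfolded a'_def] Wr y_in]
  let ?d = "\<lambda>k. 1/2 * bil (tangent (w k - W)) (tangent (w k - W))"
  let ?u1 = "\<lambda>k. obj (\<theta> k) k - (- 1/2 * bil (tangent (w k)) (tangent (w k)) + bil (tangent (w k)) (tangent W))"
  let ?u2 = "\<lambda>k. obj (y k) k - (- 1/2 * bil (tangent W) (tangent W) + bil (tangent W) (tangent W))"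
  \<comment> \<open>The distance of \<open>w k\<close> to the maximum of the limiting quadratic is its loss of value, which the
    maximality of \<open>\<theta> k\<close> bounds by the errors of the two expansions.\<close>
  have d_lim: "?d \<longlonglongrightarrow> 0"
  proof (rule tendsto_sandwich[OF _ _ tendsto_const])
    show "\<forall>\<^sub>F k in sequentially. 0 \<le> ?d k" using bil_nonneg by simp
    show "\<forall>\<^sub>F k in sequentially. ?d k \<le> ?u1 k - ?u2 k"
      using y_in
    proof eventually_elim
      case (elim k)
      have "obj (y k) k \<le> obj (\<theta> k) k"
        unfolding obj_def using \<epsilon>_pos[of k] by (intro divide_right_mono basic_inequality[OF max elim]) simp
      moreover have e: "tangent (w k - W) = tangent (w k) - tangent W"
        by (rule linear_diff[OF bounded_linear.linear[OF bounded_linear_tangent]])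
      ultimately show ?case
        unfolding e bil.diff_left bil.diff_right bil_sym[of "tangent W" "tangent (w k)"] by argo
    qed
    show "(\<lambda>k. ?u1 k - ?u2 k) \<longlonglongrightarrow> 0" using tendsto_diff[OF lim1 lim2] by simp
  qed
  have wW: "w \<longlonglongrightarrow> W"
  proof -
    have "(\<lambda>k. (norm (w k - W))\<^sup>2) \<longlonglongrightarrow> 0"
    proof (rule Lim_null_comparison)
      show "\<forall>\<^sub>F k in sequentially. norm ((norm (w k - W))\<^sup>2) \<le> 2 / c' * ?d k"
        using c' by (intro always_eventually allI) (simp add: pos_le_divide_eq mult.commute)
      show "(\<lambda>k. 2 / c' * ?d k) \<longlonglongrightarrow> 0" using tendsto_mult_left[OF d_lim, of "2 / c'"] by simp
    qed
    from tendsto_real_sqrt[OF this] have "(\<lambda>k. norm (w k - W)) \<longlonglongrightarrow> 0" by simp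
    then have "(\<lambda>k. w k - W) \<longlonglongrightarrow> 0" by (rule tendsto_norm_zero_cancel)
    then show ?thesis by (rule LIM_zero_cancel)
  qed
  have "(\<lambda>k. (I k (a k) z - (\<Sum>i\<in>UNIV. w k $ i * G i z)) + (\<Sum>i\<in>UNIV. w k $ i * G i z)) \<longlonglongrightarrow> 0 + (\<Sum>i\<in>UNIV. W $ i * G i z)"
    by (intro tendsto_add noise[OF a w_le] tendsto_sum tendsto_mult tendsto_const tendsto_vec_nth wW)
  moreover have "(\<Sum>i\<in>UNIV. W $ i * G i z) = (\<Sum>i\<in>UNIV. \<Sum>j\<in>UNIV. A $ i $ j * (G i z * G j z))"
    unfolding W_def matrix_vector_mult_def
    by (simp only: vec_lambda_beta sum_distrib_right mult.assoc mult.commute[of "G _ z" "G _ z"])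
  moreover have "I k (a k) z = I k (\<Delta> (\<theta> k)) z / \<epsilon> k" for k by (simp add: a_def grid_sum_scaleR)
  ultimately show ?thesis by simp
qed

end

section \<open>Expected overshoot of the maximal contrast\<close>

context gaussian_model_sequence
begin

lemma measurable_compose_\<Theta>:
  assumes "continuous_on \<Theta> f" "\<theta> \<in> borel_measurable M" "\<And>\<omega>. \<omega> \<in> space M \<Longrightarrow> \<theta> \<omega> \<in> \<Theta>"
  shows "(\<lambda>\<omega>. f (\<theta> \<omega>) :: real) \<in> borel_measurable M"
proof -
  have "\<theta> \<in> M \<rightarrow>\<^sub>M restrict_space borel \<Theta>" using assms(2,3) by (intro measurable_restrict_space2) auto
  then show ?thesis
    by (rule measurable_compose[OF _ borel_measurable_continuous_on_restrict[OF assms(1)]])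
qed

lemma smeasure_cont: "continuous_on \<Theta> (\<lambda>\<theta>. smeasure (\<mu> \<theta>) A)"
  by (rule bounded_linear.continuous_on[OF bounded_linear_smeasure \<mu>_cont])

lemma bias_cont: "continuous_on \<Theta> (bias k)"
proof -
  have "continuous_on \<Theta> (\<lambda>\<theta>. I k (\<mu> \<theta>) (cov_op T K (\<mu> \<theta>\<^sub>0)))"
    by (rule bounded_linear.continuous_on[OF bounded_linear_grid_sum \<mu>_cont])
  moreover have "continuous_on \<Theta> (\<lambda>\<theta>. bil (\<mu> \<theta>) (\<mu> \<theta>\<^sub>0))" "continuous_on \<Theta> (\<lambda>\<theta>. bil (\<mu> \<theta>) (\<mu> \<theta>))"
    by (intro bil.continuous_on \<mu>_cont continuous_on_const)+
  moreover have "continuous_on \<Theta> (\<lambda>\<theta>. grid_bil (N k) (g k) (\<mu> \<theta>) (\<mu> \<theta>))"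
    unfolding grid_bil_def by (intro continuous_on_sum continuous_on_mult smeasure_cont continuous_on_const)
  ultimately show ?thesis unfolding bias_def[abs_def]
    by (intro continuous_on_diff continuous_on_mult continuous_on_const)
qed

lemma noise_measurable:
  assumes "\<theta> \<in> borel_measurable M" "\<And>\<omega>. \<omega> \<in> space M \<Longrightarrow> \<theta> \<omega> \<in> \<Theta>"
  shows "(\<lambda>\<omega>. I k (\<Delta> (\<theta> \<omega>)) (Z \<omega>)) \<in> borel_measurable M"
  unfolding grid_sum_def \<Delta>_def smeasure_diff using grid_range[OF grid]
  by (intro borel_measurable_sum borel_measurable_times borel_measurable_diff borel_measurable_const
      point_measurable measurable_compose_\<Theta>[OF smeasure_cont assms]) auto

text \<open>The noise at the maximizer, divided by \<open>\<epsilon>\<close>, has bounded second moments: it is at most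
  \<open>p s \<bar>w\<bar>\<close>, where \<open>s\<close> is a supremum with bounded moments and \<open>\<bar>w\<bar> = O(1 + s)\<close> is the rescaled error.\<close>

lemma noise_second_moment:
  assumes max: "\<And>k \<omega>. \<omega> \<in> space M \<Longrightarrow> maximizes k (Z \<omega>) (\<theta> k \<omega>)"
  obtains B where "B \<ge> 0"
    and "\<And>k. (\<integral>\<^sup>+\<omega>. ennreal ((I k (\<Delta> (\<theta> k \<omega>)) (Z \<omega>) / \<epsilon> k)\<^sup>2) \<partial>M) \<le> ennreal B"
proof -
  let ?p = "real CARD('p)"
  define q where "q = 4 * CARD('p) + 2"
  obtain B where B: "B \<ge> 0" "\<And>n t. is_grid \<tau> n t \<Longrightarrow> sup_moment_le M q B (UNIV \<times> interior \<Theta>)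
      (\<lambda>x \<omega>. grid_sum n t (partial_deriv (fst x) \<mu> (snd x)) (Z \<omega>))"
    by (rule grid_sum_sup_moment[OF q_def]) blast
  obtain R where R: "R \<ge> 0" "\<And>\<theta>. \<theta> \<in> \<Theta> \<Longrightarrow> norm (\<mu> \<theta>) \<le> R" by (rule \<mu>_bounded) blast
  obtain c where c: "c > 0" "\<And>\<theta>. \<theta> \<in> \<Theta> \<Longrightarrow> c * (norm (\<theta> - \<theta>\<^sub>0))\<^sup>2 \<le> bil (\<Delta> \<theta>) (\<Delta> \<theta>)"
    by (rule \<Delta>_coercive) blast
  have "Bseq (\<lambda>k. \<delta> k / (\<epsilon> k)\<^sup>2)" by (intro convergent_imp_Bseq convergentI[OF \<delta>_lim])
  then obtain b0 where b0: "\<And>k. norm (\<delta> k / (\<epsilon> k)\<^sup>2) \<le> b0" by (auto simp: Bseq_def)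
  define b where "b = 56 * R\<^sup>2 / c * b0"
  have b: "56 * R\<^sup>2 / c * (\<delta> k / (\<epsilon> k)\<^sup>2) \<le> b" for k
  proof -
    have "\<delta> k / (\<epsilon> k)\<^sup>2 \<le> b0" using b0[of k] unfolding real_norm_def by linarith
    then show ?thesis unfolding b_def using c(1) by (intro mult_left_mono) auto
  qed
  have "0 \<le> b0" using b0[of 0] norm_ge_zero order_trans by blast
  then have b_nn: "b \<ge> 0" using c(1) by (simp add: b_def)
  define C where "C = ?p\<^sup>2 * ((2 * ?p / c)\<^sup>2 + b)"
  have C: "C > 0" using b_nn c(1) by (simp add: C_def add_pos_nonneg)
  have pt: "(I k (\<Delta> (\<theta> k \<omega>)) (Z \<omega>) / \<epsilon> k)\<^sup>2 \<le> C * (2 + s ^ q)"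
    if \<omega>: "\<omega> \<in> space M" and s: "s \<ge> 0"
      and S: "\<And>i x. x \<in> interior \<Theta> \<Longrightarrow> \<bar>I k (partial_deriv i \<mu> x) (Z \<omega>)\<bar> \<le> s" for k \<omega> s
  proof -
    let ?x = "norm (\<theta> k \<omega> - \<theta>\<^sub>0)"
    have \<theta>: "\<theta> k \<omega> \<in> \<Theta>" using max[OF \<omega>] by (simp add: maximizes_def)
    have "\<bar>I k (\<Delta> (\<theta> k \<omega>)) (Z \<omega>) / \<epsilon> k\<bar> \<le> ?p * s * (?x / \<epsilon> k)"
      using divide_right_mono[OF grid_sum_\<Delta>_bound[OF S \<theta>], of "\<epsilon> k"] \<epsilon>_pos[of k] by simp
    then have "(I k (\<Delta> (\<theta> k \<omega>)) (Z \<omega>) / \<epsilon> k)\<^sup>2 \<le> (?p * s * (?x / \<epsilon> k))\<^sup>2"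
      using power_mono[of "\<bar>I k (\<Delta> (\<theta> k \<omega>)) (Z \<omega>) / \<epsilon> k\<bar>" _ 2] by (simp only: power2_abs abs_ge_zero)
    also have "\<dots> = ?p\<^sup>2 * s\<^sup>2 * (?x / \<epsilon> k)\<^sup>2" by (simp only: power_mult_distrib)
    also have "\<dots> \<le> ?p\<^sup>2 * s\<^sup>2 * ((2 * ?p * s / c)\<^sup>2 + b)"
    proof (rule mult_left_mono)
      have "(?x / \<epsilon> k)\<^sup>2 \<le> (2 * ?p * s / c)\<^sup>2 + 56 * R\<^sup>2 / c * (\<delta> k / (\<epsilon> k)\<^sup>2)"
        by (rule rate[OF max[OF \<omega>] R(2,1) c S])
      then show "(?x / \<epsilon> k)\<^sup>2 \<le> (2 * ?p * s / c)\<^sup>2 + b" using b[of k] by linarith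
    qed simp
    also have "\<dots> = ?p\<^sup>2 * ((2 * ?p / c)\<^sup>2 * s ^ 4 + b * s\<^sup>2)"
      by (simp add: power_mult_distrib power_divide power2_eq_square power4_eq_xxxx algebra_simps)
    also have "\<dots> \<le> ?p\<^sup>2 * ((2 * ?p / c)\<^sup>2 * (2 + s ^ q) + b * (2 + s ^ q))"
    proof -
      have low: "s ^ j \<le> 2 + s ^ q" if "j \<le> q" for j
      proof (cases "s \<le> 1")
        case True
        then have "s ^ j \<le> 1" using s by (intro power_le_one)
        then show ?thesis using s by (simp add: add_increasing2)
      next
        case False
        then have "s ^ j \<le> s ^ q" using that by (intro power_increasing) auto
        then show ?thesis by simp
      qed
      have "4 \<le> q" "2 \<le> q" unfolding q_def by (simp_all add: Suc_le_eq)
      then show ?thesis using low b_nn by (intro mult_left_mono add_mono) auto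
    qed
    also have "\<dots> = C * (2 + s ^ q)" by (simp add: C_def algebra_simps)
    finally show ?thesis .
  qed
  show thesis
  proof (rule that[of "C * (2 + B)"])
    show "C * (2 + B) \<ge> 0" using C B(1) by simp
    fix k
    obtain S where S[measurable]: "S \<in> borel_measurable M" and S1: "\<And>\<omega> x i. \<omega> \<in> space M \<Longrightarrow> x \<in> interior \<Theta> \<Longrightarrow>
        ennreal (\<bar>I k (partial_deriv i \<mu> x) (Z \<omega>)\<bar> ^ q) \<le> S \<omega>"
      and S2: "(\<integral>\<^sup>+\<omega>. S \<omega> \<partial>M) \<le> ennreal B"
      using B(2)[OF grid[of k]] unfolding sup_moment_le_def by fastforce
    have "(\<integral>\<^sup>+\<omega>. ennreal ((I k (\<Delta> (\<theta> k \<omega>)) (Z \<omega>) / \<epsilon> k)\<^sup>2) \<partial>M) \<le> (\<integral>\<^sup>+\<omega>. ennreal C * (2 + S \<omega>) \<partial>M)"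
    proof (rule nn_integral_mono)
      fix \<omega> assume \<omega>: "\<omega> \<in> space M"
      show "ennreal ((I k (\<Delta> (\<theta> k \<omega>)) (Z \<omega>) / \<epsilon> k)\<^sup>2) \<le> ennreal C * (2 + S \<omega>)"
      proof (cases "S \<omega> = \<infinity>")
        case True
        then show ?thesis using C by (simp add: ennreal_mult_top)
      next
        case False
        then obtain v where v: "S \<omega> = ennreal v" "v \<ge> 0" by (cases "S \<omega>") auto
        have q0: "q > 0" by (simp add: q_def)
        define s where "s = root q v"
        have s: "s \<ge> 0" "s ^ q = v" using q0 v(2) by (auto simp: s_def)
        have "\<bar>I k (partial_deriv i \<mu> x) (Z \<omega>)\<bar> \<le> s" if "x \<in> interior \<Theta>" for i x
        proof (rule ccontr)
          assume "\<not> ?thesis"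
          then have "s ^ q < \<bar>I k (partial_deriv i \<mu> x) (Z \<omega>)\<bar> ^ q" using s(1) q0 by (intro power_strict_mono) auto
          moreover have "\<bar>I k (partial_deriv i \<mu> x) (Z \<omega>)\<bar> ^ q \<le> v"
            using S1[OF \<omega> that, of i] v by (simp add: ennreal_le_iff)
          ultimately show False using s(2) by simp
        qed
        then have "(I k (\<Delta> (\<theta> k \<omega>)) (Z \<omega>) / \<epsilon> k)\<^sup>2 \<le> C * (2 + v)"
          using pt[OF \<omega> s(1)] s(2) by metis
        then have "ennreal ((I k (\<Delta> (\<theta> k \<omega>)) (Z \<omega>) / \<epsilon> k)\<^sup>2) \<le> ennreal (C * (2 + v))" by (rule ennreal_leI)
        also have "\<dots> = ennreal C * (2 + S \<omega>)" using C v by (simp add: ennreal_mult v(1))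
        finally show ?thesis .
      qed
    qed
    also have "\<dots> = ennreal C * (2 + (\<integral>\<^sup>+\<omega>. S \<omega> \<partial>M))"
      by (simp add: nn_integral_cmult nn_integral_add emeasure_space_1)
    also have "\<dots> \<le> ennreal C * (2 + ennreal B)" by (intro mult_left_mono add_left_mono S2) simp
    also have "\<dots> = ennreal (C * (2 + B))" using C B(1) by (simp add: ennreal_mult)
    finally show "(\<integral>\<^sup>+\<omega>. ennreal ((I k (\<Delta> (\<theta> k \<omega>)) (Z \<omega>) / \<epsilon> k)\<^sup>2) \<partial>M) \<le> ennreal (C * (2 + B))" .
  qed
qed

lemma \<delta>_tendsto: "\<delta> \<longlonglongrightarrow> 0"
proof -
  have "(\<lambda>k. \<delta> k / (\<epsilon> k)\<^sup>2 * (\<epsilon> k)\<^sup>2) \<longlonglongrightarrow> 0 * 0\<^sup>2" by (intro tendsto_intros \<delta>_lim \<epsilon>_lim)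
  moreover have "\<delta> k / (\<epsilon> k)\<^sup>2 * (\<epsilon> k)\<^sup>2 = \<delta> k" for k using \<epsilon>_pos[of k] by simp
  ultimately show ?thesis by simp
qed

text \<open>The limiting score \<open>G\<close> has covariance matrix \<open>\<Sigma>\<close>, as the limit of its discretisations.\<close>

lemma G_covariance:
  "integrable M (\<lambda>\<omega>. G i (Z \<omega>) * G j (Z \<omega>))" "(\<integral>\<omega>. G i (Z \<omega>) * G j (Z \<omega>) \<partial>M) = bil (D i) (D j)"
proof -
  obtain \<kappa> where \<kappa>: "\<kappa> \<ge> 0" "\<And>s u. s \<in> T \<Longrightarrow> u \<in> T \<Longrightarrow> \<bar>K s u\<bar> \<le> \<kappa>" by (rule K_bounded) blast
  define C where "C l = normal_moment_const 2 * \<kappa>\<^sup>2 * norm (D l) ^ 4" for l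
  have C: "C l \<ge> 0" for l unfolding C_def using normal_moment_const_pos[of 2] by simp
  have m: "(\<lambda>\<omega>. I k (D l) (Z \<omega>)) \<in> borel_measurable M" for k l by (rule grid_sum_measurable[OF grid])
  have lim: "(\<lambda>k. I k (D i) (Z \<omega>) * I k (D j) (Z \<omega>)) \<longlonglongrightarrow> G i (Z \<omega>) * G j (Z \<omega>)" if "\<omega> \<in> space M" for \<omega>
    unfolding G_def by (intro tendsto_mult pairing_lim path_continuous that)
  have bnd: "(\<integral>\<^sup>+\<omega>. ennreal ((I k (D i) (Z \<omega>) * I k (D j) (Z \<omega>))\<^sup>2) \<partial>M) \<le> ennreal (C i + C j)" for k
  proof -
    have [measurable]: "(\<lambda>\<omega>. I k (D l) (Z \<omega>)) \<in> borel_measurable M" for l by (rule m)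
    have "(\<integral>\<^sup>+\<omega>. ennreal ((I k (D i) (Z \<omega>) * I k (D j) (Z \<omega>))\<^sup>2) \<partial>M)
        \<le> (\<integral>\<^sup>+\<omega>. ennreal (\<bar>I k (D i) (Z \<omega>)\<bar> ^ (2 * 2)) + ennreal (\<bar>I k (D j) (Z \<omega>)\<bar> ^ (2 * 2)) \<partial>M)"
    proof (rule nn_integral_mono)
      fix \<omega>
      have "(x * y)\<^sup>2 \<le> \<bar>x\<bar> ^ (2 * 2) + \<bar>y\<bar> ^ (2 * 2)" for x y :: real
        using square_mult_le_quartic[of x y] by simp
      then have "ennreal ((I k (D i) (Z \<omega>) * I k (D j) (Z \<omega>))\<^sup>2)
          \<le> ennreal (\<bar>I k (D i) (Z \<omega>)\<bar> ^ (2 * 2) + \<bar>I k (D j) (Z \<omega>)\<bar> ^ (2 * 2))"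
        by (rule ennreal_leI)
      then show "ennreal ((I k (D i) (Z \<omega>) * I k (D j) (Z \<omega>))\<^sup>2)
          \<le> ennreal (\<bar>I k (D i) (Z \<omega>)\<bar> ^ (2 * 2)) + ennreal (\<bar>I k (D j) (Z \<omega>)\<bar> ^ (2 * 2))"
        by (simp only: ennreal_plus[OF zero_le_power zero_le_power] abs_ge_zero)
    qed
    also have "\<dots> = (\<integral>\<^sup>+\<omega>. ennreal (\<bar>I k (D i) (Z \<omega>)\<bar> ^ (2 * 2)) \<partial>M) + (\<integral>\<^sup>+\<omega>. ennreal (\<bar>I k (D j) (Z \<omega>)\<bar> ^ (2 * 2)) \<partial>M)"
      by (rule nn_integral_add) measurable
    also have "\<dots> \<le> ennreal (C i) + ennreal (C j)"
      using grid_sum_moment[OF grid \<kappa>, where k = 2] by (intro add_mono) (auto simp: C_def)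
    also have "\<dots> = ennreal (C i + C j)" using C by (simp add: ennreal_plus)
    finally show ?thesis .
  qed
  note conv = convergence_of_means[OF prob borel_measurable_times[OF m m] lim bnd add_nonneg_nonneg[OF C C]]
  show "integrable M (\<lambda>\<omega>. G i (Z \<omega>) * G j (Z \<omega>))" by (rule conv(2))
  have "(\<lambda>k. grid_bil (N k) (g k) (D i) (D j)) \<longlonglongrightarrow> (\<integral>\<omega>. G i (Z \<omega>) * G j (Z \<omega>) \<partial>M)"
    using conv(3) by (simp add: grid_sum_product[OF grid])
  moreover have "(\<lambda>k. grid_bil (N k) (g k) (D i) (D j)) \<longlonglongrightarrow> bil (D i) (D j)"
  proof (rule LIM_zero_cancel, rule Lim_null_comparison)
    show "\<forall>\<^sub>F k in sequentially. norm (grid_bil (N k) (g k) (D i) (D j) - bil (D i) (D j)) \<le> 6 * \<delta> k * norm (D i) * norm (D j)"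
      using grid_bil_bil[OF grid N_pos osc] by simp
    have "(\<lambda>k. 6 * \<delta> k * norm (D i) * norm (D j)) \<longlonglongrightarrow> 6 * 0 * norm (D i) * norm (D j)"
      by (intro tendsto_intros \<delta>_tendsto)
    then show "(\<lambda>k. 6 * \<delta> k * norm (D i) * norm (D j)) \<longlonglongrightarrow> 0" by simp
  qed
  ultimately show "(\<integral>\<omega>. G i (Z \<omega>) * G j (Z \<omega>) \<partial>M) = bil (D i) (D j)" by (rule LIMSEQ_unique)
qed

lemma expected_overshoot:
  assumes max: "\<And>k \<omega>. \<omega> \<in> space M \<Longrightarrow> maximizes k (Z \<omega>) (\<theta> k \<omega>)"
    and meas: "\<And>k. \<theta> k \<in> borel_measurable M"
  shows "integrable M (\<lambda>\<omega>. contrast k (Z \<omega>) (\<theta> k \<omega>) - limit_contrast (\<theta> k \<omega>))"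
    and "(\<lambda>k. ((\<integral>\<omega>. contrast k (Z \<omega>) (\<theta> k \<omega>) - limit_contrast (\<theta> k \<omega>) \<partial>M) - real CARD('p) * (\<epsilon> k)\<^sup>2) / (\<epsilon> k)\<^sup>2) \<longlonglongrightarrow> 0"
proof -
  have \<theta>: "\<theta> k \<omega> \<in> \<Theta>" if "\<omega> \<in> space M" for k \<omega> using max[OF that, of k] by (simp add: maximizes_def)
  obtain R where R: "R \<ge> 0" "\<And>\<theta>. \<theta> \<in> \<Theta> \<Longrightarrow> norm (\<mu> \<theta>) \<le> R" by (rule \<mu>_bounded) blast
  obtain B where B: "B \<ge> 0"
    "\<And>k. (\<integral>\<^sup>+\<omega>. ennreal ((I k (\<Delta> (\<theta> k \<omega>)) (Z \<omega>) / \<epsilon> k)\<^sup>2) \<partial>M) \<le> ennreal B"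
  proof (rule noise_second_moment[of \<theta>])
    show "\<omega> \<in> space M \<Longrightarrow> maximizes k (Z \<omega>) (\<theta> k \<omega>)" for k \<omega> by (rule max)
  qed (rule that)
  obtain A where A: "(\<chi> i j. bil (D i) (D j)) ** A = (mat 1 :: real^'p^'p)"
    using regular unfolding invertible_def D_def by blast
  define Q where "Q k \<omega> = I k (\<Delta> (\<theta> k \<omega>)) (Z \<omega>) / \<epsilon> k" for k \<omega>
  have Qm: "Q k \<in> borel_measurable M" for k
    unfolding Q_def by (intro borel_measurable_divide borel_measurable_const noise_measurable meas \<theta>)
  have Ql: "(\<lambda>k. Q k \<omega>) \<longlonglongrightarrow> (\<Sum>i\<in>UNIV. \<Sum>j\<in>UNIV. A $ i $ j * (G i (Z \<omega>) * G j (Z \<omega>)))" if "\<omega> \<in> space M" for \<omega>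
    unfolding Q_def by (rule maximizer_noise_tendsto[OF path_continuous[OF that] max[OF that] A])
  note conv = convergence_of_means[OF prob Qm Ql B(2)[folded Q_def] B(1)]
  \<comment> \<open>The limit has mean \<open>tr(\<Sigma> A)\<close>, by the symmetry of \<open>\<Sigma>\<close>.\<close>
  have "(\<integral>\<omega>. (\<Sum>i\<in>UNIV. \<Sum>j\<in>UNIV. A $ i $ j * (G i (Z \<omega>) * G j (Z \<omega>))) \<partial>M) =
      (\<Sum>i\<in>UNIV. \<Sum>j\<in>UNIV. A $ i $ j * bil (D i) (D j))"
    by (simp add: Bochner_Integration.integral_sum Bochner_Integration.integrable_sum G_covariance)
  also have "\<dots> = (\<Sum>j\<in>UNIV. ((\<chi> i j. bil (D i) (D j)) ** A) $ j $ j)"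
    by (subst sum.swap) (simp add: matrix_matrix_mult_def bil_sym[of "D _" "D _"] mult.commute)
  also have "\<dots> = real CARD('p)" by (simp add: A mat_def)
  finally have EQ: "(\<lambda>k. \<integral>\<omega>. Q k \<omega> \<partial>M) \<longlonglongrightarrow> real CARD('p)" using conv(3) by simp
  define b where "b k \<omega> = bias k (\<theta> k \<omega>)" for k \<omega>
  have bm: "b k \<in> borel_measurable M" for k
    unfolding b_def by (rule measurable_compose_\<Theta>[OF bias_cont meas \<theta>])
  have b_le: "\<bar>b k \<omega>\<bar> \<le> 7 * R\<^sup>2 * \<delta> k" if "\<omega> \<in> space M" for k \<omega>
    unfolding b_def by (rule bias_le[OF R(2,1) \<theta>[OF that]])
  have bi: "integrable M (b k)" for k
    by (rule integrable_const_bound[OF _ bm, where B = "7 * R\<^sup>2 * \<delta> k"]) (auto simp: b_le)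
  have Ii: "integrable M (\<lambda>\<omega>. I k (\<mu> \<theta>\<^sub>0) (Z \<omega>))" "(\<integral>\<omega>. I k (\<mu> \<theta>\<^sub>0) (Z \<omega>) \<partial>M) = 0" for k
    using centered_normal_integrable[OF prob grid_sum_normal[OF grid], of k "\<mu> \<theta>\<^sub>0" 1]
      centered_normal_mean[OF prob grid_sum_normal[OF grid], of k "\<mu> \<theta>\<^sub>0"] by simp_all
  have eq: "contrast k (Z \<omega>) (\<theta> k \<omega>) - limit_contrast (\<theta> k \<omega>) = b k \<omega> + \<epsilon> k * I k (\<mu> \<theta>\<^sub>0) (Z \<omega>) + (\<epsilon> k)\<^sup>2 * Q k \<omega>" for k \<omega>
  proof -
    have "(\<epsilon> k)\<^sup>2 * Q k \<omega> = \<epsilon> k * I k (\<Delta> (\<theta> k \<omega>)) (Z \<omega>)"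
      using \<epsilon>_pos[of k] by (simp add: Q_def power2_eq_square)
    then show ?thesis by (simp add: contrast_eq b_def \<Delta>_def grid_sum_diff algebra_simps)
  qed
  show "integrable M (\<lambda>\<omega>. contrast k (Z \<omega>) (\<theta> k \<omega>) - limit_contrast (\<theta> k \<omega>))"
    unfolding eq by (intro Bochner_Integration.integrable_add integrable_mult_right bi Ii conv(1))
  have mean: "(\<integral>\<omega>. contrast k (Z \<omega>) (\<theta> k \<omega>) - limit_contrast (\<theta> k \<omega>) \<partial>M) = (\<integral>\<omega>. b k \<omega> \<partial>M) + (\<epsilon> k)\<^sup>2 * (\<integral>\<omega>. Q k \<omega> \<partial>M)" for k
    unfolding eq using bi[of k] Ii[of k] conv(1)[of k] by simp
  have "(\<lambda>k. (\<integral>\<omega>. b k \<omega> \<partial>M) / (\<epsilon> k)\<^sup>2) \<longlonglongrightarrow> 0"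
  proof (rule Lim_null_comparison)
    show "\<forall>\<^sub>F k in sequentially. norm ((\<integral>\<omega>. b k \<omega> \<partial>M) / (\<epsilon> k)\<^sup>2) \<le> 7 * R\<^sup>2 * (\<delta> k / (\<epsilon> k)\<^sup>2)"
    proof (intro always_eventually allI)
      fix k
      have "\<bar>\<integral>\<omega>. b k \<omega> \<partial>M\<bar> \<le> (\<integral>\<omega>. \<bar>b k \<omega>\<bar> \<partial>M)" by (rule integral_abs_bound)
      also have "\<dots> \<le> (\<integral>\<omega>. 7 * R\<^sup>2 * \<delta> k \<partial>M)" using bi[of k] b_le by (intro integral_mono) auto
      finally have "\<bar>\<integral>\<omega>. b k \<omega> \<partial>M\<bar> \<le> 7 * R\<^sup>2 * \<delta> k" by (simp add: prob_space)
      then show "norm ((\<integral>\<omega>. b k \<omega> \<partial>M) / (\<epsilon> k)\<^sup>2) \<le> 7 * R\<^sup>2 * (\<delta> k / (\<epsilon> k)\<^sup>2)"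
        using \<epsilon>_pos[of k] by (simp add: divide_right_mono)
    qed
    show "(\<lambda>k. 7 * R\<^sup>2 * (\<delta> k / (\<epsilon> k)\<^sup>2)) \<longlonglongrightarrow> 0" using tendsto_mult_left[OF \<delta>_lim, of "7 * R\<^sup>2"] by simp
  qed
  then have "(\<lambda>k. (\<integral>\<omega>. b k \<omega> \<partial>M) / (\<epsilon> k)\<^sup>2 + ((\<integral>\<omega>. Q k \<omega> \<partial>M) - real CARD('p))) \<longlonglongrightarrow> 0 + 0"
    by (intro tendsto_add LIM_zero EQ)
  moreover have "((\<integral>\<omega>. contrast k (Z \<omega>) (\<theta> k \<omega>) - limit_contrast (\<theta> k \<omega>) \<partial>M) - real CARD('p) * (\<epsilon> k)\<^sup>2) / (\<epsilon> k)\<^sup>2 =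
      (\<integral>\<omega>. b k \<omega> \<partial>M) / (\<epsilon> k)\<^sup>2 + ((\<integral>\<omega>. Q k \<omega> \<partial>M) - real CARD('p))" for k
    unfolding mean using \<epsilon>_pos[of k] by (simp add: add_divide_distrib diff_divide_distrib)
  ultimately show "(\<lambda>k. ((\<integral>\<omega>. contrast k (Z \<omega>) (\<theta> k \<omega>) - limit_contrast (\<theta> k \<omega>) \<partial>M) - real CARD('p) * (\<epsilon> k)\<^sup>2) / (\<epsilon> k)\<^sup>2) \<longlonglongrightarrow> 0"
    by simp
qed

end

section \<open>The essential supremum of the discretisation error\<close>

text \<open>Inside the open product cell the discretised kernel is constant, so that the difference is
  continuous there and its essential supremum is a supremum; it passes to the closure by continuity.\<close>

lemma (in continuous_kernel) cell_osc_Linf: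
  assumes g: "is_grid \<tau> n t"
    and d: "Linf_norm (T \<times> T) (\<lambda>(s, u). K_disc n t K s u - K s u) \<le> ereal d"
  shows "cell_osc n t d"
  unfolding cell_osc_def
proof (intro ballI)
  fix i j s u assume i: "i \<in> {1..n}" and j: "j \<in> {1..n}" and s: "s \<in> cell t i" and u: "u \<in> cell t j"
  let ?f = "\<lambda>(s, u). K_disc n t K s u - K s u"
  let ?h = "\<lambda>x. \<bar>K (t i) (t j) - (\<lambda>(s, u). K s u) x\<bar>"
  define U where "U = {t (i - 1)<..<t i} \<times> {t (j - 1)<..<t j}"
  have sub: "cell t i \<times> cell t j \<subseteq> T \<times> T" using cell_subset_interval[OF g i] cell_subset_interval[OF g j] by blast
  have U: "open U" "U \<subseteq> cell t i \<times> cell t j"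
    using cell_subset(2)[OF g i] cell_subset(2)[OF g j] by (auto simp: U_def intro: open_Times)
  have UT: "U \<subseteq> T \<times> T" using U sub by blast
  have h_cont: "continuous_on (T \<times> T) ?h" by (intro continuous_on_rabs continuous_on_diff continuous_on_const K_cont)
  have disc: "K_disc n t K s' u' = K (t i) (t j)" if "s' \<in> cell t i" "u' \<in> cell t j" for s' u'
  proof -
    have ind: "indicat_real (cell t i' \<times> cell t j') (s', u') = (if i' = i then if j' = j then 1 else 0 else 0)"
      if "i' \<in> {1..n}" "j' \<in> {1..n}" for i' j'
      using disjoint_family_onD[OF disjoint_cells[OF g] that(1) i] disjoint_family_onD[OF disjoint_cells[OF g] that(2) j]
        \<open>s' \<in> cell t i\<close> \<open>u' \<in> cell t j\<close> by (auto simp: indicator_def)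
    have "K_disc n t K s' u' = (\<Sum>i'=1..n. \<Sum>j'=1..n. if i' = i then if j' = j then K (t i') (t j') else 0 else 0)"
      unfolding K_disc_def by (intro sum.cong refl) (simp add: ind)
    also have "\<dots> = (\<Sum>i'=1..n. if i' = i then \<Sum>j'=1..n. if j' = j then K (t i') (t j') else 0 else 0)"
      by (intro sum.cong refl) auto
    also have "\<dots> = K (t i) (t j)" using i j by (simp add: sum.delta)
    finally show ?thesis .
  qed
  have "AE x in restrict_space lborel (T \<times> T). ereal \<bar>?f x\<bar> \<le> ereal d"
    by (rule eventually_mono[OF esssup_AE order_trans[OF _ d[unfolded Linf_norm_def]]])
  moreover have "T \<times> T \<in> sets (borel :: (real \<times> real) measure)" by (intro borel_closed closed_Times) auto
  ultimately have ae: "AE x in lborel. x \<in> T \<times> T \<longrightarrow> \<bar>?f x\<bar> \<le> d"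
    by (subst (asm) AE_restrict_space_iff) auto
  define V where "V = U \<inter> ?h -` {d<..}"
  have V: "open V" unfolding V_def
    by (intro continuous_open_preimage continuous_on_subset[OF h_cont UT] U(1)) auto
  have "AE x in lborel. x \<notin> V"
    using ae
  proof eventually_elim
    case (elim x)
    show ?case
    proof
      assume x: "x \<in> V"
      then have "?f x = K (t i) (t j) - (\<lambda>(s, u). K s u) x" using U(2) disc by (auto simp: V_def)
      then show False using x UT elim by (auto simp: V_def)
    qed
  qed
  then have "V \<in> null_sets lborel" using V by (subst AE_iff_null_sets) auto
  then have "negligible V" unfolding negligible_iff_null_sets by (rule null_sets_completionI)
  then have "V = {}" using open_not_negligible[OF V] by blast
  then have "U \<subseteq> {x \<in> T \<times> T. ?h x \<le> d}" using UT unfolding V_def by fastforce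
  moreover have "closed {x \<in> T \<times> T. ?h x \<le> d}"
    by (intro continuous_on_closed_Collect_le h_cont continuous_on_const closed_Times closed_atLeastAtMost)
  ultimately have "closure U \<subseteq> {x \<in> T \<times> T. ?h x \<le> d}" by (rule closure_minimal)
  moreover have "(s, u) \<in> closure U"
    using s u cell_subset(1)[OF g i] cell_subset(1)[OF g j] cell_subset(3)[OF g i] cell_subset(3)[OF g j]
    by (auto simp: U_def closure_Times)
  ultimately show "\<bar>K (t i) (t j) - K s u\<bar> \<le> d" by auto
qed

text \<open>Where the essential supremum is infinite, the trivial bound \<open>2 \<kappa>\<close> serves as \<open>\<delta>\<close>; by the
  hypothesis this occurs for finitely many \<open>k\<close> only.\<close>

lemma (in continuous_kernel) Linf_cell_osc_sequence:
  assumes g: "\<And>k. is_grid \<tau> (N k) (g k)" and e: "\<And>k. e k > 0"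
    and lim: "(\<lambda>k. ereal (1 / e k) * Linf_norm (T \<times> T) (\<lambda>(s, u). K_disc (N k) (g k) K s u - K s u)) \<longlonglongrightarrow> 0"
  obtains \<delta> where "\<And>k. cell_osc (N k) (g k) (\<delta> k)" "(\<lambda>k. \<delta> k / e k) \<longlonglongrightarrow> 0"
proof -
  define \<Lambda> where "\<Lambda> k = Linf_norm (T \<times> T) (\<lambda>(s, u). K_disc (N k) (g k) K s u - K s u)" for k
  obtain \<kappa> where \<kappa>: "\<kappa> \<ge> 0" "\<And>s u. s \<in> T \<Longrightarrow> u \<in> T \<Longrightarrow> \<bar>K s u\<bar> \<le> \<kappa>" by (rule K_bounded) blast
  define \<delta> where "\<delta> k = (if \<Lambda> k = \<infinity> then 2 * \<kappa> else real_of_ereal (\<Lambda> k))" for k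
  show thesis
  proof (rule that[of \<delta>])
    show "cell_osc (N k) (g k) (\<delta> k)" for k
    proof (cases "\<Lambda> k = \<infinity>")
      case True
      have "\<bar>K (g k i) (g k j) - K s u\<bar> \<le> 2 * \<kappa>"
        if "i \<in> {1..N k}" "j \<in> {1..N k}" "s \<in> cell (g k) i" "u \<in> cell (g k) j" for i j s u
      proof -
        have "s \<in> T" "u \<in> T"
          using subsetD[OF cell_subset_interval[OF g that(1)] that(3)]
            subsetD[OF cell_subset_interval[OF g that(2)] that(4)] by simp_all
        moreover have "g k i \<in> T" "g k j \<in> T" using grid_range[OF g, of i k] grid_range[OF g, of j k] that(1,2) by simp_all
        ultimately show ?thesis using \<kappa>(2)[of "g k i" "g k j"] \<kappa>(2)[of s u] by linarith
      qed
      then show ?thesis using True by (simp add: cell_osc_def \<delta>_def)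
    next
      case False
      then have "\<Lambda> k \<le> ereal (\<delta> k)" by (cases "\<Lambda> k") (auto simp: \<delta>_def)
      then show ?thesis unfolding \<Lambda>_def by (rule cell_osc_Linf[OF g])
    qed
    have "\<forall>\<^sub>F k in sequentially. ereal (1 / e k) * \<Lambda> k < 1"
      using lim unfolding \<Lambda>_def by (rule order_tendstoD) simp
    then have ev: "\<forall>\<^sub>F k in sequentially. real_of_ereal (ereal (1 / e k) * \<Lambda> k) = \<delta> k / e k"
    proof eventually_elim
      case (elim k)
      then have "\<Lambda> k \<noteq> \<infinity>" using e[of k] by auto
      then show ?case by (simp add: \<delta>_def)
    qed
    have "(\<lambda>k. real_of_ereal (ereal (1 / e k) * \<Lambda> k)) \<longlonglongrightarrow> 0"
      using lim unfolding \<Lambda>_def zero_ereal_def by (rule lim_real_of_ereal)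
    from Lim_transform_eventually[OF this ev] show "(\<lambda>k. \<delta> k / e k) \<longlonglongrightarrow> 0" .
  qed
qed

section \<open>The expansion\<close>

theorem theorem3p36:
  fixes M :: "'w measure" and Z :: "'w \<Rightarrow> real \<Rightarrow> real"
    and \<tau> :: real and T :: "real set" and K :: "real \<Rightarrow> real \<Rightarrow> real"
    and t :: "nat \<Rightarrow> nat \<Rightarrow> real"
    and \<Theta> :: "(real^'p) set" and \<theta>\<^sub>0 :: "real^'p"
    and \<mu> :: "real^'p \<Rightarrow> real signed_measure"
    and h\<^sub>0 :: "real \<Rightarrow> real" and X :: "real \<Rightarrow> 'w \<Rightarrow> real \<Rightarrow> real"
    and \<epsilon> :: "nat \<Rightarrow> real" and n :: "nat \<Rightarrow> nat"
    and \<theta>hat :: "nat \<Rightarrow> real \<Rightarrow> 'w \<Rightarrow> real^'p"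
  assumes "prob_space M" and "\<tau> > 0" and T_def: "T = {0..\<tau>}"
    and "centered_gaussian_vector M T Z"
    and K_def: "K = cov_fun M Z"
    and grid: "\<And>m. m \<ge> 1 \<Longrightarrow> is_grid \<tau> m (t m)"
    and mesh: "(\<lambda>m. mesh m (t m)) \<longlonglongrightarrow> 0"
    and "compact \<Theta>" and "convex \<Theta>" and "smooth_boundary \<Theta>"
    and "\<theta>\<^sub>0 \<in> interior \<Theta>"
    and "\<And>\<theta>. \<theta> \<in> \<Theta> \<Longrightarrow> \<mu> \<theta> \<in> measures_on T"
    and "continuous_on \<Theta> \<mu>" and "Ck_on 2 \<Theta> \<mu>" and "Ck_on 3 \<Theta> \<mu>"
    and identifiable: "\<And>\<theta>. \<theta> \<in> \<Theta> \<Longrightarrow>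
      (\<forall>s\<in>T. cov_op T K (\<mu> \<theta>) s = cov_op T K (\<mu> \<theta>\<^sub>0) s) \<Longrightarrow> \<theta> = \<theta>\<^sub>0"
    and regular: "invertible (\<chi> i j.
      pairing T (partial_deriv i \<mu> \<theta>\<^sub>0) (cov_op T K (partial_deriv j \<mu> \<theta>\<^sub>0)) :: real^'p^'p)"
    and h\<^sub>0_def: "h\<^sub>0 = cov_op T K (\<mu> \<theta>\<^sub>0)"
    and X_def: "X = (\<lambda>e \<omega> s. h\<^sub>0 s + e * Z \<omega> s)"
    and "\<And>k. \<epsilon> k > 0" and "\<And>k. n k \<ge> 1"
    and "\<epsilon> \<longlonglongrightarrow> 0" and "filterlim n at_top sequentially"
    and "(\<lambda>k. ereal (1 / \<epsilon> k) *
      Linf_norm (T \<times> T) (\<lambda>(s, u). K_disc (n k) (t (n k)) K s u - K s u)) \<longlonglongrightarrow> 0"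
    and "(\<lambda>k. ereal (1 / (\<epsilon> k)^2) *
      Linf_norm (T \<times> T) (\<lambda>(s, u). K_disc (n k) (t (n k)) K s u - K s u)) \<longlonglongrightarrow> 0"
    and "\<And>k. \<theta>hat (n k) (\<epsilon> k) \<in> borel_measurable M"
    and "\<And>k \<omega>. \<omega> \<in> space M \<Longrightarrow> \<theta>hat (n k) (\<epsilon> k) \<omega> \<in> \<Theta>"
    and maximizer: "\<And>k \<omega> \<theta>. \<omega> \<in> space M \<Longrightarrow> \<theta> \<in> \<Theta> \<Longrightarrow>
      Phi_disc (n k) (t (n k)) K (X (\<epsilon> k) \<omega>) (\<mu> \<theta>) \<le>
      Phi_disc (n k) (t (n k)) K (X (\<epsilon> k) \<omega>) (\<mu> (\<theta>hat (n k) (\<epsilon> k) \<omega>))"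
  shows "(\<forall>k. integrable M (\<lambda>\<omega>.
      Phi_disc (n k) (t (n k)) K (X (\<epsilon> k) \<omega>) (\<mu> (\<theta>hat (n k) (\<epsilon> k) \<omega>)) -
      Phi_lim T K h\<^sub>0 (\<mu> (\<theta>hat (n k) (\<epsilon> k) \<omega>)))) \<and>
    (\<lambda>k. (\<integral>\<omega>.
      Phi_disc (n k) (t (n k)) K (X (\<epsilon> k) \<omega>) (\<mu> (\<theta>hat (n k) (\<epsilon> k) \<omega>)) -
      Phi_lim T K h\<^sub>0 (\<mu> (\<theta>hat (n k) (\<epsilon> k) \<omega>)) \<partial>M) - real CARD('p) * (\<epsilon> k)^2)
      \<in> o(\<lambda>k. (\<epsilon> k)^2)"
proof -
  interpret gaussian_process M Z \<tau> K
    by (rule gaussian_process.intro[OF assms(1,2) assms(4)[unfolded T_def] K_def])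
  interpret gaussian_model M Z \<tau> K \<Theta> \<theta>\<^sub>0 \<mu>
  proof
    show "compact \<Theta>" "convex \<Theta>" "\<theta>\<^sub>0 \<in> interior \<Theta>" "continuous_on \<Theta> \<mu>" "Ck_on 2 \<Theta> \<mu>" by fact+
    show "\<theta> = \<theta>\<^sub>0" if "\<theta> \<in> \<Theta>" "\<forall>s\<in>{0..\<tau>}. cov_op {0..\<tau>} K (\<mu> \<theta>) s = cov_op {0..\<tau>} K (\<mu> \<theta>\<^sub>0) s" for \<theta>
      using identifiable[OF that(1)] that(2) unfolding T_def .
    show "invertible (\<chi> i j. bil (partial_deriv i \<mu> \<theta>\<^sub>0) (partial_deriv j \<mu> \<theta>\<^sub>0) :: real^'p^'p)"
      using regular unfolding T_def bil_def .
  qed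
  have g: "is_grid \<tau> (n k) (t (n k))" for k by (rule grid[OF assms(21)])
  obtain \<delta> where \<delta>: "\<And>k. cell_osc (n k) (t (n k)) (\<delta> k)" "(\<lambda>k. \<delta> k / (\<epsilon> k)\<^sup>2) \<longlonglongrightarrow> 0"
  proof (rule Linf_cell_osc_sequence[OF g, of "\<lambda>k. (\<epsilon> k)\<^sup>2"])
    show "(\<epsilon> k)\<^sup>2 > 0" for k using assms(20)[of k] by simp
    show "(\<lambda>k. ereal (1 / (\<epsilon> k)\<^sup>2) * Linf_norm ({0..\<tau>} \<times> {0..\<tau>})
        (\<lambda>(s, u). K_disc (n k) (t (n k)) K s u - K s u)) \<longlonglongrightarrow> 0"
      using assms(25) unfolding T_def .
  qed (rule that)
  interpret gaussian_model_sequence M Z \<tau> K \<Theta> \<theta>\<^sub>0 \<mu> n "\<lambda>k. t (n k)" \<epsilon> \<delta>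
  proof
    fix \<nu> and x :: "real \<Rightarrow> real" assume "continuous_on {0..\<tau>} x"
    from filterlim_compose[OF grid_sum_tendsto[OF grid mesh this] assms(23)]
    show "(\<lambda>k. grid_sum (n k) (t (n k)) \<nu> x) \<longlonglongrightarrow> pairing {0..\<tau>} \<nu> x" .
  qed (fact g \<delta> assms(20-22))+
  have contrast: "Phi_disc (n k) (t (n k)) K (X (\<epsilon> k) \<omega>) (\<mu> \<theta>) = contrast k (Z \<omega>) \<theta>"
    "Phi_lim T K h\<^sub>0 (\<mu> \<theta>) = limit_contrast \<theta>" for k \<omega> \<theta>
    by (simp_all add: contrast_def limit_contrast_def X_def h\<^sub>0_def T_def)
  have max: "maximizes k (Z \<omega>) (\<theta>hat (n k) (\<epsilon> k) \<omega>)" if "\<omega> \<in> space M" for k \<omega>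
    using maximizer[OF that, of _ k] assms(27)[OF that, of k] unfolding maximizes_def contrast by simp
  note result = expected_overshoot[where \<theta> = "\<lambda>k. \<theta>hat (n k) (\<epsilon> k)", OF max assms(26)]
  show ?thesis
    unfolding contrast
  proof (intro conjI allI)
    show "integrable M (\<lambda>\<omega>. contrast k (Z \<omega>) (\<theta>hat (n k) (\<epsilon> k) \<omega>) - limit_contrast (\<theta>hat (n k) (\<epsilon> k) \<omega>))" for k
      by (rule result(1))
    show "(\<lambda>k. (\<integral>\<omega>. contrast k (Z \<omega>) (\<theta>hat (n k) (\<epsilon> k) \<omega>) - limit_contrast (\<theta>hat (n k) (\<epsilon> k) \<omega>) \<partial>M)
        - real CARD('p) * (\<epsilon> k)\<^sup>2) \<in> o(\<lambda>k. (\<epsilon> k)\<^sup>2)"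
      by (rule smalloI_tendsto[OF result(2)]) (use assms(20) in \<open>auto simp: less_imp_neq[symmetric]\<close>)
  qed
qed

end
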